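(* Let $X$ be a compact topological space, let $\mathcal{E}$ and $\mathcal{F}$ be Banach bundles over $X$, and let $L\in\mathfrak{F}(\mathcal{E},\mathcal{F})$ be a Fredholm morphism. If $\mathcal{V},\mathcal{W}\subset\mathcal{F}$ are two finite dimensional subbundles that are transversal to the image of $L$, i.e. $\operatorname{im}(L_\lambda)+\mathcal{V}_\lambda=\mathcal{F}_\lambda$ and $\operatorname{im}(L_\lambda)+\mathcal{W}_\lambda=\mathcal{F}_\lambda$ for all $\lambda\in X$, then $$[E(L,\mathcal{V})]-[\mathcal{V}]=[E(L,\mathcal{W})]-[\mathcal{W}]\in K(X).$$
   Context: Scalars are $\mathbb{K}=\mathbb{R}$ or $\mathbb{C}$; $K(X)$ denotes the Grothendieck group of finite dimensional $\mathbb{K}$-vector bundles over $X$ (so $K(X)$ means $KO(X)$ in the real case). Compact spaces are understood to be Hausdorff. A Banach bundle $\mathcal{E}$ over $X$ is a locally trivial bundle with fibres $\mathcal{E}_\lambda$, $\lambda\in X$, isomorphic to a fixed model Banach space, with transition functions that are continuous into the bounded invertible operators with the norm topology. $\mathcal{L}(\mathcal{E},\mathcal{F})$ denotes the bundle morphisms over the identity of $X$, i.e. fibrewise bounded linear maps $L_\lambda:\mathcal{E}_\lambda\to\mathcal{F}_\lambda$ which in local trivialisations are norm-continuous families of bounded operators. $\mathfrak{F}_k(\mathcal{E},\mathcal{F})$ is the set of morphisms for which each $L_\lambda$ is a bounded Fredholm operator of index $k$, and $\mathfrak{F}(\mathcal{E},\mathcal{F})=\bigcup_{k\in\mathbb{Z}}\mathfrak{F}_k(\mathcal{E},\mathcal{F})$;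 its elements are called Fredholm morphisms. For a finite dimensional subbundle $\mathcal{V}\subset\mathcal{F}$ transversal to the image of $L$, $E(L,\mathcal{V})$ is the finite dimensional subbundle of $\mathcal{E}$ with fibres $E(L,\mathcal{V})_\lambda=\{u\in\mathcal{E}_\lambda: L_\lambda u\in\mathcal{V}_\lambda\}$; equivalently, it is the kernel of the surjective bundle morphism $(I-P)L:\mathcal{E}\to\operatorname{im}(I-P)$, where $P\in\mathcal{L}(\mathcal{F},\mathcal{F})$ is an idempotent morphism with $\operatorname{im}P=\mathcal{V}$. Its fibres have dimension $\operatorname{ind}(L_\lambda)+\dim\mathcal{V}_\lambda$. *)

theory Defs
  imports "HOL-Analysis.Analysis" "HOL-Algebra.Group" "HOL-Library.Function_Algebras"
begin

text \<open>The scalar field is \<open>\<real>\<close> or \<open>\<complex>\<close>: the element \<open>j\<close> below is \<open>0\<close> in the first case and an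
  imaginary unit in the second.  A multiplicative norm extending the one of \<open>\<real>\<close> is the usual
  absolute value in both cases.\<close>

class real_or_complex = real_normed_field +
  assumes ex_imaginary_unit:
    "\<exists>j. (j = 0 \<or> j * j = - 1) \<and> (\<forall>z. \<exists>a b. z = scaleR a 1 + scaleR b j)"

instance real :: real_or_complex
proof
  show "\<exists>j::real. (j = 0 \<or> j * j = - 1) \<and> (\<forall>z. \<exists>a b. z = scaleR a 1 + scaleR b j)"
    by (intro exI[of _ 0]) auto
qed

instance complex :: real_or_complex
proof
  show "\<exists>j::complex. (j = 0 \<or> j * j = - 1) \<and> (\<forall>z. \<exists>a b. z = scaleR a 1 + scaleR b j)"
  proof (intro exI[of _ \<i>] conjI allI)
    fix z :: complex
    show "\<exists>a b. z = a *\<^sub>R 1 + b *\<^sub>R \<i>"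
      by (intro exI[of _ "Re z"] exI[of _ "Im z"]) (simp add: complex_eq_iff)
  qed simp
qed

definition K_banach_space :: "('k::real_or_complex \<Rightarrow> 'm::banach \<Rightarrow> 'm) \<Rightarrow> bool" where
  "K_banach_space s \<longleftrightarrow> vector_space s
     \<and> (\<forall>r x. s (of_real r) x = r *\<^sub>R x)
     \<and> (\<forall>a x. norm (s a x) = norm a * norm x)"

definition linear_between ::
  "('k \<Rightarrow> 'e::ab_group_add \<Rightarrow> 'e) \<Rightarrow> ('k \<Rightarrow> 'f::ab_group_add \<Rightarrow> 'f) \<Rightarrow> 'e set \<Rightarrow> 'f set \<Rightarrow> ('e \<Rightarrow> 'f) \<Rightarrow> bool"
  where
  "linear_between s t A B f \<longleftrightarrow> (\<forall>u\<in>A. f u \<in> B)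
     \<and> (\<forall>u\<in>A. \<forall>v\<in>A. f (u + v) = f u + f v)
     \<and> (\<forall>a. \<forall>u\<in>A. f (s a u) = t a (f u))"

definition has_dim :: "('k::field \<Rightarrow> 'e::ab_group_add \<Rightarrow> 'e) \<Rightarrow> 'e set \<Rightarrow> nat \<Rightarrow> bool" where
  "has_dim s V n \<longleftrightarrow>
     (\<exists>B. finite B \<and> card B = n \<and> \<not> module.dependent s B \<and> module.span s B = V)"

definition has_codim ::
  "('k::field \<Rightarrow> 'e::ab_group_add \<Rightarrow> 'e) \<Rightarrow> 'e set \<Rightarrow> 'e set \<Rightarrow> nat \<Rightarrow> bool" where
  "has_codim s W V n \<longleftrightarrow>
     (\<exists>C. has_dim s C n \<and> C \<subseteq> V \<and> W \<inter> C = {0} \<and> V = {w + c |w c. w \<in> W \<and> c \<in> C})"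

text \<open>Boundedness is part of the notion of bundle morphism below; closedness of the image is then
  automatic.\<close>

definition fredholm_of_index ::
  "('k::field \<Rightarrow> 'e::ab_group_add \<Rightarrow> 'e) \<Rightarrow> ('k \<Rightarrow> 'f::ab_group_add \<Rightarrow> 'f) \<Rightarrow>
   'e set \<Rightarrow> 'f set \<Rightarrow> int \<Rightarrow> ('e \<Rightarrow> 'f) \<Rightarrow> bool" where
  "fredholm_of_index s t A B k f \<longleftrightarrow>
     (\<exists>m n. has_dim s {u \<in> A. f u = 0} m \<and> has_codim t (f ` A) B n \<and> k = int m - int n)"

text \<open>The fibres are linear subspaces of one ambient vector space type \<open>'e\<close>, which carries no
  topology and does not relate different fibres to each other (it may be taken to be the direct
  sum of all fibres).  The topology of the fibres and the bundle structure come from the atlas, a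
  set of pairs \<open>(U, \<phi>)\<close> with \<open>\<phi> x\<close> an isomorphism of the fibre over \<open>x \<in> U\<close> onto the model
  space \<open>'m\<close>.\<close>

record ('k, 'x, 'e, 'm) banach_bundle =
  smult_fib :: "'k \<Rightarrow> 'e \<Rightarrow> 'e"
  smult_model :: "'k \<Rightarrow> 'm \<Rightarrow> 'm"
  fib :: "'x \<Rightarrow> 'e set"
  atlas :: "('x set \<times> ('x \<Rightarrow> 'e \<Rightarrow> 'm)) set"

text \<open>Over \<open>U\<close>, the maps \<open>L x\<close>, read in the trivialisations \<open>\<phi>\<close> and \<open>\<psi>\<close>, are a norm-continuous
  family of bounded operators.\<close>

definition norm_continuous_in ::
  "'x topology \<Rightarrow> 'x set \<Rightarrow> ('x \<Rightarrow> 'e set) \<Rightarrow> ('x \<Rightarrow> 'e \<Rightarrow> 'm::real_normed_vector) \<Rightarrow>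
   ('x \<Rightarrow> 'f \<Rightarrow> 'n::real_normed_vector) \<Rightarrow> ('x \<Rightarrow> 'e \<Rightarrow> 'f) \<Rightarrow> bool" where
  "norm_continuous_in X U A \<phi> \<psi> L \<longleftrightarrow>
     (\<exists>T :: 'x \<Rightarrow> 'm \<Rightarrow>\<^sub>L 'n. continuous_map (subtopology X U) euclidean T
        \<and> (\<forall>x\<in>U. \<forall>u\<in>A x. \<psi> x (L x u) = blinfun_apply (T x) (\<phi> x u)))"

definition local_trivialisation ::
  "'x topology \<Rightarrow> ('k::real_or_complex, 'x, 'e::ab_group_add, 'm::banach) banach_bundle \<Rightarrow>
   'x set \<Rightarrow> ('x \<Rightarrow> 'e \<Rightarrow> 'm) \<Rightarrow> bool" where
  "local_trivialisation X E U \<phi> \<longleftrightarrow> openin X U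
     \<and> (\<forall>x\<in>U. linear_between (smult_fib E) (smult_model E) (fib E x) UNIV (\<phi> x)
            \<and> bij_betw (\<phi> x) (fib E x) UNIV)
     \<and> (\<forall>(V, \<psi>)\<in>atlas E.
           norm_continuous_in X (U \<inter> V) (fib E) \<phi> \<psi> (\<lambda>x u. u)
         \<and> norm_continuous_in X (U \<inter> V) (fib E) \<psi> \<phi> (\<lambda>x u. u))"

definition is_banach_bundle ::
  "'x topology \<Rightarrow> ('k::real_or_complex, 'x, 'e::ab_group_add, 'm::banach) banach_bundle \<Rightarrow> bool"
  where
  "is_banach_bundle X E \<longleftrightarrow> vector_space (smult_fib E) \<and> K_banach_space (smult_model E)
     \<and> (\<forall>x\<in>topspace X. module.subspace (smult_fib E) (fib E x))
     \<and> (\<forall>(U, \<phi>)\<in>atlas E. local_trivialisation X E U \<phi>)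
     \<and> (\<Union>(U, \<phi>)\<in>atlas E. U) = topspace X"

definition total_space ::
  "'x topology \<Rightarrow> ('k, 'x, 'e, 'm::topological_space) banach_bundle \<Rightarrow> ('x \<times> 'e) topology" where
  "total_space X E = topology_generated_by
     {{(x, u). x \<in> W \<and> u \<in> fib E x \<and> \<phi> x u \<in> N} |U \<phi> W N.
        (U, \<phi>) \<in> atlas E \<and> openin X W \<and> W \<subseteq> U \<and> open N}"

definition bundle_morphism ::
  "'x topology \<Rightarrow> ('k::real_or_complex, 'x, 'e::ab_group_add, 'm::banach) banach_bundle \<Rightarrow>
   ('k, 'x, 'f::ab_group_add, 'n::banach) banach_bundle \<Rightarrow> ('x \<Rightarrow> 'e \<Rightarrow> 'f) \<Rightarrow> bool" where
  "bundle_morphism X E F L \<longleftrightarrow>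
     (\<forall>x\<in>topspace X. linear_between (smult_fib E) (smult_fib F) (fib E x) (fib F x) (L x))
     \<and> (\<forall>(U, \<phi>)\<in>atlas E. \<forall>(V, \<psi>)\<in>atlas F. norm_continuous_in X (U \<inter> V) (fib E) \<phi> \<psi> L)"

definition fredholm_morphism_of_index ::
  "'x topology \<Rightarrow> ('k::real_or_complex, 'x, 'e::ab_group_add, 'm::banach) banach_bundle \<Rightarrow>
   ('k, 'x, 'f::ab_group_add, 'n::banach) banach_bundle \<Rightarrow> int \<Rightarrow> ('x \<Rightarrow> 'e \<Rightarrow> 'f) \<Rightarrow> bool" where
  "fredholm_morphism_of_index X E F k L \<longleftrightarrow> bundle_morphism X E F L
     \<and> (\<forall>x\<in>topspace X.
          fredholm_of_index (smult_fib E) (smult_fib F) (fib E x) (fib F x) k (L x))"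

definition fredholm_morphism ::
  "'x topology \<Rightarrow> ('k::real_or_complex, 'x, 'e::ab_group_add, 'm::banach) banach_bundle \<Rightarrow>
   ('k, 'x, 'f::ab_group_add, 'n::banach) banach_bundle \<Rightarrow> ('x \<Rightarrow> 'e \<Rightarrow> 'f) \<Rightarrow> bool" where
  "fredholm_morphism X E F L \<longleftrightarrow> (\<exists>k. fredholm_morphism_of_index X E F k L)"

text \<open>Locally, \<open>V\<close> corresponds in a trivialisation of \<open>F\<close> to a constant finite dimensional subspace
  (automatically complemented) of the model space.  The dimension is locally constant.\<close>

definition finite_dim_subbundle ::
  "'x topology \<Rightarrow> ('k::real_or_complex, 'x, 'f::ab_group_add, 'n::banach) banach_bundle \<Rightarrow>
   ('x \<Rightarrow> 'f set) \<Rightarrow> bool" where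
  "finite_dim_subbundle X F V \<longleftrightarrow> (\<forall>x\<in>topspace X. V x \<subseteq> fib F x)
     \<and> (\<forall>x\<in>topspace X. \<exists>U \<phi> M n. x \<in> U \<and> local_trivialisation X F U \<phi>
           \<and> has_dim (smult_model F) M n \<and> (\<forall>y\<in>U. \<phi> y ` V y = M))"

definition transversal_to_image ::
  "'x topology \<Rightarrow> ('k, 'x, 'e, 'm) banach_bundle \<Rightarrow> ('k, 'x, 'f::ab_group_add, 'n) banach_bundle \<Rightarrow>
   ('x \<Rightarrow> 'e \<Rightarrow> 'f) \<Rightarrow> ('x \<Rightarrow> 'f set) \<Rightarrow> bool" where
  "transversal_to_image X E F L V \<longleftrightarrow>
     (\<forall>x\<in>topspace X. {w + v |w v. w \<in> L x ` fib E x \<and> v \<in> V x} = fib F x)"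

definition preimage_subbundle ::
  "('k, 'x, 'e, 'm) banach_bundle \<Rightarrow> ('x \<Rightarrow> 'e \<Rightarrow> 'f) \<Rightarrow> ('x \<Rightarrow> 'f set) \<Rightarrow> 'x \<Rightarrow> 'e set" where
  "preimage_subbundle E L V x = {u \<in> fib E x. L x u \<in> V x}"

text \<open>A finite dimensional vector bundle is given by the topology \<open>T\<close> of its total space, whose
  points are pairs \<open>(x, u)\<close> with \<open>u\<close> in the fibre over \<open>x\<close>; again the fibres are subspaces of an
  ambient vector space.  A local trivialisation \<open>U \<times> K\<^sup>n \<rightarrow> T|U\<close> that is linear on fibres is the
  same thing as a frame \<open>e\<close> through which it is written.\<close>

definition is_vector_bundle ::
  "('k::real_or_complex \<Rightarrow> 'e::ab_group_add \<Rightarrow> 'e) \<Rightarrow> 'x topology \<Rightarrow> ('x \<times> 'e) topology \<Rightarrow> bool" where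
  "is_vector_bundle s X T \<longleftrightarrow> vector_space s \<and> topspace T \<subseteq> topspace X \<times> UNIV
     \<and> (\<forall>x\<in>topspace X. \<exists>U (n::nat) (e :: nat \<Rightarrow> 'x \<Rightarrow> 'e). openin X U \<and> x \<in> U
          \<and> homeomorphic_map
               (prod_topology (subtopology X U)
                  (product_topology (\<lambda>_. euclidean :: 'k topology) {..<n}))
               (subtopology T (U \<times> UNIV))
               (\<lambda>(y, a). (y, \<Sum>i<n. s (a i) (e i y))))"

definition bundle_isomorphic ::
  "('k \<Rightarrow> 'e::ab_group_add \<Rightarrow> 'e) \<Rightarrow> ('k \<Rightarrow> 'f::ab_group_add \<Rightarrow> 'f) \<Rightarrow>
   ('x \<times> 'e) topology \<Rightarrow> ('x \<times> 'f) topology \<Rightarrow> bool" where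
  "bundle_isomorphic s t T T' \<longleftrightarrow> (\<exists>h. homeomorphic_map T T' (\<lambda>(x, u). (x, h x u))
     \<and> (\<forall>x. linear_between s t {u. (x, u) \<in> topspace T} {v. (x, v) \<in> topspace T'} (h x)))"

definition subbundle_space ::
  "'x topology \<Rightarrow> ('k, 'x, 'e, 'm::topological_space) banach_bundle \<Rightarrow> ('x \<Rightarrow> 'e set) \<Rightarrow>
   ('x \<times> 'e) topology" where
  "subbundle_space X E V = subtopology (total_space X E) (SIGMA x:topspace X. V x)"

definition smult_pair ::
  "('k \<Rightarrow> 'e \<Rightarrow> 'e) \<Rightarrow> ('k \<Rightarrow> 'f \<Rightarrow> 'f) \<Rightarrow> 'k \<Rightarrow> 'e \<times> 'f \<Rightarrow> 'e \<times> 'f" where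
  "smult_pair s t a = (\<lambda>(u, v). (s a u, t a v))"

definition whitney_sum ::
  "('x \<times> 'e) topology \<Rightarrow> ('x \<times> 'f) topology \<Rightarrow> ('x \<times> ('e \<times> 'f)) topology" where
  "whitney_sum T T' =
     pullback_topology UNIV (\<lambda>(x, (u, v)). ((x, u), (x, v))) (prod_topology T T')"

text \<open>To form a set of isomorphism classes one has to fix a type for the fibres.  With fibres in the
  space of all sequences of scalars, every finite dimensional vector bundle, whatever its ambient
  space, is isomorphic to one of the bundles considered: choose a basis of each fibre and transport
  the topology.\<close>

definition smult_seq :: "'k::field \<Rightarrow> (nat \<Rightarrow> 'k) \<Rightarrow> (nat \<Rightarrow> 'k)" where
  "smult_seq a f = (\<lambda>i. a * f i)"

definition Vect :: "'x topology \<Rightarrow> ('x \<times> (nat \<Rightarrow> 'k::real_or_complex)) topology set" where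
  "Vect X = {T. is_vector_bundle smult_seq X T}"

text \<open>\<open>T\<close> may have any ambient space; the class is empty if \<open>T\<close> is not a vector bundle over
  \<open>X\<close>.\<close>

definition iso_class ::
  "'x topology \<Rightarrow> ('k::real_or_complex \<Rightarrow> 'e::ab_group_add \<Rightarrow> 'e) \<Rightarrow> ('x \<times> 'e) topology \<Rightarrow>
   ('x \<times> (nat \<Rightarrow> 'k)) topology set" where
  "iso_class X s T = {A \<in> Vect X. bundle_isomorphic smult_seq s A T}"

definition Vect_monoid ::
  "'x topology \<Rightarrow> ('x \<times> (nat \<Rightarrow> 'k::real_or_complex)) topology set monoid" where
  "Vect_monoid X =
     \<lparr>carrier = iso_class X smult_seq ` Vect X,
      monoid.mult = (\<lambda>a b. {C \<in> Vect X. \<exists>A\<in>a. \<exists>B\<in>b.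
         bundle_isomorphic smult_seq (smult_pair smult_seq smult_seq) C (whitney_sum A B)}),
      one = iso_class X smult_seq (prod_topology X (discrete_topology {0}))\<rparr>"

definition grothendieck_rel :: "('a, 'b) monoid_scheme \<Rightarrow> (('a \<times> 'a) \<times> ('a \<times> 'a)) set" where
  "grothendieck_rel G = {((a, b), (c, d)).
     a \<in> carrier G \<and> b \<in> carrier G \<and> c \<in> carrier G \<and> d \<in> carrier G
     \<and> (\<exists>e\<in>carrier G. a \<otimes>\<^bsub>G\<^esub> d \<otimes>\<^bsub>G\<^esub> e = c \<otimes>\<^bsub>G\<^esub> b \<otimes>\<^bsub>G\<^esub> e)}"

text \<open>The Grothendieck group of a commutative monoid; the class of \<open>(a, b)\<close> is the formal difference
  of \<open>a\<close> and \<open>b\<close>.  In the record notation the group operation is written \<open>\<otimes>\<close> although it is the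
  addition, so the difference of \<open>p\<close> and \<open>q\<close> is \<open>p \<otimes> inv q\<close>.\<close>

definition grothendieck_group :: "('a, 'b) monoid_scheme \<Rightarrow> ('a \<times> 'a) set monoid" where
  "grothendieck_group G =
     \<lparr>carrier = (carrier G \<times> carrier G) // grothendieck_rel G,
      monoid.mult = (\<lambda>p q. \<Union>(a, b)\<in>p. \<Union>(c, d)\<in>q.
         grothendieck_rel G `` {(a \<otimes>\<^bsub>G\<^esub> c, b \<otimes>\<^bsub>G\<^esub> d)}),
      one = grothendieck_rel G `` {(\<one>\<^bsub>G\<^esub>, \<one>\<^bsub>G\<^esub>)}\<rparr>"

definition grothendieck_class :: "('a, 'b) monoid_scheme \<Rightarrow> 'a \<Rightarrow> ('a \<times> 'a) set" where
  "grothendieck_class G a = grothendieck_rel G `` {(a, \<one>\<^bsub>G\<^esub>)}"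

type_synonym ('x, 'k) K_element =
  "(('x \<times> (nat \<Rightarrow> 'k)) topology set \<times> ('x \<times> (nat \<Rightarrow> 'k)) topology set) set"

definition K_group :: "'x topology \<Rightarrow> ('x, 'k::real_or_complex) K_element monoid" where
  "K_group X = grothendieck_group (Vect_monoid X)"

definition K_diff ::
  "'x topology \<Rightarrow> ('x, 'k::real_or_complex) K_element \<Rightarrow> ('x, 'k) K_element \<Rightarrow> ('x, 'k) K_element"
  where
  "K_diff X p q = p \<otimes>\<^bsub>K_group X\<^esub> inv\<^bsub>K_group X\<^esub> q"

definition K_class ::
  "'x topology \<Rightarrow> ('k::real_or_complex, 'x, 'e::ab_group_add, 'm::banach) banach_bundle \<Rightarrow>
   ('x \<Rightarrow> 'e set) \<Rightarrow> ('x, 'k) K_element" where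
  "K_class X E V = grothendieck_class (Vect_monoid X)
     (iso_class X (smult_fib E) (subbundle_space X E V))"

end

theory Submission
  imports Defs
begin

text \<open>Consider the triples \<open>(a, v, w)\<close> with \<open>v\<close> in \<open>V\<close>, \<open>w\<close> in \<open>W\<close> and \<open>L a = v + w\<close>.  Projecting to \<open>w\<close> is
  surjective with kernel \<open>E(L, V)\<close>, projecting to \<open>v\<close> is surjective with kernel \<open>E(L, W)\<close>, so splitting both
  projections gives \<open>E(L, V) \<oplus> W \<cong> E(L, W) \<oplus> V\<close>.  A splitting is a bundle map \<open>s\<close> with \<open>L s f - f\<close> in
  \<open>V\<close>.  Locally it exists since kernels and preimages of finite dimensional subspaces are finite
  dimensional, hence complemented, so that the open mapping theorem yields a bounded right inverse of \<open>L\<close>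
  modulo \<open>V\<close> at one point, which persists nearby by perturbation; globally it is obtained by averaging with
  bump functions on the compact base.  The same perturbation straightens \<open>E(L, V)\<close> in a trivialisation of
  \<open>E\<close>, so it is a vector bundle.\<close>

section \<open>Bounded projections onto finite dimensional subspaces\<close>

text \<open>The obvious route compares \<open>V\<close> and \<open>W\<close> inside
  \<open>V + W\<close>, but the dimension of \<open>V \<inter> W\<close> may jump from point to
  point, so \<open>V + W\<close> need not be a subbundle. In the triples the two subbundles enter
  symmetrically and are never added inside \<open>F\<close>.

  A splitting only has to invert \<open>L\<close> modulo \<open>V\<close>. This condition is affine
  in the splitting, hence stable under averaging, and this is why a global splitting can be glued
  from local ones. What is glued is continuity on total spaces rather than norm continuity of
  operator families: it is preserved by sums and by multiplication with continuous scalar functions,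
  and it is what a homeomorphism of total spaces requires.

  Since the models are arbitrary Banach spaces, bounded projections onto finite dimensional
  subspaces rest on the Hahn-Banach theorem. It is obtained for real scalars by descending to
  minimal sublinear functionals and carried over to both scalar fields by averaging.\<close>

definition sublinear_functional :: "('a::real_vector \<Rightarrow> real) \<Rightarrow> bool" where
  "sublinear_functional p \<longleftrightarrow> p 0 = 0 \<and> (\<forall>x y. p (x + y) \<le> p x + p y)
     \<and> (\<forall>r>0. \<forall>x. p (r *\<^sub>R x) \<le> r * p x)"

text \<open>Homogeneity is imposed as an inequality because pointwise infima inherit that form
  directly. Applying it to \<open>1/r\<close> as well turns it into an equality.\<close>

lemma sublinear_functionalD:
  assumes "sublinear_functional p"
  shows "p 0 = 0" "p (x + y) \<le> p x + p y" "r \<ge> 0 \<Longrightarrow> p (r *\<^sub>R x) = r * p x" "- p (- x) \<le> p x"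
proof -
  show 0: "p 0 = 0" and sub: "p (x + y) \<le> p x + p y" for x y
    using assms by (auto simp: sublinear_functional_def)
  have le: "p (r *\<^sub>R x) \<le> r * p x" if "r > 0" for r x
    using assms that by (auto simp: sublinear_functional_def)
  show "p (r *\<^sub>R x) = r * p x" if "r \<ge> 0"
  proof (cases "r = 0")
    case False
    then have r: "r > 0" using that by simp
    have "p ((1/r) *\<^sub>R (r *\<^sub>R x)) \<le> (1/r) * p (r *\<^sub>R x)"
      using r by (intro le) simp
    then have "r * p x \<le> p (r *\<^sub>R x)"
      using r by (simp add: field_simps)
    with le[OF r, of x] show ?thesis by simp
  qed (simp add: 0)
  show "- p (- x) \<le> p x"
    using sub[of x "-x"] 0 by simp
qed

lemma sublinear_functional_norm: "sublinear_functional norm"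
  by (auto simp: sublinear_functional_def norm_triangle_ineq)

text \<open>The functional \<open>q\<close> lies below \<open>p\<close> and is pushed down in the
  direction \<open>- v\<close>: taking \<open>t = 1\<close> gives
  \<open>q (- v) \<le> - p v\<close>, so a linear functional below \<open>q\<close> is at least
  \<open>p v\<close> at \<open>v\<close>. Subadditivity holds because shifts by \<open>t\<close> and
  \<open>s\<close> add up to a shift by \<open>t + s\<close>.\<close>

lemma sublinear_functional_shift:
  fixes v :: "'a::real_vector"
  assumes p: "sublinear_functional p"
  defines "q \<equiv> \<lambda>x. INF t\<in>{0..}. p (x + t *\<^sub>R v) - t * p v"
  shows "sublinear_functional q" "\<And>x t. t \<ge> 0 \<Longrightarrow> q x \<le> p (x + t *\<^sub>R v) - t * p v"
proof -
  note D = sublinear_functionalD[OF p]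
  have bdd: "bdd_below ((\<lambda>t. p (x + t *\<^sub>R v) - t * p v) ` {0..})" for x
  proof (rule bdd_belowI2)
    fix t :: real assume "t \<in> {0..}"
    then have "t * p v = p ((x + t *\<^sub>R v) + - x)" by (simp add: D)
    also have "\<dots> \<le> p (x + t *\<^sub>R v) + p (- x)" by (rule D)
    finally show "- p (-x) \<le> p (x + t *\<^sub>R v) - t * p v" by simp
  qed
  show le: "q x \<le> p (x + t *\<^sub>R v) - t * p v" if "t \<ge> 0" for x t
    unfolding q_def using that by (intro cINF_lower bdd) auto
  have ge: "c \<le> q x" if "\<And>t. t \<ge> 0 \<Longrightarrow> c \<le> p (x + t *\<^sub>R v) - t * p v" for c x
    unfolding q_def using that by (intro cINF_greatest) auto
  have "q 0 = 0"
    using le[of 0 0] D(1) by (intro antisym ge) (auto simp: D)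
  moreover have "q (x + y) \<le> q x + q y" for x y
  proof -
    have "q (x + y) - (p (y + s *\<^sub>R v) - s * p v) \<le> q x" if s: "s \<ge> 0" for s
    proof (rule ge)
      fix t :: real assume t: "t \<ge> 0"
      have "q (x + y) \<le> p ((x + y) + (t + s) *\<^sub>R v) - (t + s) * p v"
        using s t by (intro le) simp
      also have "(x + y) + (t + s) *\<^sub>R v = (x + t *\<^sub>R v) + (y + s *\<^sub>R v)"
        by (simp add: algebra_simps)
      also have "p \<dots> \<le> p (x + t *\<^sub>R v) + p (y + s *\<^sub>R v)" by (rule D)
      finally show "q (x + y) - (p (y + s *\<^sub>R v) - s * p v) \<le> p (x + t *\<^sub>R v) - t * p v"
        by (simp add: algebra_simps)
    qed
    then have "q (x + y) - q x \<le> q y"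
      by (intro ge) (simp add: algebra_simps)
    then show ?thesis by simp
  qed
  moreover have "q (r *\<^sub>R x) \<le> r * q x" if r: "r > 0" for r x
  proof -
    have "q (r *\<^sub>R x) / r \<le> q x"
    proof (rule ge)
      fix t :: real assume t: "t \<ge> 0"
      have "q (r *\<^sub>R x) \<le> p (r *\<^sub>R x + (r * t) *\<^sub>R v) - (r * t) * p v"
        using r t by (intro le) simp
      also have "r *\<^sub>R x + (r * t) *\<^sub>R v = r *\<^sub>R (x + t *\<^sub>R v)"
        by (simp add: algebra_simps)
      also have "p \<dots> = r * p (x + t *\<^sub>R v)" using r by (simp add: D)
      finally show "q (r *\<^sub>R x) / r \<le> p (x + t *\<^sub>R v) - t * p v"
        using r by (simp add: field_simps)
    qed
    then show ?thesis using r by (simp add: field_simps)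
  qed
  ultimately show "sublinear_functional q"
    by (auto simp: sublinear_functional_def)
qed

text \<open>A nonempty chain is bounded below by its pointwise infimum, which is finite since every
  member \<open>p\<close> satisfies \<open>- q (- x) \<le> - p (- x) \<le> p x\<close>.\<close>

lemma ex_minimal_sublinear_functional:
  assumes q: "sublinear_functional q"
  shows "\<exists>p. sublinear_functional p \<and> p \<le> q
    \<and> (\<forall>p'. sublinear_functional p' \<and> p' \<le> p \<longrightarrow> p' = p)"
proof -
  define A where "A = {p. sublinear_functional p \<and> p \<le> q}"
  have "\<exists>m\<in>A. \<forall>a\<in>A. a \<le> m \<longrightarrow> a = m"
  proof (rule predicate_Zorn)
    \<comment> \<open>The order is reversed, so that the maximal element supplied by Zorn's lemma is
      a minimal functional.\<close>
    show "partial_order_on A (relation_of (\<lambda>a b. b \<le> a) A)"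
      by (rule partial_order_on_relation_ofI) auto
    fix C assume "C \<in> Chains (relation_of (\<lambda>a b. b \<le> a) A)"
    then have CA: "C \<subseteq> A" and ch: "\<And>a b. a \<in> C \<Longrightarrow> b \<in> C \<Longrightarrow> a \<le> b \<or> b \<le> a"
      by (auto simp: Chains_def relation_of_def)
    show "\<exists>u\<in>A. \<forall>a\<in>C. u \<le> a"
    proof (cases "C = {}")
      case True
      then show ?thesis using q by (auto simp: A_def)
    next
      case False
      define u where "u x = (INF p\<in>C. p x)" for x
      have sub: "sublinear_functional p" and pq: "p x \<le> q x" if "p \<in> C" for p x
        using that CA by (auto simp: A_def le_fun_def)
      have bdd: "bdd_below ((\<lambda>p. p x) ` C)" for x
      proof (rule bdd_belowI2)
        fix p assume p: "p \<in> C"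
        show "- q (- x) \<le> p x"
          using sublinear_functionalD(4)[OF sub[OF p], of x] pq[OF p, of "-x"] by linarith
      qed
      have le: "u x \<le> p x" if "p \<in> C" for p x
        unfolding u_def using that by (intro cINF_lower bdd) auto
      have ge: "c \<le> u x" if "\<And>p. p \<in> C \<Longrightarrow> c \<le> p x" for c x
        unfolding u_def using that False by (intro cINF_greatest) auto
      obtain p0 where p0: "p0 \<in> C" using False by blast
      have "u 0 = 0"
      proof (rule antisym)
        show "u 0 \<le> 0"
          using le[OF p0, of 0] by (simp add: sublinear_functionalD(1)[OF sub[OF p0]])
        show "0 \<le> u 0"
          by (rule ge) (simp add: sublinear_functionalD(1)[OF sub])
      qed
      moreover have "u (x + y) \<le> u x + u y" for x y
      proof -
        have "u (x + y) - p' y \<le> u x" if p': "p' \<in> C" for p'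
        proof (rule ge)
          fix p assume p: "p \<in> C"
          \<comment> \<open>Two independent members are merged by comparability in the chain:
            \<open>r\<close> is the smaller of \<open>p\<close> and \<open>p'\<close>.\<close>
          obtain r where r: "r \<in> C" "r \<le> p" "r \<le> p'" using ch[OF p p'] p p' by blast
          have "u (x + y) \<le> r x + r y"
            using le[OF r(1), of "x + y"] sublinear_functionalD(2)[OF sub[OF r(1)], of x y] by linarith
          also have "\<dots> \<le> p x + p' y" using r(2,3) by (intro add_mono) (auto simp: le_fun_def)
          finally show "u (x + y) - p' y \<le> p x" by simp
        qed
        then have "u (x + y) - u x \<le> u y"
          by (intro ge) (simp add: algebra_simps)
        then show ?thesis by simp
      qed
      moreover have "u (r *\<^sub>R x) \<le> r * u x" if r: "r > 0" for r x
      proof -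
        have "u (r *\<^sub>R x) / r \<le> u x"
        proof (rule ge)
          fix p assume p: "p \<in> C"
          have "u (r *\<^sub>R x) \<le> r * p x"
            using le[OF p, of "r *\<^sub>R x"] sublinear_functionalD(3)[OF sub[OF p], of r x] r by simp
          then show "u (r *\<^sub>R x) / r \<le> p x" using r by (simp add: field_simps)
        qed
        then show ?thesis using r by (simp add: field_simps)
      qed
      ultimately have "sublinear_functional u" by (auto simp: sublinear_functional_def)
      moreover have "u \<le> q"
        using le[OF p0] pq[OF p0] by (auto simp: le_fun_def intro: order_trans)
      ultimately show ?thesis using le by (intro bexI[of _ u]) (auto simp: A_def le_fun_def)
    qed
  qed
  then show ?thesis unfolding A_def by (blast intro: order_trans)
qed

text \<open>Minimality makes every shift of \<open>p\<close> equal to \<open>p\<close>. The shift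
  along \<open>v\<close> is at most \<open>- p v\<close> at \<open>- v\<close>, so \<open>p\<close>
  is odd; for an odd functional, subadditivity at \<open>- x\<close> and \<open>- y\<close> is the
  reverse inequality.\<close>

lemma minimal_sublinear_functional_linear:
  assumes p: "sublinear_functional p"
    and min: "\<And>p'. sublinear_functional p' \<Longrightarrow> p' \<le> p \<Longrightarrow> p' = p"
  shows "linear p"
proof -
  note D = sublinear_functionalD[OF p]
  have neg: "p (- v) = - p v" for v
  proof -
    define q where "q x = (INF t\<in>{0..}. p (x + t *\<^sub>R v) - t * p v)" for x
    have q: "sublinear_functional q" "\<And>x t. t \<ge> 0 \<Longrightarrow> q x \<le> p (x + t *\<^sub>R v) - t * p v"
      unfolding q_def by (rule sublinear_functional_shift[OF p]; assumption)+
    have "q = p"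
      using q(2)[of 0] by (intro min[OF q(1)]) (simp add: le_fun_def)
    then show ?thesis
      using q(2)[of 1 "- v"] D(4)[of v] by (simp add: D(1))
  qed
  show ?thesis
  proof (rule linearI)
    fix x y
    show "p (x + y) = p x + p y"
      using D(2)[of x y] D(2)[of "-x" "-y"] neg[of "x + y"] neg[of x] neg[of y] by simp
    show "p (r *\<^sub>R x) = r *\<^sub>R p x" for r
      using D(3)[of r x] D(3)[of "-r" x] neg[of "r *\<^sub>R x"] by (cases "r \<ge> 0") auto
  qed
qed

text \<open>A minimal sublinear functional below the norm is linear; starting the descent from the norm
  shifted along \<open>v\<close> forces the value at \<open>v\<close> to be \<open>norm v\<close>.\<close>

lemma ex_bounded_functional_separating:
  fixes v :: "'a::real_normed_vector"
  assumes "v \<noteq> 0"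
  shows "\<exists>f :: 'a \<Rightarrow> real. bounded_linear f \<and> f v = 1"
proof -
  define q where "q x = (INF t\<in>{0..}. norm (x + t *\<^sub>R v) - t * norm v)" for x
  have q: "sublinear_functional q" "\<And>x t. t \<ge> 0 \<Longrightarrow> q x \<le> norm (x + t *\<^sub>R v) - t * norm v"
    unfolding q_def by (rule sublinear_functional_shift[OF sublinear_functional_norm]; assumption)+
  obtain f where f: "sublinear_functional f" "f \<le> q"
    and "\<And>p'. sublinear_functional p' \<Longrightarrow> p' \<le> f \<Longrightarrow> p' = f"
    using ex_minimal_sublinear_functional[OF q(1)] by blast
  then have lin: "linear f" by (intro minimal_sublinear_functional_linear)
  have le: "f x \<le> norm x" for x
    using q(2)[of 0 x] f(2) by (auto simp: le_fun_def intro: order_trans)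
  have bl: "bounded_linear f"
  proof (rule bounded_linear_intro[of _ 1])
    show "norm (f x) \<le> norm x * 1" for x
      using le[of x] le[of "-x"] linear_neg[OF lin, of x] by (simp add: abs_le_iff)
  qed (use lin in \<open>auto simp: linear_add linear_scale\<close>)
  have "f (- v) \<le> q (- v)" using f(2) by (simp add: le_fun_def)
  then have "f v \<ge> norm v"
    using q(2)[of 1 "- v"] linear_neg[OF lin, of v] by simp
  then have "f v > 0" using assms by (smt (verit) zero_less_norm_iff)
  with bl show ?thesis
    by (intro exI[of _ "\<lambda>x. f x / f v"]) (auto intro: bounded_linear_divide bounded_linear_compose
        simp: bounded_linear_divide[THEN bounded_linear_compose])
qed

text \<open>A new generator \<open>b\<close> contributes only its residue
  \<open>d = b - Q b\<close>. A bounded functional equal to \<open>1\<close> at \<open>d\<close>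
  measures how much of \<open>d\<close> is left over by \<open>Q\<close>.\<close>

lemma ex_real_projection:
  fixes B :: "'a::real_normed_vector set"
  assumes "finite B"
  shows "\<exists>Q. bounded_linear Q \<and> (\<forall>x. Q x \<in> span B) \<and> (\<forall>x\<in>span B. Q x = x)"
  using assms
proof (induction B)
  case empty
  show ?case by (intro exI[of _ "\<lambda>_. 0"]) auto
next
  case (insert b B)
  then obtain Q where Q: "bounded_linear Q" "\<And>x. Q x \<in> span B" "\<And>x. x \<in> span B \<Longrightarrow> Q x = x"
    by blast
  interpret Q: bounded_linear Q by (rule Q(1))
  show ?case
  proof (cases "Q b = b")
    case True
    then have "b \<in> span B" using Q(2)[of b] by simp
    then have "span (insert b B) = span B" by (rule span_redundant)
    then show ?thesis using Q by auto
  next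
    case False
    define d where "d = b - Q b"
    obtain f :: "'a \<Rightarrow> real" where f: "bounded_linear f" "f d = 1"
      using ex_bounded_functional_separating[of d] False by (auto simp: d_def)
    interpret f: bounded_linear f by (rule f(1))
    \<comment> \<open>On the old span \<open>x - Q x\<close> vanishes and \<open>R\<close> agrees
      with \<open>Q\<close>; at \<open>b\<close> the residue is \<open>d\<close> itself, so
      \<open>R b = Q b + d = b\<close>.\<close>
    define R where "R x = Q x + f (x - Q x) *\<^sub>R d" for x
    have bl: "bounded_linear R"
      unfolding R_def by (intro bounded_linear_intros Q(1) bounded_linear_compose[OF f(1)])
    interpret R: bounded_linear R by (rule bl)
    have Bi: "span B \<subseteq> span (insert b B)" by (intro span_mono) auto
    have "d \<in> span (insert b B)"
      unfolding d_def using Q(2)[of b] Bi by (intro span_diff) (auto simp: span_base)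
    then have "R x \<in> span (insert b B)" for x
      unfolding R_def using Q(2)[of x] Bi by (intro span_add span_scale) auto
    moreover have "R x = x" if "x \<in> span (insert b B)" for x
    proof -
      have "R x = (\<lambda>x. x) x"
        using that
      proof (rule linear_eq_on[OF R.linear linear_id[unfolded id_def]])
        fix y assume "y \<in> insert b B"
        then consider "y = b" | "y \<in> B" by blast
        then show "R y = y"
        proof cases
          case 1
          have "f (b - Q b) = 1" using f(2) by (simp add: d_def)
          then show ?thesis by (simp add: R_def 1 d_def)
        next
          case 2
          then show ?thesis using Q(3)[of y] by (simp add: R_def span_base)
        qed
      qed
      then show ?thesis .
    qed
    ultimately show ?thesis using bl by blast
  qed
qed


section \<open>Projections and coordinates over the scalar field\<close>

lemma bounded_bilinear_K_banach_space:
  assumes "K_banach_space s"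
  shows "bounded_bilinear s"
proof -
  interpret vector_space s using assms by (simp add: K_banach_space_def)
  have sr: "s (of_real r) x = r *\<^sub>R x" and sn: "norm (s a x) = norm a * norm x" for r a x
    using assms by (auto simp: K_banach_space_def)
  show ?thesis
  proof
    show "s (r *\<^sub>R a) x = r *\<^sub>R s a x" for r a x
      by (metis scale_scale sr scaleR_conv_of_real)
    show "s a (r *\<^sub>R x) = r *\<^sub>R s a x" for r a x
      by (metis scale_scale sr mult.commute)
    show "\<exists>K. \<forall>a b. norm (s a b) \<le> norm a * norm b * K"
      by (intro exI[of _ 1]) (simp add: sn)
  qed (simp_all add: scale_left_distrib scale_right_distrib)
qed

text \<open>Averaging a real-linear projection over the group generated by the imaginary unit makes it
  linear over the scalar field.\<close>

lemma ex_bounded_projection: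
  fixes s :: "'k::real_or_complex \<Rightarrow> 'm::banach \<Rightarrow> 'm"
  assumes s: "K_banach_space s" and B: "finite B"
  shows "\<exists>P :: 'm \<Rightarrow>\<^sub>L 'm. (\<forall>x. P x \<in> module.span s B) \<and> (\<forall>x\<in>module.span s B. P x = x)
    \<and> (\<forall>a x. P (s a x) = s a (P x))"
proof -
  interpret V: vector_space s using s by (simp add: K_banach_space_def)
  interpret bounded_bilinear s by (rule bounded_bilinear_K_banach_space[OF s])
  have sr: "s (of_real r) x = r *\<^sub>R x" for r x
    using s by (simp add: K_banach_space_def)
  note s_scaleR = scaleR_left and s_scaleR' = scaleR_right and bl = bounded_linear_right
  obtain j :: 'k where j: "j = 0 \<or> j * j = - 1" and ab: "\<And>z. \<exists>a b. z = a *\<^sub>R 1 + b *\<^sub>R j"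
    using ex_imaginary_unit by blast
  \<comment> \<open>With the generators doubled by \<open>j\<close>, a span over the scalar field
    becomes a real span, to which the real projection applies. For \<open>j = 0\<close> the doubling
    adds at most the zero vector.\<close>
  have span_eq: "span (B \<union> s j ` B) = V.span B"
  proof (rule antisym)
    have "subspace (V.span B)"
      unfolding subspace_def sr[symmetric] by (auto simp: V.span_zero V.span_add V.span_scale)
    then show "span (B \<union> s j ` B) \<subseteq> V.span B"
      by (intro span_minimal) (auto intro: V.span_base V.span_scale)
    show "V.span B \<subseteq> span (B \<union> s j ` B)"
    proof
      fix x assume "x \<in> V.span B"
      then show "x \<in> span (B \<union> s j ` B)"
      proof (induction rule: V.span_induct_alt)
        case base
        show ?case by (rule span_zero)
      next
        case (step c x y)
        obtain a b where c: "c = a *\<^sub>R 1 + b *\<^sub>R j" using ab by blast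
        have "s c x = a *\<^sub>R x + b *\<^sub>R s j x"
          unfolding c V.scale_left_distrib s_scaleR by simp
        also have "\<dots> \<in> span (B \<union> s j ` B)"
          using step(1) by (intro span_add span_scale) (auto intro: span_base)
        finally show ?case using step by (intro span_add) auto
      qed
    qed
  qed
  obtain Q where Q: "bounded_linear Q" "\<And>x. Q x \<in> V.span B" "\<And>x. x \<in> V.span B \<Longrightarrow> Q x = x"
    using ex_real_projection[of "B \<union> s j ` B"] B span_eq by auto
  interpret Q: bounded_linear Q by (rule Q(1))
  show ?thesis
  proof (cases "j = 0")
    case True
    have "Q (s a x) = s a (Q x)" for a x
    proof -
      obtain r where "a = of_real r" using ab[of a] True by (auto simp: scaleR_conv_of_real)
      then show ?thesis by (simp add: sr Q.scaleR)
    qed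
    then show ?thesis
      using Q by (intro exI[of _ "Blinfun Q"]) (auto simp: bounded_linear_Blinfun_apply)
  next
    case False
    then have jj: "j * j = - 1" using j by simp
    have jjx: "s j (s j x) = - x" for x by (simp add: jj)
    \<comment> \<open>The mean of \<open>Q\<close> and its conjugate by \<open>j\<close>, whose
      inverse is \<open>- j\<close>.\<close>
    define P where "P x = (1/2) *\<^sub>R (Q x - s j (Q (s j x)))" for x
    have blP: "bounded_linear P"
      unfolding P_def
      by (rule bounded_linear_compose[OF bounded_linear_scaleR_right bounded_linear_sub[OF Q(1)
            bounded_linear_compose[OF bl bounded_linear_compose[OF Q(1) bl]]]])
    interpret P: bounded_linear P by (rule blP)
    have 1: "P x \<in> V.span B" for x
      unfolding P_def sr[symmetric] by (intro V.span_scale V.span_diff Q)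
    have 2: "P x = x" if "x \<in> V.span B" for x
    proof -
      have "P x = (1/2) *\<^sub>R (x - s j (s j x))"
        using that by (simp add: P_def Q V.span_scale)
      then show ?thesis unfolding jjx by simp
    qed
    have Pj: "P (s j x) = s j (P x)" for x
      unfolding P_def s_scaleR' V.scale_right_diff_distrib jjx by (simp add: Q.neg)
    have 3: "P (s a x) = s a (P x)" for a x
    proof -
      obtain r t where a: "a = r *\<^sub>R 1 + t *\<^sub>R j" using ab by blast
      show ?thesis
        unfolding a V.scale_left_distrib s_scaleR by (simp add: P.add P.scaleR Pj)
    qed
    show ?thesis
      using 1 2 3 blP by (intro exI[of _ "Blinfun P"]) (auto simp: bounded_linear_Blinfun_apply)
  qed
qed

lemma continuous_map_euclidean_atin:
  "continuous_map X euclidean f \<longleftrightarrow> (\<forall>x\<in>topspace X. (f \<longlongrightarrow> f x) (atin X x))"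
  by (simp add: continuous_map_atin)

text \<open>Project boundedly onto the span of the other basis vectors: \<open>u - P u\<close> is
  the coordinate of \<open>u\<close> times the fixed nonzero vector \<open>b - P b\<close>, and
  dividing by the norm of that vector bounds the coordinate. For frames of bundles this bound yields
  continuity of the coordinates.\<close>

lemma bounded_coordinate:
  fixes s :: "'k::real_or_complex \<Rightarrow> 'm::banach \<Rightarrow> 'm"
  assumes s: "K_banach_space s" and B: "finite B" "\<not> module.dependent s B" "b \<in> B"
  shows "\<exists>C. \<forall>u\<in>module.span s B. norm (module.representation s B u b) \<le> C * norm u"
proof -
  interpret V: vector_space s using s by (simp add: K_banach_space_def)
  have sn: "norm (s a x) = norm a * norm x" for a x
    using s by (auto simp: K_banach_space_def)
  obtain P :: "'m \<Rightarrow>\<^sub>L 'm" where P: "\<And>x. P x \<in> V.span (B - {b})"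
      "\<And>x. x \<in> V.span (B - {b}) \<Longrightarrow> P x = x" "\<And>a x. P (s a x) = s a (P x)"
    using ex_bounded_projection[OF s, of "B - {b}"] B(1) by auto
  define d where "d = b - P b"
  have "b \<notin> V.span (B - {b})" using B(2,3) by (auto simp: V.dependent_def)
  then have d: "d \<noteq> 0" using P(1)[of b] by (auto simp: d_def)
  show ?thesis
  proof (intro exI ballI)
    fix u assume u: "u \<in> V.span B"
    let ?c = "V.representation B u"
    have "u = (\<Sum>v\<in>B. s (?c v) v)"
      using V.sum_representation_eq[OF B(2) u B(1) order_refl] by simp
    also have "\<dots> = s (?c b) b + (\<Sum>v\<in>B - {b}. s (?c v) v)"
      using B(1,3) by (simp add: sum.remove)
    finally have u_eq: "u = s (?c b) b + (\<Sum>v\<in>B - {b}. s (?c v) v)" (is "_ = _ + ?w") .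
    have "P ?w = ?w"
      by (intro P(2) V.span_sum V.span_scale V.span_base)
    then have "u - P u = s (?c b) d"
      by (subst (1 2) u_eq) (simp add: blinfun.add_right P(3) d_def V.scale_right_diff_distrib)
    then have "norm (?c b) * norm d = norm (u - P u)" by (simp add: sn)
    also have "\<dots> \<le> norm u + norm P * norm u"
      by (intro order_trans[OF norm_triangle_ineq4] add_mono norm_blinfun) simp
    finally show "norm (?c b) \<le> (1 + norm P) / norm d * norm u"
      using d by (simp add: field_simps)
  qed
qed

section \<open>Open mapping and perturbation\<close>

text \<open>By Baire the closure of the image of some ball contains a ball, about whose centre
  \<open>y0\<close> nothing is known. The centre drops out on approximating \<open>y0 + t y\<close>
  and \<open>y0\<close> separately and subtracting.\<close>

lemma open_mapping_approx:
  fixes A :: "'a::real_normed_vector \<Rightarrow>\<^sub>L 'b::banach"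
  assumes surj: "\<And>y. \<exists>x. A x = y"
  shows "\<exists>K>0. \<forall>y. \<exists>x. norm x \<le> K * norm y \<and> norm (y - A x) \<le> norm y / 2"
proof -
  let ?F = "\<lambda>n::nat. closure (blinfun_apply A ` ball 0 (real n))"
  have "\<exists>n. interior (?F n) \<noteq> {}"
  proof (rule ccontr)
    assume "\<nexists>n. interior (?F n) \<noteq> {}"
    then have "euclidean interior_of \<Union>(range ?F) = {}"
      by (intro Baire_category_alt) (auto simp: completely_metrizable_space_euclidean)
    moreover have "\<Union>(range ?F) = UNIV"
    proof (rule UNIV_eq_I[symmetric])
      fix y
      obtain x where x: "A x = y" using surj by blast
      obtain n where "norm x < real n" using reals_Archimedean2 by blast
      then have "y \<in> ?F n" using x closure_subset by fastforce
      then show "y \<in> \<Union>(range ?F)" by blast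
    qed
    ultimately show False by (metis UNIV_not_empty interior_UNIV euclidean_interior_of)
  qed
  then obtain n y0 where "y0 \<in> interior (?F n)" by blast
  then obtain r where r: "r > 0" "ball y0 r \<subseteq> ?F n"
    by (meson mem_interior)
  \<comment> \<open>With \<open>t = r / (2 * norm y)\<close>, the bound \<open>2 n / t\<close>
    equals \<open>(4 n / r) * norm y\<close>; the added \<open>1\<close> makes \<open>K\<close>
    positive whatever \<open>n\<close> is.\<close>
  define K where "K = 4 * real n / r + 1"
  have "\<exists>x. norm x \<le> K * norm y \<and> norm (y - A x) \<le> norm y / 2" for y
  proof (cases "y = 0")
    case True
    then show ?thesis by (intro exI[of _ 0]) simp
  next
    case False
    \<comment> \<open>This \<open>t\<close> puts \<open>y0 + t y\<close> at distance
      \<open>r / 2\<close> from \<open>y0\<close>, inside the ball. The error \<open>e\<close> below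
      is chosen so that two of them add up to half of \<open>t * norm y\<close>.\<close>
    define t where "t = r / (2 * norm y)"
    have t: "t > 0" using r False by (simp add: t_def)
    define e where "e = t * norm y / 4"
    have e: "e > 0" using t False by (simp add: e_def)
    have "y0 + t *\<^sub>R y \<in> ?F n" "y0 \<in> ?F n"
      using r False by (auto simp: t_def dist_norm intro!: subsetD[OF r(2)])
    then obtain x1 x2 where x: "norm x1 < n" "norm x2 < n"
      "dist (A x1) (y0 + t *\<^sub>R y) < e" "dist (A x2) y0 < e"
      using e unfolding closure_approachable by force
    define x where "x = (1/t) *\<^sub>R (x1 - x2)"
    have "norm x = norm (x1 - x2) / t" using t by (simp add: x_def)
    also have "\<dots> \<le> (2 * real n) / t"
      using x norm_triangle_ineq4[of x1 x2] t by (intro divide_right_mono) auto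
    also have "\<dots> \<le> K * norm y"
      using r False by (simp add: t_def K_def field_simps)
    finally have "norm x \<le> K * norm y" .
    moreover have "norm (y - A x) \<le> norm y / 2"
    proof -
      have "t *\<^sub>R (y - A x) = (y0 + t *\<^sub>R y - A x1) - (y0 - A x2)"
        using t by (simp add: x_def algebra_simps blinfun.bilinear_simps)
      also have "norm \<dots> \<le> e + e"
        by (rule norm_triangle_le_diff, rule add_mono)
          (use x in \<open>simp_all add: dist_norm norm_minus_commute less_imp_le\<close>)
      finally have "t * norm (y - A x) \<le> t * (norm y / 2)" using t by (simp add: e_def)
      then show ?thesis using t by simp
    qed
    ultimately show ?thesis by blast
  qed
  moreover have "K > 0" using r by (simp add: K_def add_nonneg_pos)
  ultimately show ?thesis by blast
qed

text \<open>Each approximate solution halves the residue, so the successive corrections are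
  dominated by a geometric series with sum \<open>2 * K * norm y\<close>. Completeness of the domain
  sums them, and the images telescope to \<open>y\<close>.\<close>

lemma open_mapping_bound:
  fixes A :: "'a::banach \<Rightarrow>\<^sub>L 'b::banach"
  assumes surj: "\<And>y. \<exists>x. A x = y"
  shows "\<exists>C. \<forall>y. \<exists>x. A x = y \<and> norm x \<le> C * norm y"
proof -
  obtain K g where K: "K > 0" and g: "\<And>y. norm (g y) \<le> K * norm y"
      "\<And>y. norm (y - A (g y)) \<le> norm y / 2"
    using open_mapping_approx[OF surj] by metis
  have "\<exists>x. A x = y \<and> norm x \<le> (2 * K) * norm y" for y
  proof -
    define z where "z n = ((\<lambda>y. y - A (g y)) ^^ n) y" for n
    have z0: "z 0 = y" and zS: "z (Suc n) = z n - A (g (z n))" for n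
      by (simp_all add: z_def)
    have zn: "norm (z n) \<le> norm y * (1/2) ^ n" for n
    proof (induction n)
      case (Suc n)
      then show ?case using g(2)[of "z n"] by (simp add: zS)
    qed (simp add: z0)
    have gn: "norm (g (z n)) \<le> K * norm y * (1/2) ^ n" for n
      using order_trans[OF g(1)[of "z n"] mult_left_mono[OF zn[of n]]] K by (simp add: mult.assoc)
    have geo: "(\<lambda>n. K * norm y * (1/2) ^ n) sums (K * norm y * 2)"
      using sums_mult[OF geometric_sums[of "1/2 :: real"], of "K * norm y"] by simp
    have sn: "summable (\<lambda>n. norm (g (z n)))"
      using gn by (intro summable_comparison_test'[OF sums_summable[OF geo], of 0]) simp
    then have s: "summable (\<lambda>n. g (z n))" by (rule summable_norm_cancel)
    define x where "x = (\<Sum>n. g (z n))"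
    have "norm x \<le> (\<Sum>n. norm (g (z n)))" unfolding x_def using sn by (rule summable_norm)
    also have "\<dots> \<le> K * norm y * 2"
      using suminf_le[OF gn sn sums_summable[OF geo]] sums_unique[OF geo] by simp
    finally have nx: "norm x \<le> (2 * K) * norm y" by simp
    have "(\<lambda>n. A (g (z n))) sums A x"
      unfolding x_def
      by (rule bounded_linear.sums[OF blinfun.bounded_linear_right summable_sums[OF s]])
    moreover have "z \<longlonglongrightarrow> 0"
    proof (rule Lim_null_comparison)
      show "\<forall>\<^sub>F n in sequentially. norm (z n) \<le> norm y * (1/2) ^ n" using zn by simp
      show "(\<lambda>n. norm y * (1/2) ^ n) \<longlonglongrightarrow> 0"
        by (intro tendsto_mult_right_zero LIMSEQ_power_zero) simp
    qed
    then have "(\<lambda>n. z n - z (Suc n)) sums (z 0 - 0)" by (rule telescope_sums')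
    then have "(\<lambda>n. A (g (z n))) sums y" by (simp add: zS z0)
    ultimately have "A x = y" by (rule sums_unique2)
    with nx show ?thesis by blast
  qed
  then show ?thesis by blast
qed

text \<open>Solving \<open>A u = g\<close> is a fixed point problem for the contraction
  \<open>u \<mapsto> g + (u - A u)\<close>. The bound \<open>2 = 1 / (1 - 1/2)\<close> is uniform in
  \<open>A\<close>; continuity of the inverses in a parameter will rely on that.\<close>

lemma blinfun_inverse_near_identity:
  fixes A :: "'a::banach \<Rightarrow>\<^sub>L 'a"
  assumes A: "norm (A - id_blinfun) \<le> 1/2"
  shows "\<exists>B :: 'a \<Rightarrow>\<^sub>L 'a. A o\<^sub>L B = id_blinfun \<and> B o\<^sub>L A = id_blinfun \<and> norm B \<le> 2"
proof -
  have le: "norm (u - A u) \<le> 1/2 * norm u" for u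
    using norm_blinfun[of "A - id_blinfun" u] mult_right_mono[OF A, of "norm u"]
    by (simp add: blinfun.diff_left norm_minus_commute)
  have bd: "norm u \<le> 2 * norm (A u)" for u
    using norm_triangle_ineq[of "A u" "u - A u"] le[of u] by simp
  have inj: "u = v" if "A u = A v" for u v
    using bd[of "u - v"] that by (simp add: blinfun.diff_right)
  have "\<exists>u. A u = g" for g
  proof -
    have "\<exists>!u. g + (u - A u) = u"
    proof (rule banach_fix_type[of "1/2"])
      show "\<forall>x y. dist (g + (x - A x)) (g + (y - A y)) \<le> 1/2 * dist x y"
      proof (intro allI)
        fix x y
        have eq: "(g + (x - A x)) - (g + (y - A y)) = (x - y) - A (x - y)"
          by (simp add: blinfun.diff_right)
        then show "dist (g + (x - A x)) (g + (y - A y)) \<le> 1/2 * dist x y"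
          unfolding dist_norm eq using le by blast
      qed
    qed auto
    then obtain u where "g + (u - A u) = u" by blast
    then have "A u = g" by (simp add: algebra_simps)
    then show ?thesis by blast
  qed
  then obtain B where B: "\<And>g. A (B g) = g" by metis
  have BA: "B (A u) = u" for u using inj B by blast
  have bl: "bounded_linear B"
  proof (rule bounded_linear_intro[of _ 2])
    show "B (x + y) = B x + B y" for x y by (rule inj) (simp add: B blinfun.add_right)
    show "B (r *\<^sub>R x) = r *\<^sub>R B x" for r x by (rule inj) (simp add: B blinfun.scaleR_right)
    show "norm (B x) \<le> norm x * 2" for x using bd[of "B x"] by (simp add: B)
  qed
  have "norm (Blinfun B) \<le> 2"
    using bd[of "B _"] by (intro norm_blinfun_bound) (auto simp: bounded_linear_Blinfun_apply[OF bl] B)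
  then show ?thesis
    by (intro exI[of _ "Blinfun B"])
       (auto intro!: blinfun_eqI simp: bounded_linear_Blinfun_apply[OF bl] B BA)
qed

lemma blinfun_compose_id_apply:
  assumes "A o\<^sub>L B = id_blinfun"
  shows "A (B w) = w"
proof -
  have "A (B w) = (A o\<^sub>L B) w" by (rule blinfun_apply_blinfun_compose[symmetric])
  also have "\<dots> = w" by (simp only: assms blinfun_apply_id_blinfun)
  finally show ?thesis .
qed

text \<open>Second resolvent identity: \<open>B y - B z = B y (A z - A y) B z\<close>.\<close>

lemma continuous_map_blinfun_inverse:
  fixes A :: "'x \<Rightarrow> 'a::real_normed_vector \<Rightarrow>\<^sub>L 'a"
  assumes A: "continuous_map X euclidean A"
    and AB: "\<And>y. y \<in> topspace X \<Longrightarrow> A y o\<^sub>L B y = id_blinfun"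
    and BA: "\<And>y. y \<in> topspace X \<Longrightarrow> B y o\<^sub>L A y = id_blinfun"
    and bd: "\<And>y. y \<in> topspace X \<Longrightarrow> norm (B y) \<le> c"
  shows "continuous_map X euclidean B"
proof -
  have bound: "dist (B y) (B z) \<le> c * c * dist (A y) (A z)"
    if y: "y \<in> topspace X" and z: "z \<in> topspace X" for y z
  proof -
    have c: "c \<ge> 0" using bd[OF y] norm_ge_zero[of "B y"] by linarith
    have By: "B y (A y w) = w" for w
      by (rule blinfun_compose_id_apply[OF BA[OF y]])
    have Az: "A z (B z w) = w" for w
      by (rule blinfun_compose_id_apply[OF AB[OF z]])
    have "norm (B y - B z) = norm (B y o\<^sub>L (A z - A y) o\<^sub>L B z)"
    proof (intro arg_cong[of _ _ norm] blinfun_eqI)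
      fix w
      show "(B y - B z) w = (B y o\<^sub>L (A z - A y) o\<^sub>L B z) w"
        by (simp add: blinfun.diff_left blinfun.diff_right By Az)
    qed
    also have "\<dots> \<le> norm (B y o\<^sub>L (A z - A y)) * norm (B z)"
      by (rule norm_blinfun_compose)
    also have "\<dots> \<le> (norm (B y) * norm (A z - A y)) * norm (B z)"
      by (intro mult_right_mono norm_blinfun_compose) simp
    also have "\<dots> \<le> (c * norm (A z - A y)) * c"
      by (intro mult_mono bd y z) (auto simp: c)
    finally show ?thesis by (simp add: dist_norm norm_minus_commute mult_ac)
  qed
  show ?thesis
    unfolding continuous_map_euclidean_atin
  proof
    fix x assume x: "x \<in> topspace X"
    have "(A \<longlongrightarrow> A x) (atin X x)"
      using A x by (simp add: continuous_map_euclidean_atin)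
    then have "((\<lambda>y. c * c * dist (A y) (A x)) \<longlongrightarrow> c * c * dist (A x) (A x)) (atin X x)"
      by (intro tendsto_mult_left tendsto_dist tendsto_const)
    then have lim: "((\<lambda>y. c * c * dist (A y) (A x)) \<longlongrightarrow> 0) (atin X x)" by simp
    have "\<forall>\<^sub>F y in atin X x. norm (B y - B x) \<le> c * c * dist (A y) (A x)"
      unfolding eventually_atin
    proof (intro disjI2 exI conjI ballI)
      fix y assume "y \<in> topspace X - {x}"
      then show "norm (B y - B x) \<le> c * c * dist (A y) (A x)"
        using bound[of y x] x by (simp add: dist_norm)
    qed (use x in auto)
    then have "((\<lambda>y. B y - B x) \<longlongrightarrow> 0) (atin X x)"
      using lim by (rule Lim_null_comparison)
    then show "(B \<longlongrightarrow> B x) (atin X x)" by (rule LIM_zero_cancel)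
  qed
qed

section \<open>Inverting an operator modulo a finite dimensional subspace\<close>

lemma finite_span_preimage:
  assumes f: "Vector_Spaces.linear s t f"
    and K: "finite K" "{u. f u = 0} = module.span s K" and B: "finite B"
  shows "\<exists>C. finite C \<and> module.span s C = {u. f u \<in> module.span t B}"
proof -
  interpret f: Vector_Spaces.linear s t f by (rule f)
  define R where "R = range f \<inter> f.vs2.span B"
  obtain D where D: "D \<subseteq> R" "f.vs2.independent D" "R \<subseteq> f.vs2.span D"
    by (rule f.vs2.basis_exists)
  have "D \<subseteq> f.vs2.span B" using D(1) by (auto simp: R_def)
  then have fD: "finite D"
    using f.vs2.independent_span_bound[OF B D(2)] by blast
  have "\<forall>d\<in>D. \<exists>u. f u = d" using D(1) by (auto simp: R_def)
  \<comment> \<open>The preimage is spanned by the kernel together with one lift \<open>g d\<close>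
    for each vector of a basis \<open>D\<close> of the attained part of the target.\<close>
  then obtain g where g: "\<And>d. d \<in> D \<Longrightarrow> f (g d) = d" by metis
  have img: "f ` f.vs1.span (g ` D) = f.vs2.span D"
  proof -
    have "f ` g ` D = D" using g by force
    then show ?thesis using f.span_image[of "g ` D"] by simp
  qed
  have "f.vs1.span (K \<union> g ` D) = {u. f u \<in> f.vs2.span B}"
  proof (intro antisym subsetI)
    fix u assume "u \<in> f.vs1.span (K \<union> g ` D)"
    then obtain k w where u: "u = k + w" and k: "k \<in> f.vs1.span K" and w: "w \<in> f.vs1.span (g ` D)"
      unfolding f.vs1.span_Un mem_Collect_eq by (elim exE conjE)
    have "f k = 0" using k K(2) by blast
    moreover have "f w \<in> f.vs2.span D" unfolding img[symmetric] using w by (rule imageI)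
    moreover have "f.vs2.span D \<subseteq> f.vs2.span B"
      using \<open>D \<subseteq> f.vs2.span B\<close> by (rule f.vs2.span_minimal) simp
    ultimately show "u \<in> {u. f u \<in> f.vs2.span B}" by (auto simp: u f.add)
  next
    fix u assume "u \<in> {u. f u \<in> f.vs2.span B}"
    then have "f u \<in> f.vs2.span D" using D(3) by (auto simp: R_def)
    then obtain w where w: "w \<in> f.vs1.span (g ` D)" "f u = f w"
      unfolding img[symmetric] by (rule imageE)
    then have "f (u - w) = 0" by (simp add: f.diff)
    then have "u - w \<in> f.vs1.span K" using K(2) by blast
    moreover have "f.vs1.span K \<subseteq> f.vs1.span (K \<union> g ` D)" "f.vs1.span (g ` D) \<subseteq> f.vs1.span (K \<union> g ` D)"
      by (intro f.vs1.span_mono; blast)+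
    ultimately have "(u - w) + w \<in> f.vs1.span (K \<union> g ` D)"
      using w(1) by (intro f.vs1.span_add) auto
    then show "u \<in> f.vs1.span (K \<union> g ` D)" by simp
  qed
  moreover have "finite (K \<union> g ` D)" using K(1) fD by blast
  ultimately show ?thesis by blast
qed

text \<open>\<open>Q\<close> is a right inverse of \<open>T\<close> modulo \<open>M\<close>, normalised by \<open>P \<circ> Q = 0\<close>.  It is bounded by the
  open mapping theorem, applied to \<open>(u, f) \<mapsto> T u + R f\<close> for a projection \<open>R\<close> onto \<open>M\<close>.\<close>

lemma ex_right_inverse_modulo:
  fixes sm :: "'k::real_or_complex \<Rightarrow> 'm::banach \<Rightarrow> 'm" and sn :: "'k \<Rightarrow> 'n::banach \<Rightarrow> 'n"
    and T :: "'m \<Rightarrow>\<^sub>L 'n"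
  assumes sm: "K_banach_space sm" and sn: "K_banach_space sn"
    and T: "\<And>a u. T (sm a u) = sn a (T u)"
    and M: "finite B" "M = module.span sn B"
    and N: "finite C" "{u. T u \<in> M} = module.span sm C"
    and trans: "\<And>f. \<exists>u. T u - f \<in> M"
  shows "\<exists>(P :: 'm \<Rightarrow>\<^sub>L 'm) (Q :: 'n \<Rightarrow>\<^sub>L 'm).
    (\<forall>u. T (P u) \<in> M) \<and> (\<forall>u. T u \<in> M \<longrightarrow> P u = u) \<and> (\<forall>a u. P (sm a u) = sm a (P u))
    \<and> (\<forall>a f. Q (sn a f) = sm a (Q f)) \<and> (\<forall>f. P (Q f) = 0) \<and> (\<forall>f. Q f = 0 \<longleftrightarrow> f \<in> M)
    \<and> (\<forall>u. Q (T u) = u - P u)"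
proof -
  interpret Vm: vector_space sm using sm by (simp add: K_banach_space_def)
  interpret Vn: vector_space sn using sn by (simp add: K_banach_space_def)
  have sr: "sm (of_real r) u = r *\<^sub>R u" "sn (of_real r) f = r *\<^sub>R f" for r u f
    using sm sn by (auto simp: K_banach_space_def)
  have Msub: "Vn.subspace M" unfolding M(2) by simp
  note Mcl = Vn.subspace_0[OF Msub] Vn.subspace_add[OF Msub] Vn.subspace_diff[OF Msub]
    Vn.subspace_scale[OF Msub] Vn.subspace_neg[OF Msub]
  obtain P :: "'m \<Rightarrow>\<^sub>L 'm" where P: "\<And>u. T (P u) \<in> M" "\<And>u. T u \<in> M \<Longrightarrow> P u = u"
      "\<And>a u. P (sm a u) = sm a (P u)"
    using ex_bounded_projection[OF sm N(1)] N(2)[symmetric] by auto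
  obtain R :: "'n \<Rightarrow>\<^sub>L 'n" where R: "\<And>f. R f \<in> M" "\<And>f. f \<in> M \<Longrightarrow> R f = f"
    using ex_bounded_projection[OF sn M(1)] M(2)[symmetric] by auto
  \<comment> \<open>\<open>T\<close> alone need not be onto. Adding \<open>R\<close> makes the map
    onto, since transversality leaves a remainder in \<open>M\<close>, which \<open>R\<close>
    fixes.\<close>
  define A where "A = (T o\<^sub>L fst_blinfun) + (R o\<^sub>L snd_blinfun)"
  have A: "A (u, f) = T u + R f" for u f
    by (simp add: A_def blinfun.add_left)
  have "\<exists>x. A x = f" for f
  proof -
    obtain u where "T u - f \<in> M" using trans by blast
    then have "f - T u \<in> M" using Mcl(5)[of "T u - f"] by simp
    then have "A (u, f - T u) = f" by (simp add: A R)
    then show ?thesis by blast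
  qed
  then obtain c where "\<forall>f. \<exists>x. A x = f \<and> norm x \<le> c * norm f"
    using open_mapping_bound[of A] by blast
  then obtain g where g: "\<And>f. A (g f) = f" "\<And>f. norm (g f) \<le> c * norm f" by metis
  define q where "q f = fst (g f) - P (fst (g f))" for f
  have Tg: "T (fst (g f)) - f \<in> M" for f
  proof -
    have "T (fst (g f)) + R (snd (g f)) = f" using g(1)[of f] A[of "fst (g f)" "snd (g f)"] by simp
    then have "T (fst (g f)) - f = - R (snd (g f))" by (simp add: algebra_simps)
    then show ?thesis using R(1) Mcl(5) by simp
  qed
  have Tq: "T (q f) - f \<in> M" for f
    using Mcl(3)[OF Tg[of f] P(1)[of "fst (g f)"]] by (simp add: q_def blinfun.diff_right algebra_simps)
  have PP: "P (P u) = P u" for u by (intro P)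
  have Pq: "P (q f) = 0" for f by (simp add: q_def blinfun.diff_right PP)
  \<comment> \<open>Only one solution modulo \<open>M\<close> is killed by \<open>P\<close>. Hence
    \<open>q\<close> is linear although \<open>g\<close> was selected without regard to
    linearity.\<close>
  have uniq: "u = q f" if "P u = 0" "T u - f \<in> M" for u f
  proof -
    have "T (u - q f) \<in> M"
      using Mcl(3)[OF that(2) Tq[of f]] by (simp add: blinfun.diff_right)
    then have "P (u - q f) = u - q f" by (rule P)
    then show ?thesis using that(1) Pq by (simp add: blinfun.diff_right)
  qed
  have qs: "q (sn a f) = sm a (q f)" for a f
    using Mcl(4)[OF Tq[of f], of a] Pq[of f]
    by (intro uniq[symmetric]) (simp_all add: P T Vn.scale_right_diff_distrib)
  have bq: "bounded_linear q"
  proof (rule bounded_linear_intro[of _ "c + norm P * c"])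
    fix f h
    have E: "T (q f + q h) - (f + h) = (T (q f) - f) + (T (q h) - h)"
      by (simp add: blinfun.add_right)
    have "T (q f + q h) - (f + h) \<in> M" unfolding E by (intro Mcl(2) Tq)
    then show "q (f + h) = q f + q h"
      by (intro uniq[symmetric]) (simp_all add: blinfun.add_right Pq)
    show "q (r *\<^sub>R f) = r *\<^sub>R q f" for r
      using qs[of "of_real r" f] by (simp add: sr)
    have fst_le: "norm (fst (g f)) \<le> norm (g f)"
      by (metis norm_fst_le prod.collapse)
    have "norm (q f) \<le> norm (fst (g f)) + norm P * norm (fst (g f))"
      unfolding q_def by (intro order_trans[OF norm_triangle_ineq4] add_mono norm_blinfun) simp
    also have "\<dots> \<le> c * norm f + norm P * (c * norm f)"
      by (intro add_mono mult_left_mono order_trans[OF fst_le g(2)]) simp_all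
    finally show "norm (q f) \<le> norm f * (c + norm P * c)" by (simp add: algebra_simps)
  qed
  have q0: "q f = 0 \<longleftrightarrow> f \<in> M" for f
  proof
    assume "q f = 0"
    then show "f \<in> M" using Tq[of f] Mcl(5)[of "- f"] by (simp add: blinfun.zero_right)
  next
    assume "f \<in> M"
    then show "q f = 0"
      by (intro uniq[symmetric]) (simp_all add: blinfun.zero_right Mcl)
  qed
  have qT: "q (T u) = u - P u" for u
    using Mcl(5)[OF P(1)[of u]]
    by (intro uniq[symmetric]) (simp_all add: blinfun.diff_right PP)
  show ?thesis
    using P Pq qs q0 qT by (intro exI[of _ P] exI[of _ "Blinfun q"])
      (simp add: bounded_linear_Blinfun_apply[OF bq])
qed

text \<open>With \<open>P\<close> and \<open>Q\<close> as above, \<open>Q T' + P\<close> is the identity at \<open>T' = T\<close>, and where it is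
  invertible it straightens the preimages of \<open>M\<close> to the one under \<open>T\<close>.\<close>

lemma straighten_preimage:
  fixes P :: "'m::real_normed_vector \<Rightarrow>\<^sub>L 'm" and Q :: "'n::real_normed_vector \<Rightarrow>\<^sub>L 'm" and T T' :: "'m \<Rightarrow>\<^sub>L 'n"
  assumes P: "\<And>u. T (P u) \<in> M" "\<And>u. T u \<in> M \<Longrightarrow> P u = u"
    and Q: "\<And>f. P (Q f) = 0" "\<And>f. Q f = 0 \<longleftrightarrow> f \<in> M"
    and inv: "((Q o\<^sub>L T') + P) o\<^sub>L A = id_blinfun"
  shows "T (Q (T' u) + P u) \<in> M \<longleftrightarrow> T' u \<in> M" and "T' (A (Q f)) - f \<in> M"
proof -
  have PP: "P (P u) = P u" for u by (intro P)
  show "T (Q (T' u) + P u) \<in> M \<longleftrightarrow> T' u \<in> M"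
  proof
    assume "T (Q (T' u) + P u) \<in> M"
    then have "P (Q (T' u) + P u) = Q (T' u) + P u" by (rule P)
    then show "T' u \<in> M" by (simp add: blinfun.add_right Q PP)
  next
    assume "T' u \<in> M"
    then have "Q (T' u) = 0" by (simp add: Q)
    then show "T (Q (T' u) + P u) \<in> M" by (simp add: P)
  qed
  define w where "w = A (Q f)"
  have "((Q o\<^sub>L T') + P) w = Q f"
    unfolding w_def by (rule blinfun_compose_id_apply[OF inv])
  then have eq: "Q (T' w) + P w = Q f" by (simp add: blinfun.add_left)
  \<comment> \<open>\<open>P\<close> kills the range of \<open>Q\<close> and fixes its own range, so
    applying it isolates \<open>P w\<close>; what is left says that \<open>Q\<close> vanishes at
    \<open>T' w - f\<close>.\<close>
  then have "P (Q (T' w) + P w) = P (Q f)" by simp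
  then have "P w = 0" by (simp add: blinfun.add_right Q PP)
  then have "Q (T' w - f) = 0" using eq by (simp add: blinfun.diff_right)
  then show "T' (A (Q f)) - f \<in> M" by (simp add: Q w_def)
qed

section \<open>Vector bundles and Whitney sums\<close>

lemma continuous_map_fibre:
  assumes "continuous_map T T' (\<lambda>(x, u). (x, h x u))" "(x, u) \<in> topspace T"
  shows "(x, h x u) \<in> topspace T'"
  using funcset_mem[OF continuous_map_funspace[OF assms(1)] assms(2)] by simp

lemma bundle_isomorphicI:
  assumes "continuous_map T T' (\<lambda>(x, u). (x, h x u))" "continuous_map T' T (\<lambda>(x, v). (x, k x v))"
    and "\<And>x u. (x, u) \<in> topspace T \<Longrightarrow> k x (h x u) = u"
    and "\<And>x v. (x, v) \<in> topspace T' \<Longrightarrow> h x (k x v) = v"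
    and "\<And>x u v. (x, u) \<in> topspace T \<Longrightarrow> (x, v) \<in> topspace T \<Longrightarrow> h x (u + v) = h x u + h x v"
    and "\<And>x a u. (x, u) \<in> topspace T \<Longrightarrow> h x (s a u) = t a (h x u)"
  shows "bundle_isomorphic s t T T'"
proof -
  have "homeomorphic_maps T T' (\<lambda>(x, u). (x, h x u)) (\<lambda>(x, v). (x, k x v))"
    using assms(1-4) by (auto simp: homeomorphic_maps_def)
  then have "homeomorphic_map T T' (\<lambda>(x, u). (x, h x u))"
    using homeomorphic_map_maps by blast
  moreover have "(x, h x u) \<in> topspace T'" if "(x, u) \<in> topspace T" for x u
    using continuous_map_fibre[OF assms(1) that] .
  ultimately show ?thesis
    using assms(5,6) by (auto simp: bundle_isomorphic_def linear_between_def)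
qed

text \<open>\<open>bundle_isomorphic\<close> hides the inverse inside a homeomorphism of pairs; here
  it becomes an explicit fibrewise map \<open>k\<close>. Linearity is recorded for \<open>h\<close>
  alone: for \<open>k\<close> it has to be derived, and that takes fibres closed under the
  operations.\<close>

definition inverse_bundle_maps ::
  "('k \<Rightarrow> 'e::ab_group_add \<Rightarrow> 'e) \<Rightarrow> ('k \<Rightarrow> 'f::ab_group_add \<Rightarrow> 'f) \<Rightarrow> ('x \<times> 'e) topology \<Rightarrow>
   ('x \<times> 'f) topology \<Rightarrow> ('x \<Rightarrow> 'e \<Rightarrow> 'f) \<Rightarrow> ('x \<Rightarrow> 'f \<Rightarrow> 'e) \<Rightarrow> bool" where
  "inverse_bundle_maps s t T T' h k \<longleftrightarrow>
     continuous_map T T' (\<lambda>(x, u). (x, h x u)) \<and> continuous_map T' T (\<lambda>(x, v). (x, k x v))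
   \<and> (\<forall>x u. (x, u) \<in> topspace T \<longrightarrow> k x (h x u) = u) \<and> (\<forall>x v. (x, v) \<in> topspace T' \<longrightarrow> h x (k x v) = v)
   \<and> (\<forall>x u v. (x, u) \<in> topspace T \<longrightarrow> (x, v) \<in> topspace T \<longrightarrow> h x (u + v) = h x u + h x v)
   \<and> (\<forall>x a u. (x, u) \<in> topspace T \<longrightarrow> h x (s a u) = t a (h x u))"

lemma inverse_bundle_mapsD:
  assumes "inverse_bundle_maps s t T T' h k"
  shows "continuous_map T T' (\<lambda>(x, u). (x, h x u))" "continuous_map T' T (\<lambda>(x, v). (x, k x v))"
    "\<And>x u. (x, u) \<in> topspace T \<Longrightarrow> (x, h x u) \<in> topspace T'"
    "\<And>x v. (x, v) \<in> topspace T' \<Longrightarrow> (x, k x v) \<in> topspace T"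
    "\<And>x u. (x, u) \<in> topspace T \<Longrightarrow> k x (h x u) = u"
    "\<And>x v. (x, v) \<in> topspace T' \<Longrightarrow> h x (k x v) = v"
    "\<And>x u v. (x, u) \<in> topspace T \<Longrightarrow> (x, v) \<in> topspace T \<Longrightarrow> h x (u + v) = h x u + h x v"
    "\<And>x a u. (x, u) \<in> topspace T \<Longrightarrow> h x (s a u) = t a (h x u)"
  using assms continuous_map_fibre[of T T' h] continuous_map_fibre[of T' T k]
  by (simp_all add: inverse_bundle_maps_def)

lemma bundle_isomorphicE:
  assumes "bundle_isomorphic s t T T'"
  shows "\<exists>h k. inverse_bundle_maps s t T T' h k"
proof -
  obtain h where h: "homeomorphic_map T T' (\<lambda>(x, u). (x, h x u))"
    and lin: "\<And>x. linear_between s t {u. (x, u) \<in> topspace T} {v. (x, v) \<in> topspace T'} (h x)"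
    using assms by (auto simp: bundle_isomorphic_def)
  obtain g where g: "homeomorphic_maps T T' (\<lambda>(x, u). (x, h x u)) g"
    using h homeomorphic_map_maps by blast
  define k where "k x v = snd (g (x, v))" for x v
  have gk: "g (x, v) = (x, k x v)" if "(x, v) \<in> topspace T'" for x v
  proof -
    have "(\<lambda>(x, u). (x, h x u)) (g (x, v)) = (x, v)"
      using g that by (auto simp: homeomorphic_maps_def)
    then show ?thesis by (cases "g (x, v)") (auto simp: k_def)
  qed
  have ck: "continuous_map T' T (\<lambda>(x, v). (x, k x v))"
    by (rule continuous_map_eq[of T' T g]) (use g gk in \<open>auto simp: homeomorphic_maps_def\<close>)
  have ch: "continuous_map T T' (\<lambda>(x, u). (x, h x u))"
    using g by (simp add: homeomorphic_maps_def)
  have hT: "(x, h x u) \<in> topspace T'" if "(x, u) \<in> topspace T" for x u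
    using continuous_map_fibre[OF ch that] .
  have "k x (h x u) = u" if "(x, u) \<in> topspace T" for x u
    using g gk[OF hT[OF that]] that by (auto simp: homeomorphic_maps_def)
  moreover have "h x (k x v) = v" if "(x, v) \<in> topspace T'" for x v
    using g gk[OF that] that by (auto simp: homeomorphic_maps_def)
  ultimately have "inverse_bundle_maps s t T T' h k"
    using ch ck lin by (simp add: inverse_bundle_maps_def linear_between_def)
  then show ?thesis by blast
qed

text \<open>A local trivialisation split into a frame \<open>e\<close> and coordinate functions
  \<open>c\<close>. The homeomorphism turns into continuity of the map that forms combinations, of
  the projection, and of finitely many scalar functions.\<close>

definition vb_frame ::
  "('k::real_or_complex \<Rightarrow> 'e::ab_group_add \<Rightarrow> 'e) \<Rightarrow> 'x topology \<Rightarrow> ('x \<times> 'e) topology \<Rightarrow>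
   'x set \<Rightarrow> nat \<Rightarrow> (nat \<Rightarrow> 'x \<Rightarrow> 'e) \<Rightarrow> (nat \<Rightarrow> 'x \<times> 'e \<Rightarrow> 'k) \<Rightarrow> bool" where
  "vb_frame s X T U n e c \<longleftrightarrow> openin X U
     \<and> (\<forall>y\<in>U. \<forall>a. (y, \<Sum>i<n. s (a i) (e i y)) \<in> topspace T)
     \<and> (\<forall>y\<in>U. \<forall>a. \<forall>j<n. c j (y, \<Sum>i<n. s (a i) (e i y)) = a j)
     \<and> (\<forall>y\<in>U. \<forall>u. (y, u) \<in> topspace T \<longrightarrow> (\<Sum>i<n. s (c i (y, u)) (e i y)) = u)
     \<and> continuous_map (prod_topology (subtopology X U) (product_topology (\<lambda>_. euclidean) {..<n})) T
         (\<lambda>(y, a). (y, \<Sum>i<n. s (a i) (e i y)))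
     \<and> continuous_map (subtopology T (U \<times> UNIV)) X fst
     \<and> (\<forall>i<n. continuous_map (subtopology T (U \<times> UNIV)) euclidean (c i))"

lemma vb_frameD:
  assumes "vb_frame s X T U n e c"
  shows "openin X U" "\<And>y a. y \<in> U \<Longrightarrow> (y, \<Sum>i<n. s (a i) (e i y)) \<in> topspace T"
    "\<And>y a j. y \<in> U \<Longrightarrow> j < n \<Longrightarrow> c j (y, \<Sum>i<n. s (a i) (e i y)) = a j"
    "\<And>y u. y \<in> U \<Longrightarrow> (y, u) \<in> topspace T \<Longrightarrow> (\<Sum>i<n. s (c i (y, u)) (e i y)) = u"
    "continuous_map (prod_topology (subtopology X U) (product_topology (\<lambda>_. euclidean) {..<n})) T
       (\<lambda>(y, a). (y, \<Sum>i<n. s (a i) (e i y)))"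
    "continuous_map (subtopology T (U \<times> UNIV)) X fst"
    "\<And>i. i < n \<Longrightarrow> continuous_map (subtopology T (U \<times> UNIV)) euclidean (c i)"
  using assms by (simp_all add: vb_frame_def)

lemma is_vector_bundleI:
  assumes "vector_space s" and "topspace T \<subseteq> topspace X \<times> UNIV"
    and fr: "\<And>x. x \<in> topspace X \<Longrightarrow> \<exists>U n e c. x \<in> U \<and> vb_frame s X T U n e c"
  shows "is_vector_bundle s X T"
  unfolding is_vector_bundle_def
proof (intro conjI ballI assms(1,2))
  let ?S = "\<lambda>U n::nat. prod_topology (subtopology X U) (product_topology (\<lambda>_. euclidean :: 'a topology) {..<n})"
  fix x assume "x \<in> topspace X"
  then obtain U n e c where x: "x \<in> U" and fr: "vb_frame s X T U n e c"
    using fr by blast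
  let ?f = "\<lambda>(y, a). (y, \<Sum>i<n. s (a i) (e i y))"
  let ?g = "\<lambda>z. (fst z, \<lambda>i\<in>{..<n}. c i z)"
  note U = vb_frameD(1)[OF fr] and mem = vb_frameD(2)[OF fr] and ca = vb_frameD(3)[OF fr]
    and cu = vb_frameD(4)[OF fr] and cf = vb_frameD(5)[OF fr] and c1 = vb_frameD(6)[OF fr]
    and c2 = vb_frameD(7)[OF fr]
  have "homeomorphic_maps (?S U n) (subtopology T (U \<times> UNIV)) ?f ?g"
    unfolding homeomorphic_maps_def
  proof (intro conjI ballI)
    show "continuous_map (?S U n) (subtopology T (U \<times> UNIV)) ?f"
      using cf by (auto simp: continuous_map_in_subtopology)
    show "continuous_map (subtopology T (U \<times> UNIV)) (?S U n) ?g"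
      using c1 c2 by (auto simp: continuous_map_pairwise o_def continuous_map_in_subtopology
          continuous_map_componentwise)
    show "?g (?f z) = z" if "z \<in> topspace (?S U n)" for z
      using that ca by (auto simp: PiE_def extensional_def fun_eq_iff)
    show "?f (?g z) = z" if "z \<in> topspace (subtopology T (U \<times> UNIV))" for z
      using that cu[of "fst z" "snd z"] by (auto simp: case_prod_unfold)
  qed
  then have "homeomorphic_map (?S U n) (subtopology T (U \<times> UNIV)) ?f"
    using homeomorphic_map_maps by blast
  then show "\<exists>U (n::nat) e. openin X U \<and> x \<in> U \<and> homeomorphic_map (?S U n)
      (subtopology T (U \<times> UNIV)) (\<lambda>(y, a). (y, \<Sum>i<n. s (a i) (e i y)))"
    using U x by blast
qed

lemma is_vector_bundle_frame:
  assumes vb: "is_vector_bundle s X T" and x: "x \<in> topspace X"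
  shows "\<exists>U n e c. x \<in> U \<and> vb_frame s X T U n e c"
proof -
  let ?S = "\<lambda>U n::nat. prod_topology (subtopology X U) (product_topology (\<lambda>_. euclidean :: 'a topology) {..<n})"
  obtain U and n :: nat and e where U: "openin X U" "x \<in> U" and hm: "homeomorphic_map (?S U n)
      (subtopology T (U \<times> UNIV)) (\<lambda>(y, a). (y, \<Sum>i<n. s (a i) (e i y)))"
    using vb x unfolding is_vector_bundle_def by blast
  let ?f = "\<lambda>(y, a). (y, \<Sum>i<n. s (a i) (e i y))"
  obtain g where g: "homeomorphic_maps (?S U n) (subtopology T (U \<times> UNIV)) ?f g"
    using hm homeomorphic_map_maps by blast
  have UX: "U \<subseteq> topspace X" using U by (simp add: openin_subset)
  have cf: "continuous_map (?S U n) (subtopology T (U \<times> UNIV)) ?f"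
    and cg: "continuous_map (subtopology T (U \<times> UNIV)) (?S U n) g"
    and gf: "\<And>z. z \<in> topspace (?S U n) \<Longrightarrow> g (?f z) = z"
    and fg: "\<And>z. z \<in> topspace T \<Longrightarrow> fst z \<in> U \<Longrightarrow> ?f (g z) = z"
    using g by (auto simp: homeomorphic_maps_def)
  have fgz: "fst (g z) = fst z" if "z \<in> topspace T" "fst z \<in> U" for z
    using arg_cong[OF fg[OF that], of fst] by (simp add: case_prod_unfold)
  define c where "c i z = snd (g z) i" for i z
  \<comment> \<open>Points of the product topology are extensional functions, so coefficient
    families are cut off outside \<open>{..<n}\<close>; the sum does not see this.\<close>
  have restr: "(\<Sum>i<n. s (restrict a {..<n} i) (e i y)) = (\<Sum>i<n. s (a i) (e i y))" for a y
    by (rule sum.cong) auto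
  have zS: "(y, restrict a {..<n}) \<in> topspace (?S U n)" if "y \<in> U" for y a
    using that UX by auto
  have "vb_frame s X T U n e c"
    unfolding vb_frame_def
  proof (intro conjI ballI allI impI)
    show "openin X U" by (rule U)
    fix y assume y: "y \<in> U"
    show "(y, \<Sum>i<n. s (a i) (e i y)) \<in> topspace T" for a
      using funcset_mem[OF continuous_map_funspace[OF cf] zS[OF y, of a]] by (simp add: restr)
    show "c j (y, \<Sum>i<n. s (a i) (e i y)) = a j" if "j < n" for a j
      using gf[OF zS[OF y, of a]] that by (simp add: restr c_def)
    show "(\<Sum>i<n. s (c i (y, u)) (e i y)) = u" if "(y, u) \<in> topspace T" for u
      using fg[OF that] y by (auto simp: c_def case_prod_unfold)
  next
    show "continuous_map (?S U n) T ?f"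
      using cf by (simp add: continuous_map_in_subtopology)
    have "continuous_map (subtopology T (U \<times> UNIV)) (subtopology X U) (fst \<circ> g)"
      using cg by (simp add: continuous_map_pairwise)
    then have "continuous_map (subtopology T (U \<times> UNIV)) X (fst \<circ> g)"
      by (simp add: continuous_map_in_subtopology)
    then show "continuous_map (subtopology T (U \<times> UNIV)) X fst"
      by (rule continuous_map_eq) (auto simp: fgz)
    fix i assume i: "i < n"
    have "continuous_map (subtopology T (U \<times> UNIV)) (product_topology (\<lambda>_. euclidean :: 'a topology) {..<n}) (snd \<circ> g)"
      using cg by (simp add: continuous_map_pairwise)
    then show "continuous_map (subtopology T (U \<times> UNIV)) euclidean (c i)"
      using i by (simp add: continuous_map_componentwise c_def[abs_def])
  qed
  with U(2) show ?thesis by blast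
qed

lemma is_vector_bundle_fibre_closed:
  assumes vb: "is_vector_bundle s X T" and u: "(x, u) \<in> topspace T"
  shows "(x, v) \<in> topspace T \<Longrightarrow> (x, u + v) \<in> topspace T" "(x, s a u) \<in> topspace T"
    "(x, 0) \<in> topspace T"
proof -
  interpret vector_space s using vb by (simp add: is_vector_bundle_def)
  have "x \<in> topspace X" using vb u by (auto simp: is_vector_bundle_def)
  then obtain U n e c where x: "x \<in> U" and fr: "vb_frame s X T U n e c"
    using is_vector_bundle_frame[OF vb] by metis
  have mem: "(x, \<Sum>i<n. s (a i) (e i x)) \<in> topspace T" for a
    using vb_frameD(2)[OF fr x] .
  have cu: "(\<Sum>i<n. s (c i (x, u)) (e i x)) = u" if "(x, u) \<in> topspace T" for u
    using vb_frameD(4)[OF fr x that] .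
  show "(x, u + v) \<in> topspace T" if "(x, v) \<in> topspace T"
    using mem[of "\<lambda>i. c i (x, u) + c i (x, v)"] cu[OF u] cu[OF that]
    by (simp add: scale_left_distrib sum.distrib)
  show "(x, s a u) \<in> topspace T"
    using mem[of "\<lambda>i. a * c i (x, u)"] cu[OF u]
    by (simp add: scale_sum_right[symmetric] flip: scale_scale)
  show "(x, 0) \<in> topspace T" using mem[of "\<lambda>i. 0"] by simp
qed

text \<open>The inverse is shown to be additive by cancelling \<open>h\<close>, which requires
  \<open>k x u + k x v\<close> to lie in the total space. A bare topology does not ensure this; the
  frames of a vector bundle do.\<close>

lemma bundle_isomorphic_sym:
  assumes iso: "bundle_isomorphic s t T T'" and vb: "is_vector_bundle s X T"
  shows "bundle_isomorphic t s T' T"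
proof -
  obtain h k where "inverse_bundle_maps s t T T' h k"
    using bundle_isomorphicE[OF iso] by blast
  note h = inverse_bundle_mapsD[OF this]
  show ?thesis
  proof (rule bundle_isomorphicI[OF h(2,1,6,5)])
    fix x u v assume uv: "(x, u) \<in> topspace T'" "(x, v) \<in> topspace T'"
    have "k x (h x (k x u + k x v)) = k x u + k x v"
      using uv by (intro h(5) is_vector_bundle_fibre_closed[OF vb] h(4))
    then show "k x (u + v) = k x u + k x v"
      using uv h(7)[OF h(4)[OF uv(1)] h(4)[OF uv(2)]] by (simp add: h(6))
  next
    fix x a u assume u: "(x, u) \<in> topspace T'"
    have "k x (h x (s a (k x u))) = s a (k x u)"
      using u by (intro h(5) is_vector_bundle_fibre_closed[OF vb] h(4))
    then show "k x (t a u) = s a (k x u)"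
      using u h(8)[OF h(4)[OF u]] by (simp add: h(6))
  qed
qed

lemma bundle_isomorphic_trans:
  assumes "bundle_isomorphic s t T T'" "bundle_isomorphic t r T' T''"
  shows "bundle_isomorphic s r T T''"
proof -
  obtain h k where "inverse_bundle_maps s t T T' h k"
    using bundle_isomorphicE[OF assms(1)] by blast
  note h = inverse_bundle_mapsD[OF this]
  obtain h' k' where "inverse_bundle_maps t r T' T'' h' k'"
    using bundle_isomorphicE[OF assms(2)] by blast
  note h' = inverse_bundle_mapsD[OF this]
  have 1: "continuous_map T T'' (\<lambda>(x, u). (x, h' x (h x u)))"
    using continuous_map_compose[OF h(1) h'(1)] by (simp add: o_def case_prod_unfold)
  have 2: "continuous_map T'' T (\<lambda>(x, u). (x, k x (k' x u)))"
    using continuous_map_compose[OF h'(2) h(2)] by (simp add: o_def case_prod_unfold)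
  show ?thesis
    by (rule bundle_isomorphicI[OF 1 2]) (simp_all add: h(3-8) h'(3-8))
qed

text \<open>The frame is transported pointwise to \<open>h y (e i y)\<close>, and the new
  trivialisation is the old one followed by the isomorphism.\<close>

lemma is_vector_bundle_isomorphic:
  assumes iso: "bundle_isomorphic s t T T'" and vb: "is_vector_bundle s X T" and t: "vector_space t"
  shows "is_vector_bundle t X T'"
  unfolding is_vector_bundle_def
proof (intro conjI ballI t)
  let ?S = "\<lambda>U n::nat. prod_topology (subtopology X U) (product_topology (\<lambda>_. euclidean :: 'a topology) {..<n})"
  interpret t: vector_space t by (rule t)
  interpret s: vector_space s using vb by (simp add: is_vector_bundle_def)
  obtain h k where "inverse_bundle_maps s t T T' h k"
    using bundle_isomorphicE[OF iso] by blast
  note h = inverse_bundle_mapsD[OF this]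
  have "topspace T \<subseteq> topspace X \<times> UNIV" using vb by (simp add: is_vector_bundle_def)
  then show "topspace T' \<subseteq> topspace X \<times> UNIV" using h(4) by fastforce
  fix x assume "x \<in> topspace X"
  then obtain U and n :: nat and e where U: "openin X U" "x \<in> U" and hm: "homeomorphic_map (?S U n)
      (subtopology T (U \<times> UNIV)) (\<lambda>(y, a). (y, \<Sum>i<n. s (a i) (e i y)))"
    using vb unfolding is_vector_bundle_def by blast
  have UX: "U \<subseteq> topspace X" using U by (simp add: openin_subset)
  have mem: "(y, \<Sum>i<n. s (a i) (e i y)) \<in> topspace T" if y: "y \<in> U" for y a
  proof -
    have "(y, restrict a {..<n}) \<in> topspace (?S U n)" using y UX by auto
    from continuous_map_fibre[OF homeomorphic_imp_continuous_map[OF hm] this, unfolded case_prod_conv]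
    show ?thesis by simp
  qed
  have eT: "(y, e i y) \<in> topspace T" if "y \<in> U" "i < n" for y i
  proof -
    have "(\<Sum>j<n. s (if j = i then 1 else 0) (e j y)) = (\<Sum>j<n. if j = i then e j y else 0)"
      by (rule sum.cong) auto
    also have "\<dots> = e i y" using that(2) by simp
    finally show ?thesis using mem[OF that(1), of "\<lambda>j. if j = i then 1 else 0"] by simp
  qed
  \<comment> \<open>\<open>h\<close> is known to be additive on fibres only, so membership of the
    partial sums is carried through the induction.\<close>
  have hsum: "h y (\<Sum>i\<in>I. s (a i) (e i y)) = (\<Sum>i\<in>I. t (a i) (h y (e i y)))
      \<and> (y, \<Sum>i\<in>I. s (a i) (e i y)) \<in> topspace T"
    if y: "y \<in> U" and "I \<subseteq> {..<n}" "finite I" for y a I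
    using that(3,2)
  proof (induction I)
    case empty
    have "(y, 0) \<in> topspace T" using mem[OF y, of "\<lambda>_. 0"] by simp
    then show ?case using h(8)[of y 0 0] by simp
  next
    case (insert i I)
    then have "(y, e i y) \<in> topspace T" using eT y by blast
    with insert show ?case
      by (simp add: h is_vector_bundle_fibre_closed[OF vb])
  qed
  then have hs: "h y (\<Sum>i<n. s (a i) (e i y)) = (\<Sum>i<n. t (a i) (h y (e i y)))" if "y \<in> U" for y a
    using that by blast
  have "homeomorphic_maps T T' (\<lambda>(x, u). (x, h x u)) (\<lambda>(x, v). (x, k x v))"
    using h by (auto simp: homeomorphic_maps_def)
  then have "homeomorphic_maps (subtopology T (U \<times> UNIV)) (subtopology T' (U \<times> UNIV))
      (\<lambda>(x, u). (x, h x u)) (\<lambda>(x, v). (x, k x v))"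
    by (rule homeomorphic_maps_subtopologies_alt) auto
  then have "homeomorphic_map (subtopology T (U \<times> UNIV)) (subtopology T' (U \<times> UNIV)) (\<lambda>(x, u). (x, h x u))"
    using homeomorphic_map_maps by blast
  from homeomorphic_map_compose[OF hm this]
  have "homeomorphic_map (?S U n) (subtopology T' (U \<times> UNIV)) (\<lambda>(y, a). (y, \<Sum>i<n. t (a i) (h y (e i y))))"
  proof (rule homeomorphic_map_eq)
    fix z assume "z \<in> topspace (?S U n)"
    then have "fst z \<in> U" by (simp add: mem_Times_iff)
    then show "((\<lambda>(x, u). (x, h x u)) \<circ> (\<lambda>(y, a). (y, \<Sum>i<n. s (a i) (e i y)))) z
        = (\<lambda>(y, a). (y, \<Sum>i<n. t (a i) (h y (e i y)))) z"
      using hs[of "fst z" "snd z"] by (simp add: case_prod_unfold)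
  qed
  with U show "\<exists>U (n::nat) e. openin X U \<and> x \<in> U \<and> homeomorphic_map (?S U n)
      (subtopology T' (U \<times> UNIV)) (\<lambda>(y, a). (y, \<Sum>i<n. t (a i) (e i y)))"
    by (intro exI[of _ U] exI[of _ n] exI[of _ "\<lambda>i y. h y (e i y)"]) simp
qed

section \<open>Whitney sums\<close>

lemma topspace_whitney_sum:
  "topspace (whitney_sum T T') = {(x, (u, v)). (x, u) \<in> topspace T \<and> (x, v) \<in> topspace T'}"
  by (auto simp: whitney_sum_def topspace_pullback_topology)

text \<open>The universal property of the fibre product over the base; it reduces continuity claims
  about Whitney sums to their two components.\<close>

lemma continuous_map_whitney_sum:
  "continuous_map S (whitney_sum T T') g \<longleftrightarrow>
     continuous_map S T (\<lambda>z. (fst (g z), fst (snd (g z))))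
   \<and> continuous_map S T' (\<lambda>z. (fst (g z), snd (snd (g z))))"
proof -
  let ?f = "\<lambda>(x, (u, v)). ((x, u), (x, v))"
  have "continuous_map S (whitney_sum T T') g \<longleftrightarrow> continuous_map S (prod_topology T T') (?f \<circ> g)"
  proof
    assume g: "continuous_map S (whitney_sum T T') g"
    have "continuous_map (whitney_sum T T') (prod_topology T T') (id \<circ> ?f)"
      unfolding whitney_sum_def by (rule continuous_map_pullback) simp
    then show "continuous_map S (prod_topology T T') (?f \<circ> g)"
      using continuous_map_compose[OF g] by fastforce
  next
    assume "continuous_map S (prod_topology T T') (?f \<circ> g)"
    then show "continuous_map S (whitney_sum T T') g"
      unfolding whitney_sum_def by (rule continuous_map_pullback') auto
  qed
  also have "\<dots> \<longleftrightarrow> continuous_map S T (\<lambda>z. (fst (g z), fst (snd (g z))))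
   \<and> continuous_map S T' (\<lambda>z. (fst (g z), snd (snd (g z))))"
    by (simp add: continuous_map_pairwise o_def case_prod_unfold)
  finally show ?thesis .
qed

lemma continuous_map_whitney_sum_proj:
  "continuous_map (whitney_sum T T') T (\<lambda>(x, (u, v)). (x, u))"
  "continuous_map (whitney_sum T T') T' (\<lambda>(x, (u, v)). (x, v))"
  using continuous_map_whitney_sum[of "whitney_sum T T'" T T' id]
  by (simp_all add: case_prod_unfold)

lemma vector_space_smult_pair:
  assumes "vector_space s" "vector_space t"
  shows "vector_space (smult_pair s t)"
proof -
  interpret s: vector_space s by fact
  interpret t: vector_space t by fact
  show ?thesis
    by unfold_locales (auto simp: smult_pair_def s.scale_right_distrib t.scale_right_distrib
        s.scale_left_distrib t.scale_left_distrib)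
qed

lemma vector_space_smult_seq: "vector_space (smult_seq :: 'k::field \<Rightarrow> _)"
  by unfold_locales (auto simp: smult_seq_def fun_eq_iff algebra_simps)

lemma smult_pair_apply [simp]: "smult_pair s t a p = (s a (fst p), t a (snd p))"
  by (simp add: smult_pair_def case_prod_unfold)

lemma whitney_sum_cong:
  assumes "bundle_isomorphic s s' A A'" "bundle_isomorphic t t' B B'"
  shows "bundle_isomorphic (smult_pair s t) (smult_pair s' t') (whitney_sum A B) (whitney_sum A' B')"
proof -
  obtain h k where "inverse_bundle_maps s s' A A' h k"
    using bundle_isomorphicE[OF assms(1)] by blast
  note h = inverse_bundle_mapsD[OF this]
  obtain h' k' where "inverse_bundle_maps t t' B B' h' k'"
    using bundle_isomorphicE[OF assms(2)] by blast
  note h' = inverse_bundle_mapsD[OF this]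
  have 1: "continuous_map (whitney_sum A B) (whitney_sum A' B') (\<lambda>(x, p). (x, (h x (fst p), h' x (snd p))))"
    using continuous_map_compose[OF continuous_map_whitney_sum_proj(1) h(1), of B]
      continuous_map_compose[OF continuous_map_whitney_sum_proj(2) h'(1), of A]
    by (simp add: continuous_map_whitney_sum o_def case_prod_unfold)
  have 2: "continuous_map (whitney_sum A' B') (whitney_sum A B) (\<lambda>(x, p). (x, (k x (fst p), k' x (snd p))))"
    using continuous_map_compose[OF continuous_map_whitney_sum_proj(1) h(2), of B']
      continuous_map_compose[OF continuous_map_whitney_sum_proj(2) h'(2), of A']
    by (simp add: continuous_map_whitney_sum o_def case_prod_unfold)
  show ?thesis
    by (rule bundle_isomorphicI[OF 1 2]) (auto simp: topspace_whitney_sum h(3-8) h'(3-8))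
qed

lemma whitney_sum_commute:
  "bundle_isomorphic (smult_pair s t) (smult_pair t s) (whitney_sum A B) (whitney_sum B A)"
proof -
  have 1: "continuous_map (whitney_sum A B) (whitney_sum B A) (\<lambda>(x, p). (x, (snd p, fst p)))" for A :: "('x \<times> 'e) topology"  and B :: "('x \<times> 'f) topology"
    using continuous_map_whitney_sum_proj[of A B]
    by (simp add: continuous_map_whitney_sum o_def case_prod_unfold)
  show ?thesis
    by (rule bundle_isomorphicI[OF 1 1]) (auto simp: topspace_whitney_sum)
qed

lemma whitney_sum_assoc:
  "bundle_isomorphic (smult_pair (smult_pair r s) t) (smult_pair r (smult_pair s t))
     (whitney_sum (whitney_sum A B) C) (whitney_sum A (whitney_sum B C))"
proof -
  have 1: "continuous_map (whitney_sum (whitney_sum A B) C) (whitney_sum A (whitney_sum B C))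
      (\<lambda>(x, p). (x, (fst (fst p), (snd (fst p), snd p))))"
    using continuous_map_whitney_sum_proj(2)[of "whitney_sum A B" C]
      continuous_map_compose[OF continuous_map_whitney_sum_proj(1)[of "whitney_sum A B" C]
          continuous_map_whitney_sum_proj(1)[of A B]]
      continuous_map_compose[OF continuous_map_whitney_sum_proj(1)[of "whitney_sum A B" C]
          continuous_map_whitney_sum_proj(2)[of A B]]
    by (simp add: continuous_map_whitney_sum o_def case_prod_unfold)
  have 2: "continuous_map (whitney_sum A (whitney_sum B C)) (whitney_sum (whitney_sum A B) C)
      (\<lambda>(x, p). (x, ((fst p, fst (snd p)), snd (snd p))))"
    using continuous_map_whitney_sum_proj(1)[of A "whitney_sum B C"]
      continuous_map_compose[OF continuous_map_whitney_sum_proj(2)[of A "whitney_sum B C"]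
          continuous_map_whitney_sum_proj(1)[of B C]]
      continuous_map_compose[OF continuous_map_whitney_sum_proj(2)[of A "whitney_sum B C"]
          continuous_map_whitney_sum_proj(2)[of B C]]
    by (simp add: continuous_map_whitney_sum o_def case_prod_unfold)
  show ?thesis
    by (rule bundle_isomorphicI[OF 1 2]) (auto simp: topspace_whitney_sum)
qed

lemma vb_frame_subset:
  assumes fr: "vb_frame s X T U n e c" and O: "openin X U'" "U' \<subseteq> U"
  shows "vb_frame s X T U' n e c"
proof -
  note D = vb_frameD[OF fr]
  let ?P = "product_topology (\<lambda>_. euclidean :: 'a topology) {..<n}"
  have "continuous_map (prod_topology (subtopology X U') ?P) X fst"
    by (intro continuous_map_into_fulltopology[OF continuous_map_fst])
  then have "continuous_map (prod_topology (subtopology X U') ?P) (prod_topology (subtopology X U) ?P) id"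
    unfolding continuous_map_pairwise
    using O(2) by (auto simp: o_def continuous_map_in_subtopology continuous_map_fst continuous_map_snd
        intro: continuous_map_into_fulltopology)
  from continuous_map_compose[OF this D(5)]
  have "continuous_map (prod_topology (subtopology X U') ?P) T (\<lambda>(y, a). (y, \<Sum>i<n. s (a i) (e i y)))"
    by simp
  moreover have "subtopology T (U' \<times> UNIV) = subtopology (subtopology T (U \<times> UNIV)) (U' \<times> UNIV)"
    using O(2) by (simp add: subtopology_subtopology Times_Int_Times Int_absorb1)
  ultimately show ?thesis
    using O D by (auto simp: vb_frame_def continuous_map_from_subtopology)
qed

lemma sum_lessThan_add:
  fixes f :: "nat \<Rightarrow> 'a::comm_monoid_add"
  shows "sum f {..<n + m} = sum f {..<n} + (\<Sum>i<m. f (n + i))"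
  by (induction m) (simp_all add: add_ac)

lemma is_vector_bundle_whitney_sum:
  fixes s :: "'k::real_or_complex \<Rightarrow> 'e::ab_group_add \<Rightarrow> 'e" and t :: "'k \<Rightarrow> 'f::ab_group_add \<Rightarrow> 'f"
    and A :: "('x \<times> 'e) topology" and B :: "('x \<times> 'f) topology"
  assumes A: "is_vector_bundle s X A" and B: "is_vector_bundle t X B"
  shows "is_vector_bundle (smult_pair s t) X (whitney_sum A B)"
proof (rule is_vector_bundleI)
  have vs: "vector_space s" "vector_space t" using A B by (auto simp: is_vector_bundle_def)
  interpret s: vector_space s by (rule vs)
  interpret t: vector_space t by (rule vs)
  show "vector_space (smult_pair s t)" by (rule vector_space_smult_pair[OF vs])
  have "topspace A \<subseteq> topspace X \<times> UNIV" using A by (simp add: is_vector_bundle_def)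
  then show "topspace (whitney_sum A B) \<subseteq> topspace X \<times> UNIV"
    by (auto simp: topspace_whitney_sum)
  fix x assume x: "x \<in> topspace X"
  obtain U1 n e1 c1 where 1: "x \<in> U1" "vb_frame s X A U1 n e1 c1"
    using is_vector_bundle_frame[OF A x] by blast
  obtain U2 m e2 c2 where 2: "x \<in> U2" "vb_frame t X B U2 m e2 c2"
    using is_vector_bundle_frame[OF B x] by blast
  define U where "U = U1 \<inter> U2"
  have U: "openin X U" "x \<in> U" "U \<subseteq> U1" "U \<subseteq> U2"
    using 1(1) 2(1) vb_frameD(1)[OF 1(2)] vb_frameD(1)[OF 2(2)] by (auto simp: U_def)
  note F1 = vb_frameD[OF vb_frame_subset[OF 1(2) U(1,3)]]
  note F2 = vb_frameD[OF vb_frame_subset[OF 2(2) U(1,4)]]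
  \<comment> \<open>The frames are concatenated: index \<open>n + i\<close> stands for element
    \<open>i\<close> of the frame of \<open>B\<close>.\<close>
  define e where "e i y = (if i < n then (e1 i y, 0) else (0, e2 (i - n) y))" for i y
  define c where "c i z = (if i < n then c1 i (fst z, fst (snd z)) else c2 (i - n) (fst z, snd (snd z)))"
    for i and z :: "'x \<times> 'e \<times> 'f"
  let ?P = "\<lambda>n. product_topology (\<lambda>_. euclidean :: 'k topology) {..<n}"
  let ?S = "prod_topology (subtopology X U) (?P (n + m))"
  have sums: "(\<Sum>i<n + m. smult_pair s t (a i) (e i y))
      = (\<Sum>i<n. s (a i) (e1 i y), \<Sum>i<m. t (a (n + i)) (e2 i y))" for a y
    unfolding sum_lessThan_add by (simp add: e_def sum_prod)
  have "vb_frame (smult_pair s t) X (whitney_sum A B) U (n + m) e c"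
    unfolding vb_frame_def sums
  proof (intro conjI ballI allI impI)
    show "openin X U" by (rule U)
    fix y assume y: "y \<in> U"
    show "(y, (\<Sum>i<n. s (a i) (e1 i y), \<Sum>i<m. t (a (n + i)) (e2 i y))) \<in> topspace (whitney_sum A B)" for a
      using F1(2)[OF y] F2(2)[OF y] by (simp add: topspace_whitney_sum)
    show "c j (y, (\<Sum>i<n. s (a i) (e1 i y), \<Sum>i<m. t (a (n + i)) (e2 i y))) = a j" if "j < n + m" for a j
      using F1(3)[OF y, of j a] F2(3)[OF y, of "j - n" "\<lambda>i. a (n + i)"] that
      by (auto simp: c_def)
    show "(\<Sum>i<n. s (c i (y, u)) (e1 i y), \<Sum>i<m. t (c (n + i) (y, u)) (e2 i y)) = u"
      if "(y, u) \<in> topspace (whitney_sum A B)" for u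
      using F1(4)[OF y, of "fst u"] F2(4)[OF y, of "snd u"] that
      by (simp add: c_def topspace_whitney_sum case_prod_unfold)
  next
    have co: "continuous_map ?S euclidean (\<lambda>z. snd z i)" if "i < n + m" for i
      using continuous_map_componentwise[of ?S "\<lambda>_. euclidean :: 'k topology" "{..<n + m}" snd]
        continuous_map_snd[of "subtopology X U" "?P (n + m)"] that by simp
    have g1: "continuous_map ?S (prod_topology (subtopology X U) (?P n)) (\<lambda>z. (fst z, \<lambda>i\<in>{..<n}. snd z i))"
      using co by (auto simp: continuous_map_pairwise o_def continuous_map_fst continuous_map_componentwise)
    have g2: "continuous_map ?S (prod_topology (subtopology X U) (?P m)) (\<lambda>z. (fst z, \<lambda>i\<in>{..<m}. snd z (n + i)))"
      using co by (auto simp: continuous_map_pairwise o_def continuous_map_fst continuous_map_componentwise)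
    have "continuous_map ?S A (\<lambda>z. (fst z, \<Sum>i<n. s (snd z i) (e1 i (fst z))))"
      using continuous_map_compose[OF g1 F1(5)] by (simp add: o_def)
    moreover have "continuous_map ?S B (\<lambda>z. (fst z, \<Sum>i<m. t (snd z (n + i)) (e2 i (fst z))))"
      using continuous_map_compose[OF g2 F2(5)] by (simp add: o_def)
    ultimately show "continuous_map ?S (whitney_sum A B)
        (\<lambda>(y, a). (y, (\<Sum>i<n. s (a i) (e1 i y), \<Sum>i<m. t (a (n + i)) (e2 i y))))"
      by (simp add: continuous_map_whitney_sum case_prod_unfold)
    let ?W = "subtopology (whitney_sum A B) (U \<times> UNIV)"
    have p1: "continuous_map ?W (subtopology A (U \<times> UNIV)) (\<lambda>z. (fst z, fst (snd z)))"
      using continuous_map_whitney_sum_proj(1)[of A B]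
      by (auto simp: continuous_map_in_subtopology case_prod_unfold continuous_map_from_subtopology)
    have p2: "continuous_map ?W (subtopology B (U \<times> UNIV)) (\<lambda>z. (fst z, snd (snd z)))"
      using continuous_map_whitney_sum_proj(2)[of A B]
      by (auto simp: continuous_map_in_subtopology case_prod_unfold continuous_map_from_subtopology)
    show "continuous_map ?W X fst"
      using continuous_map_compose[OF p1 F1(6)] by (simp add: o_def)
    show "continuous_map ?W euclidean (c i)" if "i < n + m" for i
    proof (cases "i < n")
      case True
      then show ?thesis
        using continuous_map_compose[OF p1 F1(7)[OF True]] by (simp add: o_def c_def[abs_def])
    next
      case False
      then have "i - n < m" using that by simp
      with False show ?thesis
        using continuous_map_compose[OF p2 F2(7)] by (simp add: o_def c_def[abs_def])
    qed
  qed
  with U(2) show "\<exists>U n e c. x \<in> U \<and> vb_frame (smult_pair s t) X (whitney_sum A B) U n e c"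
    by blast
qed

text \<open>Coordinates with respect to a basis of each fibre, chosen without any continuity in the base
  point, transport the bundle into the sequence space.\<close>

lemma ex_Vect_isomorphic:
  fixes s :: "'k::real_or_complex \<Rightarrow> 'e::ab_group_add \<Rightarrow> 'e"
  assumes vb: "is_vector_bundle s X T"
  shows "\<exists>A\<in>Vect X. bundle_isomorphic smult_seq s A T"
proof -
  interpret s: vector_space s using vb by (simp add: is_vector_bundle_def)
  have "\<exists>q. x \<in> fst q \<and> vb_frame s X T (fst q) (fst (snd q)) (fst (snd (snd q))) (snd (snd (snd q)))"
    if "x \<in> topspace X" for x
    using is_vector_bundle_frame[OF vb that] by fastforce
  then obtain q where q: "\<And>x. x \<in> topspace X \<Longrightarrow> x \<in> fst (q x) \<and> vb_frame s X T (fst (q x))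
      (fst (snd (q x))) (fst (snd (snd (q x)))) (snd (snd (snd (q x))))"
    by metis
  define n where "n x = fst (snd (q x))" for x
  define e where "e x = fst (snd (snd (q x)))" for x
  define c where "c x = snd (snd (snd (q x)))" for x
  have fr: "vb_frame s X T (fst (q x)) (n x) (e x) (c x)" "x \<in> fst (q x)" if "x \<in> topspace X" for x
    using q[OF that] by (simp_all add: n_def e_def c_def)
  have ca: "c x j (x, \<Sum>i<n x. s (a i) (e x i x)) = a j" if x: "x \<in> topspace X" and j: "j < n x" for x a j
    by (rule vb_frameD(3)[OF fr[OF x] j])
  have cu: "(\<Sum>i<n x. s (c x i (x, u)) (e x i x)) = u" if x: "x \<in> topspace X" and u: "(x, u) \<in> topspace T" for x u
    by (rule vb_frameD(4)[OF fr[OF x] u])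
  have TX: "x \<in> topspace X" if "(x, u) \<in> topspace T" for x u
    using vb that by (auto simp: is_vector_bundle_def)
  \<comment> \<open>Padding with zeros beyond the dimension \<open>n x\<close> of the fibre keeps
    the coordinate map linear into sequences.\<close>
  define g where "g x u i = (if i < n x then c x i (x, u) else 0)" for x u i
  define k where "k x = inv_into {u. (x, u) \<in> topspace T} (g x)" for x
  have inj: "u = v" if "(x, u) \<in> topspace T" "(x, v) \<in> topspace T" "g x u = g x v" for x u v
  proof -
    have "c x i (x, u) = c x i (x, v)" if "i < n x" for i
      using fun_cong[OF \<open>g x u = g x v\<close>, of i] that by (simp add: g_def)
    then have "(\<Sum>i<n x. s (c x i (x, u)) (e x i x)) = (\<Sum>i<n x. s (c x i (x, v)) (e x i x))"
      by simp
    then show ?thesis using cu that TX by metis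
  qed
  have kg: "k x (g x u) = u" if "(x, u) \<in> topspace T" for x u
    unfolding k_def using that inj by (intro inv_into_f_f) (auto simp: inj_on_def)
  define D where "D = (\<lambda>(x, u). (x, g x u)) ` topspace T"
  \<comment> \<open>Pulling the topology back along the inverse coordinates makes both directions
    continuous by construction, although the frames chosen at different points are
    unrelated.\<close>
  define T' where "T' = pullback_topology D (\<lambda>(x, f). (x, k x f)) T"
  have top: "topspace T' = D"
    by (auto simp: T'_def topspace_pullback_topology D_def kg)
  have gk: "g x (k x f) = f" if "(x, f) \<in> topspace T'" for x f
    using that by (auto simp: top D_def kg)
  have 1: "continuous_map T T' (\<lambda>(x, u). (x, g x u))"
    unfolding T'_def
  proof (rule continuous_map_pullback')
    show "continuous_map T T ((\<lambda>(x, f). (x, k x f)) \<circ> (\<lambda>(x, u). (x, g x u)))"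
      by (rule continuous_map_eq[OF continuous_map_id]) (auto simp: kg)
  qed (auto simp: D_def)
  have 2: "continuous_map T' T (\<lambda>(x, f). (x, k x f))"
    using continuous_map_pullback[OF continuous_map_id[of T], of D "\<lambda>(x, f). (x, k x f)"]
    by (simp add: T'_def)
  have c_lin: "c x j (x, s a u + s b v) = a * c x j (x, u) + b * c x j (x, v)"
    if "(x, u) \<in> topspace T" "(x, v) \<in> topspace T" "j < n x" for x u v j a b
  proof -
    have x: "x \<in> topspace X" using TX that by blast
    have "s a u + s b v = (\<Sum>i<n x. s (a * c x i (x, u) + b * c x i (x, v)) (e x i x))"
      using cu[OF x that(1)] cu[OF x that(2)]
      by (simp add: s.scale_left_distrib sum.distrib flip: s.scale_scale s.scale_sum_right)
    then show ?thesis using ca[OF x that(3), of "\<lambda>i. a * c x i (x, u) + b * c x i (x, v)"] by simp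
  qed
  have iso: "bundle_isomorphic s smult_seq T T'"
  proof (rule bundle_isomorphicI[OF 1 2 kg gk])
    show "g x (u + v) = g x u + g x v" if "(x, u) \<in> topspace T" "(x, v) \<in> topspace T" for x u v
      using c_lin[OF that, of _ 1 1] by (auto simp: g_def fun_eq_iff)
    show "g x (s a u) = smult_seq a (g x u)" if "(x, u) \<in> topspace T" for x a u
      using c_lin[OF that that, of _ a 0] by (auto simp: g_def smult_seq_def fun_eq_iff)
  qed
  have "T' \<in> Vect X"
    using is_vector_bundle_isomorphic[OF iso vb vector_space_smult_seq] by (simp add: Vect_def)
  then show ?thesis using bundle_isomorphic_sym[OF iso vb] by blast
qed

lemma is_vector_bundle_zero:
  assumes s: "vector_space s"
  shows "is_vector_bundle s X (prod_topology X (discrete_topology {0}))"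
proof (rule is_vector_bundleI[OF s])
  fix x assume x: "x \<in> topspace X"
  have "vb_frame s X (prod_topology X (discrete_topology {0})) (topspace X) 0 (\<lambda>_ _. 0) (\<lambda>_ _. 0)"
    unfolding vb_frame_def
    by (auto simp: continuous_map_pairwise o_def case_prod_unfold continuous_map_fst
        intro: continuous_map_from_subtopology)
  with x show "\<exists>U n e c. x \<in> U \<and> vb_frame s X (prod_topology X (discrete_topology {0})) U n e c"
    by blast
qed auto

section \<open>The commutative semigroup of isomorphism classes\<close>

lemma iso_class_eq:
  assumes iso: "bundle_isomorphic s t T T'" and vb: "is_vector_bundle s X T"
  shows "iso_class X s T = iso_class X t T'"
  using bundle_isomorphic_trans[OF _ iso] bundle_isomorphic_trans[OF _ bundle_isomorphic_sym[OF iso vb]]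
  by (auto simp: iso_class_def)

lemma iso_class_in_carrier:
  assumes "is_vector_bundle s X T"
  shows "iso_class X s T \<in> carrier (Vect_monoid X)"
proof -
  obtain A where A: "A \<in> Vect X" "bundle_isomorphic smult_seq s A T"
    using ex_Vect_isomorphic[OF assms] by blast
  then have "iso_class X s T = iso_class X smult_seq A"
    by (intro iso_class_eq[symmetric]) (auto simp: Vect_def)
  then show ?thesis using A(1) by (auto simp: Vect_monoid_def)
qed

text \<open>The product of classes is defined through representatives with fibres in the sequence
  space. Transporting \<open>T\<close> and \<open>T'\<close> there supplies such representatives, so
  sums of classes can be computed with bundles in any ambient spaces.\<close>

lemma iso_class_mult:
  assumes T: "is_vector_bundle s X T" and T': "is_vector_bundle t X T'"
  shows "iso_class X s T \<otimes>\<^bsub>Vect_monoid X\<^esub> iso_class X t T'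
    = iso_class X (smult_pair s t) (whitney_sum T T')"
proof -
  have "\<exists>A\<in>iso_class X s T. \<exists>B\<in>iso_class X t T'.
      bundle_isomorphic smult_seq (smult_pair smult_seq smult_seq) C (whitney_sum A B)"
    if C: "bundle_isomorphic smult_seq (smult_pair s t) C (whitney_sum T T')" for C
  proof -
    obtain A B where A: "A \<in> Vect X" "bundle_isomorphic smult_seq s A T"
      and B: "B \<in> Vect X" "bundle_isomorphic smult_seq t B T'"
      using ex_Vect_isomorphic[OF T] ex_Vect_isomorphic[OF T'] by blast
    have "bundle_isomorphic s smult_seq T A" "bundle_isomorphic t smult_seq T' B"
      using A B by (auto simp: Vect_def intro: bundle_isomorphic_sym)
    from bundle_isomorphic_trans[OF C whitney_sum_cong[OF this]] show ?thesis
      using A B by (auto simp: iso_class_def)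
  qed
  then show ?thesis
    using whitney_sum_cong bundle_isomorphic_trans
    by (fastforce simp: Vect_monoid_def iso_class_def)
qed

lemma Vect_monoid_carrierE:
  assumes "a \<in> carrier (Vect_monoid X)"
  obtains A where "is_vector_bundle smult_seq X A" "a = iso_class X smult_seq A"
  using assms by (auto simp: Vect_monoid_def Vect_def)

lemma Vect_monoid_closed:
  assumes "a \<in> carrier (Vect_monoid X)" "b \<in> carrier (Vect_monoid X)"
  shows "a \<otimes>\<^bsub>Vect_monoid X\<^esub> b \<in> carrier (Vect_monoid X)"
  using assms
  by (elim Vect_monoid_carrierE) (simp add: iso_class_mult iso_class_in_carrier is_vector_bundle_whitney_sum)

lemma Vect_monoid_commute:
  assumes "a \<in> carrier (Vect_monoid X)" "b \<in> carrier (Vect_monoid X)"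
  shows "a \<otimes>\<^bsub>Vect_monoid X\<^esub> b = b \<otimes>\<^bsub>Vect_monoid X\<^esub> a"
proof -
  obtain A B where A: "is_vector_bundle smult_seq X A" "a = iso_class X smult_seq A"
    and B: "is_vector_bundle smult_seq X B" "b = iso_class X smult_seq B"
    using assms by (elim Vect_monoid_carrierE)
  show ?thesis
    unfolding A(2) B(2) iso_class_mult[OF A(1) B(1)] iso_class_mult[OF B(1) A(1)]
    by (rule iso_class_eq[OF whitney_sum_commute is_vector_bundle_whitney_sum[OF A(1) B(1)]])
qed

lemma Vect_monoid_assoc:
  assumes "a \<in> carrier (Vect_monoid X)" "b \<in> carrier (Vect_monoid X)" "c \<in> carrier (Vect_monoid X)"
  shows "a \<otimes>\<^bsub>Vect_monoid X\<^esub> b \<otimes>\<^bsub>Vect_monoid X\<^esub> c = a \<otimes>\<^bsub>Vect_monoid X\<^esub> (b \<otimes>\<^bsub>Vect_monoid X\<^esub> c)"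
  using assms
  by (elim Vect_monoid_carrierE) (simp add: iso_class_mult is_vector_bundle_whitney_sum
      iso_class_eq[OF whitney_sum_assoc is_vector_bundle_whitney_sum[OF is_vector_bundle_whitney_sum]])

lemma Vect_monoid_one_in_carrier: "\<one>\<^bsub>Vect_monoid X\<^esub> \<in> carrier (Vect_monoid X)"
  using iso_class_in_carrier[OF is_vector_bundle_zero[OF vector_space_smult_seq]]
  by (simp add: Vect_monoid_def)

section \<open>The Grothendieck group\<close>

text \<open>No unit law is assumed: a vector bundle in the sense of \<open>is_vector_bundle\<close> need not have a
  continuous projection, and the Whitney sum with the zero bundle then differs from it.  The
  Grothendieck construction is a group all the same.\<close>

locale pointed_comm_semigroup =
  fixes G :: "('a, 'b) monoid_scheme" (structure)
  assumes closed: "\<lbrakk>a \<in> carrier G; b \<in> carrier G\<rbrakk> \<Longrightarrow> a \<otimes> b \<in> carrier G"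
    and commute: "\<lbrakk>a \<in> carrier G; b \<in> carrier G\<rbrakk> \<Longrightarrow> a \<otimes> b = b \<otimes> a"
    and assoc: "\<lbrakk>a \<in> carrier G; b \<in> carrier G; c \<in> carrier G\<rbrakk> \<Longrightarrow> a \<otimes> b \<otimes> c = a \<otimes> (b \<otimes> c)"
    and one: "\<one> \<in> carrier G"
begin

lemma left_commute:
  assumes "a \<in> carrier G" "b \<in> carrier G" "c \<in> carrier G"
  shows "a \<otimes> (b \<otimes> c) = b \<otimes> (a \<otimes> c)"
  using assms by (metis assoc commute)

lemmas ac = assoc commute left_commute

abbreviation diff_class :: "'a \<Rightarrow> 'a \<Rightarrow> ('a \<times> 'a) set" where
  "diff_class a b \<equiv> grothendieck_rel G `` {(a, b)}"

lemma grothendieck_rel_iff: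
  "((a, b), (c, d)) \<in> grothendieck_rel G \<longleftrightarrow>
     a \<in> carrier G \<and> b \<in> carrier G \<and> c \<in> carrier G \<and> d \<in> carrier G
     \<and> (\<exists>e\<in>carrier G. a \<otimes> d \<otimes> e = c \<otimes> b \<otimes> e)"
  by (simp add: grothendieck_rel_def)

lemma grothendieck_relI:
  assumes "a \<in> carrier G" "b \<in> carrier G" "c \<in> carrier G" "d \<in> carrier G" "a \<otimes> d = c \<otimes> b"
  shows "((a, b), (c, d)) \<in> grothendieck_rel G"
  using assms one by (auto simp: grothendieck_rel_iff)

lemma equiv_grothendieck_rel: "equiv (carrier G \<times> carrier G) (grothendieck_rel G)"
proof (rule equivI)
  show "grothendieck_rel G \<subseteq> (carrier G \<times> carrier G) \<times> carrier G \<times> carrier G"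
    by (auto simp: grothendieck_rel_iff)
  show "refl_on (carrier G \<times> carrier G) (grothendieck_rel G)"
    by (rule refl_onI) (auto intro: grothendieck_relI)
  show "sym (grothendieck_rel G)"
  proof (rule symI, clarify)
    fix a b c d assume "((a, b), (c, d)) \<in> grothendieck_rel G"
    then show "((c, d), (a, b)) \<in> grothendieck_rel G"
      unfolding grothendieck_rel_iff by metis
  qed
  show "trans (grothendieck_rel G)"
  proof (rule transI, clarify)
    fix a b c d g h
    assume 1: "((a, b), (c, d)) \<in> grothendieck_rel G" and 2: "((c, d), (g, h)) \<in> grothendieck_rel G"
    then have car: "a \<in> carrier G" "b \<in> carrier G" "c \<in> carrier G" "d \<in> carrier G"
      "g \<in> carrier G" "h \<in> carrier G"
      by (auto simp: grothendieck_rel_iff)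
    obtain e where e: "e \<in> carrier G" "a \<otimes> d \<otimes> e = c \<otimes> b \<otimes> e"
      using 1 by (auto simp: grothendieck_rel_iff)
    obtain f where f: "f \<in> carrier G" "c \<otimes> h \<otimes> f = g \<otimes> d \<otimes> f"
      using 2 by (auto simp: grothendieck_rel_iff)
    \<comment> \<open>The semigroup need not be cancellative, so the middle entry \<open>d\<close>
      is absorbed into the cancelling factor together with \<open>e\<close> and
      \<open>f\<close>.\<close>
    have "a \<otimes> h \<otimes> (d \<otimes> (e \<otimes> f)) = (a \<otimes> d \<otimes> e) \<otimes> (h \<otimes> f)"
      using car e(1) f(1) by (simp add: ac closed)
    also have "\<dots> = (c \<otimes> h \<otimes> f) \<otimes> (b \<otimes> e)"
      unfolding e(2) using car e(1) f(1) by (simp add: ac closed)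
    also have "\<dots> = g \<otimes> b \<otimes> (d \<otimes> (e \<otimes> f))"
      unfolding f(2) using car e(1) f(1) by (simp add: ac closed)
    finally show "((a, b), (g, h)) \<in> grothendieck_rel G"
      using car e(1) f(1) by (auto simp: grothendieck_rel_iff closed)
  qed
qed

lemma diff_class_eqI:
  assumes "((a, b), (c, d)) \<in> grothendieck_rel G"
  shows "diff_class a b = diff_class c d"
  by (rule equiv_class_eq[OF equiv_grothendieck_rel assms])

lemma diff_class_in_carrier:
  assumes "a \<in> carrier G" "b \<in> carrier G"
  shows "diff_class a b \<in> carrier (grothendieck_group G)"
  using assms by (auto simp: grothendieck_group_def intro: quotientI)

lemma grothendieck_group_carrierE:
  assumes "p \<in> carrier (grothendieck_group G)"
  obtains a b where "a \<in> carrier G" "b \<in> carrier G" "p = diff_class a b"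
  using assms by (auto simp: grothendieck_group_def elim!: quotientE)

lemma grothendieck_rel_mult:
  assumes 1: "((a, b), (a', b')) \<in> grothendieck_rel G" and 2: "((c, d), (c', d')) \<in> grothendieck_rel G"
  shows "((a \<otimes> c, b \<otimes> d), (a' \<otimes> c', b' \<otimes> d')) \<in> grothendieck_rel G"
proof -
  have car: "a \<in> carrier G" "b \<in> carrier G" "a' \<in> carrier G" "b' \<in> carrier G"
    "c \<in> carrier G" "d \<in> carrier G" "c' \<in> carrier G" "d' \<in> carrier G"
    using assms by (auto simp: grothendieck_rel_iff)
  obtain e where e: "e \<in> carrier G" "a \<otimes> b' \<otimes> e = a' \<otimes> b \<otimes> e"
    using 1 by (auto simp: grothendieck_rel_iff)
  obtain f where f: "f \<in> carrier G" "c \<otimes> d' \<otimes> f = c' \<otimes> d \<otimes> f"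
    using 2 by (auto simp: grothendieck_rel_iff)
  have "(a \<otimes> c) \<otimes> (b' \<otimes> d') \<otimes> (e \<otimes> f) = (a \<otimes> b' \<otimes> e) \<otimes> (c \<otimes> d' \<otimes> f)"
    using car e(1) f(1) by (simp add: ac closed)
  also have "\<dots> = (a' \<otimes> c') \<otimes> (b \<otimes> d) \<otimes> (e \<otimes> f)"
    unfolding e(2) f(2) using car e(1) f(1) by (simp add: ac closed)
  finally show ?thesis
    using car e(1) f(1) by (auto simp: grothendieck_rel_iff closed)
qed

lemma diff_class_mult:
  assumes "a \<in> carrier G" "b \<in> carrier G" "c \<in> carrier G" "d \<in> carrier G"
  shows "diff_class a b \<otimes>\<^bsub>grothendieck_group G\<^esub> diff_class c d = diff_class (a \<otimes> c) (b \<otimes> d)"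
proof -
  \<comment> \<open>The product of classes is a union over all representatives. Compatibility makes
    the family constant, and nonemptiness of the classes makes the union equal to that
    constant.\<close>
  have const: "(\<Union>(a', b')\<in>S. f a' b') = Z" if "\<And>a' b'. (a', b') \<in> S \<Longrightarrow> f a' b' = Z" "S \<noteq> {}"
    for S :: "('a \<times> 'a) set" and f and Z :: "('a \<times> 'a) set"
  proof -
    have "case_prod f ` S = {Z}" using that by force
    then show ?thesis by simp
  qed
  have ne: "diff_class a b \<noteq> {}" "diff_class c d \<noteq> {}"
    using grothendieck_relI[of a b a b] grothendieck_relI[of c d c d] assms by blast+
  have "(\<Union>(a', b')\<in>diff_class a b. \<Union>(c', d')\<in>diff_class c d.
      diff_class (a' \<otimes> c') (b' \<otimes> d')) = diff_class (a \<otimes> c) (b \<otimes> d)"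
    by (rule const[OF const[OF _ ne(2)] ne(1)])
       (rule diff_class_eqI[symmetric, OF grothendieck_rel_mult]; simp)
  then show ?thesis by (simp add: grothendieck_group_def)
qed

lemma grothendieck_group_one: "\<one>\<^bsub>grothendieck_group G\<^esub> = diff_class \<one> \<one>"
  by (simp add: grothendieck_group_def)

lemma diff_class_same: "a \<in> carrier G \<Longrightarrow> diff_class a a = diff_class \<one> \<one>"
  using one by (intro diff_class_eqI grothendieck_relI) (simp_all add: commute)

lemma group_grothendieck_group: "group (grothendieck_group G)"
proof (rule groupI)
  let ?K = "grothendieck_group G"
  show "\<one>\<^bsub>?K\<^esub> \<in> carrier ?K"
    by (simp add: grothendieck_group_one diff_class_in_carrier one)
  fix p assume p: "p \<in> carrier ?K"
  then obtain a b where ab: "a \<in> carrier G" "b \<in> carrier G" "p = diff_class a b"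
    by (rule grothendieck_group_carrierE)
  \<comment> \<open>The factor \<open>\<one>\<close> stands on both sides of the formal difference
    and cancels there.\<close>
  have "diff_class (\<one> \<otimes> a) (\<one> \<otimes> b) = diff_class a b"
    using ab(1,2) one by (intro diff_class_eqI grothendieck_relI) (simp_all add: ac closed)
  then show "\<one>\<^bsub>?K\<^esub> \<otimes>\<^bsub>?K\<^esub> p = p"
    using ab one by (simp add: grothendieck_group_one diff_class_mult)
  have "diff_class b a \<otimes>\<^bsub>?K\<^esub> p = \<one>\<^bsub>?K\<^esub>"
    using ab diff_class_same[of "a \<otimes> b"]
    by (simp add: grothendieck_group_one diff_class_mult commute[of b a] closed)
  then show "\<exists>q\<in>carrier ?K. q \<otimes>\<^bsub>?K\<^esub> p = \<one>\<^bsub>?K\<^esub>"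
    using ab(1,2) diff_class_in_carrier by blast
  fix q assume "q \<in> carrier ?K"
  then obtain c d where cd: "c \<in> carrier G" "d \<in> carrier G" "q = diff_class c d"
    by (rule grothendieck_group_carrierE)
  show "p \<otimes>\<^bsub>?K\<^esub> q \<in> carrier ?K"
    using ab cd by (simp add: diff_class_mult diff_class_in_carrier closed)
  fix r assume "r \<in> carrier ?K"
  then obtain g h where gh: "g \<in> carrier G" "h \<in> carrier G" "r = diff_class g h"
    by (rule grothendieck_group_carrierE)
  show "p \<otimes>\<^bsub>?K\<^esub> q \<otimes>\<^bsub>?K\<^esub> r = p \<otimes>\<^bsub>?K\<^esub> (q \<otimes>\<^bsub>?K\<^esub> r)"
    using ab cd gh by (simp add: diff_class_mult closed assoc)
qed

lemma grothendieck_class_diff: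
  assumes a: "a \<in> carrier G" and b: "b \<in> carrier G"
  shows "grothendieck_class G a \<otimes>\<^bsub>grothendieck_group G\<^esub>
    inv\<^bsub>grothendieck_group G\<^esub> grothendieck_class G b = diff_class a b"
proof -
  interpret K: group "grothendieck_group G" by (rule group_grothendieck_group)
  have "diff_class \<one> b \<otimes>\<^bsub>grothendieck_group G\<^esub> diff_class b \<one> = \<one>\<^bsub>grothendieck_group G\<^esub>"
    using b one diff_class_same[of "b \<otimes> \<one>"]
    by (simp add: grothendieck_group_one diff_class_mult commute[of \<one> b] closed)
  then have inv: "inv\<^bsub>grothendieck_group G\<^esub> diff_class b \<one> = diff_class \<one> b"
    using b one by (intro K.inv_equality diff_class_in_carrier)
  have "diff_class (a \<otimes> \<one>) (\<one> \<otimes> b) = diff_class a b"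
    using a b one by (intro diff_class_eqI grothendieck_relI) (simp_all add: ac closed)
  then show ?thesis
    using a b one by (simp add: grothendieck_class_def inv diff_class_mult)
qed

end

lemma pointed_comm_semigroup_Vect_monoid: "pointed_comm_semigroup (Vect_monoid X)"
  by (unfold_locales; rule Vect_monoid_closed Vect_monoid_commute Vect_monoid_assoc
      Vect_monoid_one_in_carrier; assumption)

text \<open>Equal cross sums give equal formal differences. Membership in the carrier accompanies
  the equation because \<open>iso_class\<close> is empty away from vector bundles, where an equation
  could hold between degenerate values.\<close>

lemma K_diff_eqI:
  assumes vb: "is_vector_bundle s X A" "is_vector_bundle t X B"
    "is_vector_bundle s' X A'" "is_vector_bundle t' X B'"
    and iso: "bundle_isomorphic (smult_pair s t') (smult_pair s' t) (whitney_sum A B') (whitney_sum A' B)"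
  defines "k \<equiv> \<lambda>T. grothendieck_class (Vect_monoid X) T"
  shows "K_diff X (k (iso_class X s A)) (k (iso_class X t B))
      = K_diff X (k (iso_class X s' A')) (k (iso_class X t' B'))"
    and "K_diff X (k (iso_class X s A)) (k (iso_class X t B)) \<in> carrier (K_group X)"
proof -
  interpret M: pointed_comm_semigroup "Vect_monoid X"
    by (rule pointed_comm_semigroup_Vect_monoid)
  note car = vb[THEN iso_class_in_carrier]
  have eq: "K_diff X (k (iso_class X s A)) (k (iso_class X t B))
      = M.diff_class (iso_class X s A) (iso_class X t B)"
    "K_diff X (k (iso_class X s' A')) (k (iso_class X t' B'))
      = M.diff_class (iso_class X s' A') (iso_class X t' B')"
    by (simp_all add: K_diff_def K_group_def k_def M.grothendieck_class_diff car)
  have "iso_class X s A \<otimes>\<^bsub>Vect_monoid X\<^esub> iso_class X t' B'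
      = iso_class X s' A' \<otimes>\<^bsub>Vect_monoid X\<^esub> iso_class X t B"
    unfolding iso_class_mult[OF vb(1,4)] iso_class_mult[OF vb(3,2)]
    by (rule iso_class_eq[OF iso is_vector_bundle_whitney_sum[OF vb(1,4)]])
  then show "K_diff X (k (iso_class X s A)) (k (iso_class X t B))
      = K_diff X (k (iso_class X s' A')) (k (iso_class X t' B'))"
    unfolding eq by (intro M.diff_class_eqI M.grothendieck_relI car)
  show "K_diff X (k (iso_class X s A)) (k (iso_class X t B)) \<in> carrier (K_group X)"
    unfolding eq(1) K_group_def by (intro M.diff_class_in_carrier car)
qed

section \<open>Banach bundles\<close>

text \<open>The sets that pass the test are closed under finite intersections and arbitrary unions,
  so testing on generators suffices. This reduces convergence in a total space to the
  trivialisations of the atlas.\<close>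

lemma limitin_topology_generated_by:
  "limitin (topology_generated_by S) f l F \<longleftrightarrow>
     l \<in> \<Union>S \<and> (\<forall>G\<in>S. l \<in> G \<longrightarrow> (\<forall>\<^sub>F t in F. f t \<in> G))"
proof
  assume "limitin (topology_generated_by S) f l F"
  then show "l \<in> \<Union>S \<and> (\<forall>G\<in>S. l \<in> G \<longrightarrow> (\<forall>\<^sub>F t in F. f t \<in> G))"
    by (auto simp: limitin_def topology_generated_by_Basis)
next
  assume *: "l \<in> \<Union>S \<and> (\<forall>G\<in>S. l \<in> G \<longrightarrow> (\<forall>\<^sub>F t in F. f t \<in> G))"
  have "l \<in> U \<longrightarrow> (\<forall>\<^sub>F t in F. f t \<in> U)" if "generate_topology_on S U" for U
    using that
  proof induction
    case (Int a b)
    then show ?case by (auto simp: eventually_conj_iff)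
  next
    case (UN K)
    show ?case
    proof
      assume "l \<in> \<Union>K"
      then obtain k where k: "k \<in> K" "l \<in> k" by blast
      then have "\<forall>\<^sub>F t in F. f t \<in> k" using UN by blast
      then show "\<forall>\<^sub>F t in F. f t \<in> \<Union>K"
        by (rule eventually_mono) (use k in blast)
    qed
  qed (use * in auto)
  then show "limitin (topology_generated_by S) f l F"
    using * by (auto simp: limitin_def openin_topology_generated_by_iff)
qed

lemma limitin_atin_id: "z \<in> topspace T \<Longrightarrow> limitin T (\<lambda>z. z) z (atin T z)"
  by (auto simp: limitin_def eventually_atin)

lemma tendsto_continuous_map_limitin:
  assumes T: "continuous_map (subtopology X U) euclidean T" and U: "openin X U" "x \<in> U"
    and p: "limitin X p x F"
  shows "((\<lambda>t. T (p t)) \<longlongrightarrow> T x) F"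
proof -
  have "\<forall>\<^sub>F t in F. p t \<in> U" using p U by (auto simp: limitin_def)
  then have "limitin (subtopology X U) p x F"
    using p U(2) by (simp add: limitin_subtopology)
  then have "limitin euclidean (T \<circ> p) (T x) F"
    by (rule continuous_map_limit[OF T])
  then show ?thesis by (simp add: o_def)
qed

text \<open>Evaluation is jointly continuous for the operator norm, so a norm-continuous family
  carries converging sections to converging sections even while the base point moves.\<close>

lemma norm_continuous_in_tendsto:
  assumes nc: "norm_continuous_in X U A \<phi> \<psi> L" and U: "openin X U" "x \<in> U"
    and p: "limitin X p x F" and \<sigma>: "\<forall>\<^sub>F t in F. \<sigma> t \<in> A (p t)" and u: "u \<in> A x"
    and lim: "((\<lambda>t. \<phi> (p t) (\<sigma> t)) \<longlongrightarrow> \<phi> x u) F"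
  shows "((\<lambda>t. \<psi> (p t) (L (p t) (\<sigma> t))) \<longlongrightarrow> \<psi> x (L x u)) F"
proof -
  obtain T where T: "continuous_map (subtopology X U) euclidean T"
    "\<And>y v. y \<in> U \<Longrightarrow> v \<in> A y \<Longrightarrow> \<psi> y (L y v) = blinfun_apply (T y) (\<phi> y v)"
    using nc unfolding norm_continuous_in_def by blast
  have "((\<lambda>t. blinfun_apply (T (p t)) (\<phi> (p t) (\<sigma> t))) \<longlongrightarrow> T x (\<phi> x u)) F"
    by (intro blinfun.tendsto tendsto_continuous_map_limitin[OF T(1) U p] lim)
  moreover
  have "\<forall>\<^sub>F t in F. p t \<in> U" using p U by (auto simp: limitin_def)
  then have "\<forall>\<^sub>F t in F. T (p t) (\<phi> (p t) (\<sigma> t)) = \<psi> (p t) (L (p t) (\<sigma> t))"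
    using \<sigma> by eventually_elim (simp add: T(2))
  then have "((\<lambda>t. T (p t) (\<phi> (p t) (\<sigma> t))) \<longlongrightarrow> T x (\<phi> x u)) F
      \<longleftrightarrow> ((\<lambda>t. \<psi> (p t) (L (p t) (\<sigma> t))) \<longlongrightarrow> T x (\<phi> x u)) F"
    by (rule tendsto_cong)
  ultimately show ?thesis by (simp only: T(2)[OF U(2) u])
qed

lemma norm_continuous_in_subset:
  assumes "norm_continuous_in X U A \<phi> \<psi> L" "U' \<subseteq> U"
  shows "norm_continuous_in X U' A \<phi> \<psi> L"
proof -
  obtain T where T: "continuous_map (subtopology X U) euclidean T"
    "\<And>y v. y \<in> U \<Longrightarrow> v \<in> A y \<Longrightarrow> \<psi> y (L y v) = blinfun_apply (T y) (\<phi> y v)"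
    using assms(1) unfolding norm_continuous_in_def by blast
  show ?thesis
    unfolding norm_continuous_in_def
    using continuous_map_from_subtopology_mono[OF T(1) assms(2)] T(2) assms(2)
    by (intro exI[of _ T]) auto
qed

lemma continuous_map_blinfun_compose:
  assumes "continuous_map X euclidean S" "continuous_map X euclidean T"
  shows "continuous_map X euclidean (\<lambda>x. S x o\<^sub>L T x)"
  using assms unfolding continuous_map_euclidean_atin
  by (blast intro: bounded_bilinear.tendsto[OF bounded_bilinear_blinfun_compose])

lemma norm_continuous_in_compose:
  assumes 1: "norm_continuous_in X U A \<phi> \<psi> L" and 2: "norm_continuous_in X U' B \<psi> \<theta> M"
    and L: "\<And>y u. y \<in> U \<inter> U' \<Longrightarrow> u \<in> A y \<Longrightarrow> L y u \<in> B y"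
  shows "norm_continuous_in X (U \<inter> U') A \<phi> \<theta> (\<lambda>y u. M y (L y u))"
proof -
  obtain S where S: "continuous_map (subtopology X U) euclidean S"
    "\<And>y v. y \<in> U \<Longrightarrow> v \<in> A y \<Longrightarrow> \<psi> y (L y v) = blinfun_apply (S y) (\<phi> y v)"
    using 1 unfolding norm_continuous_in_def by blast
  obtain T where T: "continuous_map (subtopology X U') euclidean T"
    "\<And>y v. y \<in> U' \<Longrightarrow> v \<in> B y \<Longrightarrow> \<theta> y (M y v) = blinfun_apply (T y) (\<psi> y v)"
    using 2 unfolding norm_continuous_in_def by blast
  have "continuous_map (subtopology X (U \<inter> U')) euclidean (\<lambda>y. T y o\<^sub>L S y)"
    by (intro continuous_map_blinfun_compose continuous_map_from_subtopology_mono[OF S(1)]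
        continuous_map_from_subtopology_mono[OF T(1)]) auto
  then show ?thesis
    unfolding norm_continuous_in_def
    by (intro exI[of _ "\<lambda>y. T y o\<^sub>L S y"]) (simp add: S(2) T(2) L)
qed

lemma fredholm_morphism_imp_bundle_morphism:
  "fredholm_morphism X E F L \<Longrightarrow> bundle_morphism X E F L"
  by (auto simp: fredholm_morphism_def fredholm_morphism_of_index_def)

lemma local_trivialisationD:
  assumes "local_trivialisation X E U \<phi>"
  shows "openin X U"
    "\<And>x u v. x \<in> U \<Longrightarrow> u \<in> fib E x \<Longrightarrow> v \<in> fib E x \<Longrightarrow> \<phi> x (u + v) = \<phi> x u + \<phi> x v"
    "\<And>x a u. x \<in> U \<Longrightarrow> u \<in> fib E x \<Longrightarrow> \<phi> x (smult_fib E a u) = smult_model E a (\<phi> x u)"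
    "\<And>x. x \<in> U \<Longrightarrow> bij_betw (\<phi> x) (fib E x) UNIV"
    "\<And>V \<psi>. (V, \<psi>) \<in> atlas E \<Longrightarrow> norm_continuous_in X (U \<inter> V) (fib E) \<phi> \<psi> (\<lambda>x u. u)"
    "\<And>V \<psi>. (V, \<psi>) \<in> atlas E \<Longrightarrow> norm_continuous_in X (U \<inter> V) (fib E) \<psi> \<phi> (\<lambda>x u. u)"
  using assms by (auto simp: local_trivialisation_def linear_between_def)

lemma local_trivialisation_subset:
  assumes lt: "local_trivialisation X E U \<phi>" and "openin X U'" "U' \<subseteq> U"
  shows "local_trivialisation X E U' \<phi>"
proof -
  have "norm_continuous_in X (U' \<inter> V) (fib E) \<phi> \<psi> (\<lambda>x u. u) \<and> norm_continuous_in X (U' \<inter> V) (fib E) \<psi> \<phi> (\<lambda>x u. u)"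
    if "(V, \<psi>) \<in> atlas E" for V \<psi>
    using local_trivialisationD(5,6)[OF lt that] assms(3) by (blast intro: norm_continuous_in_subset)
  then show ?thesis using assms by (auto simp: local_trivialisation_def)
qed

lemma is_banach_bundleD:
  assumes "is_banach_bundle X E"
  shows "vector_space (smult_fib E)" "K_banach_space (smult_model E)"
    "\<And>x. x \<in> topspace X \<Longrightarrow> module.subspace (smult_fib E) (fib E x)"
    "\<And>U \<phi>. (U, \<phi>) \<in> atlas E \<Longrightarrow> local_trivialisation X E U \<phi>"
    "\<And>x. x \<in> topspace X \<Longrightarrow> \<exists>U \<phi>. (U, \<phi>) \<in> atlas E \<and> x \<in> U"
  using assms unfolding is_banach_bundle_def by fast+

lemma fib_closed:
  assumes "is_banach_bundle X E" "x \<in> topspace X"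
  shows "0 \<in> fib E x" "u \<in> fib E x \<Longrightarrow> v \<in> fib E x \<Longrightarrow> u + v \<in> fib E x"
    "u \<in> fib E x \<Longrightarrow> v \<in> fib E x \<Longrightarrow> u - v \<in> fib E x"
    "u \<in> fib E x \<Longrightarrow> smult_fib E a u \<in> fib E x"
proof -
  interpret vector_space "smult_fib E" using is_banach_bundleD[OF assms(1)] by simp
  have "subspace (fib E x)" using is_banach_bundleD(3)[OF assms] .
  then show "0 \<in> fib E x" "u \<in> fib E x \<Longrightarrow> v \<in> fib E x \<Longrightarrow> u + v \<in> fib E x"
    "u \<in> fib E x \<Longrightarrow> v \<in> fib E x \<Longrightarrow> u - v \<in> fib E x"
    "u \<in> fib E x \<Longrightarrow> smult_fib E a u \<in> fib E x"
    by (simp_all add: subspace_0 subspace_add subspace_diff subspace_scale)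
qed

lemma local_trivialisation_zero_diff:
  assumes bb: "is_banach_bundle X E" and lt: "local_trivialisation X E U \<phi>" and x: "x \<in> U"
  shows "\<phi> x 0 = 0" "u \<in> fib E x \<Longrightarrow> v \<in> fib E x \<Longrightarrow> \<phi> x (u - v) = \<phi> x u - \<phi> x v"
proof -
  note D = local_trivialisationD[OF lt]
  have xX: "x \<in> topspace X" using D(1) x openin_subset by blast
  note cl = fib_closed[OF bb xX]
  show "\<phi> x 0 = 0" using D(2)[OF x cl(1) cl(1)] by simp
  show "\<phi> x (u - v) = \<phi> x u - \<phi> x v" if "u \<in> fib E x" "v \<in> fib E x"
    using D(2)[OF x cl(3)[OF that] that(2)] by (simp add: algebra_simps)
qed

section \<open>Convergence in the total space of a Banach bundle\<close>

definition total_space_basis ::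
  "'x topology \<Rightarrow> ('k, 'x, 'e, 'm::topological_space) banach_bundle \<Rightarrow> ('x \<times> 'e) set set" where
  "total_space_basis X E = {{(x, u). x \<in> W \<and> u \<in> fib E x \<and> \<phi> x u \<in> N} |U \<phi> W N.
        (U, \<phi>) \<in> atlas E \<and> openin X W \<and> W \<subseteq> U \<and> open N}"

lemma total_space_eq: "total_space X E = topology_generated_by (total_space_basis X E)"
  unfolding total_space_def total_space_basis_def ..

lemma topspace_total_space:
  assumes "is_banach_bundle X E"
  shows "topspace (total_space X E) = {(x, u). x \<in> topspace X \<and> u \<in> fib E x}"
proof -
  note D = is_banach_bundleD[OF assms]
  have "(x, u) \<in> topspace (total_space X E)" if x: "x \<in> topspace X" and u: "u \<in> fib E x" for x u
  proof -
    obtain U \<phi> where U: "(U, \<phi>) \<in> atlas E" "x \<in> U" using D(5)[OF x] by blast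
    then have "openin X U" using D(4) local_trivialisationD(1) by blast
    then have "{(x, u). x \<in> U \<and> u \<in> fib E x \<and> \<phi> x u \<in> UNIV} \<in> total_space_basis X E"
      unfolding total_space_basis_def using U(1) by blast
    then show ?thesis
      unfolding total_space_eq topology_generated_by_topspace using U(2) u by blast
  qed
  moreover have "x \<in> topspace X \<and> u \<in> fib E x" if "(x, u) \<in> topspace (total_space X E)" for x u
    using that unfolding total_space_eq topology_generated_by_topspace total_space_basis_def
    by (auto dest: openin_subset)
  ultimately show ?thesis by auto
qed

text \<open>Continuity of bundle maps is checked in this form: the total space is given by
  generators only, whereas limits along a filter can be computed in a single trivialisation.\<close>

abbreviation section_tendsto ::
  "'x topology \<Rightarrow> ('k, 'x, 'e, 'm::topological_space) banach_bundle \<Rightarrow> ('t \<Rightarrow> 'x) \<Rightarrow> ('t \<Rightarrow> 'e) \<Rightarrow> 'x \<Rightarrow> 'e \<Rightarrow>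
   't filter \<Rightarrow> bool" where
  "section_tendsto X E p \<sigma> x u F \<equiv> limitin (total_space X E) (\<lambda>t. (p t, \<sigma> t)) (x, u) F"

lemma section_tendsto_atlas:
  assumes bb: "is_banach_bundle X E" and U: "(U, \<phi>) \<in> atlas E" "x \<in> U"
    and lim: "section_tendsto X E p \<sigma> x u F"
  shows "u \<in> fib E x" "limitin X p x F" "\<forall>\<^sub>F t in F. \<sigma> t \<in> fib E (p t)"
    "((\<lambda>t. \<phi> (p t) (\<sigma> t)) \<longlongrightarrow> \<phi> x u) F"
proof -
  note oU = local_trivialisationD(1)[OF is_banach_bundleD(4)[OF bb U(1)]]
  have "(x, u) \<in> topspace (total_space X E)" using lim by (simp add: limitin_def)
  then show u: "u \<in> fib E x" using topspace_total_space[OF bb] by auto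
  have xX: "x \<in> topspace X" using oU U openin_subset by blast
  have ev: "\<forall>\<^sub>F t in F. p t \<in> W \<and> \<sigma> t \<in> fib E (p t) \<and> \<phi> (p t) (\<sigma> t) \<in> N"
    if "openin X W" "W \<subseteq> U" "open N" "x \<in> W" "\<phi> x u \<in> N" for W N
  proof -
    have "{(x, u). x \<in> W \<and> u \<in> fib E x \<and> \<phi> x u \<in> N} \<in> total_space_basis X E"
      unfolding total_space_basis_def using U(1) that by blast
    from bspec[OF conjunct2[OF lim[unfolded total_space_eq limitin_topology_generated_by]] this]
    show ?thesis using that u by simp
  qed
  show "\<forall>\<^sub>F t in F. \<sigma> t \<in> fib E (p t)"
    using ev[OF oU order_refl open_UNIV U(2)] by (auto elim: eventually_mono)
  show "((\<lambda>t. \<phi> (p t) (\<sigma> t)) \<longlongrightarrow> \<phi> x u) F"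
    unfolding tendsto_def
  proof (intro allI impI)
    fix N assume "open N" "\<phi> x u \<in> N"
    from ev[OF oU order_refl this(1) U(2) this(2)] show "\<forall>\<^sub>F t in F. \<phi> (p t) (\<sigma> t) \<in> N"
      by (rule eventually_mono) blast
  qed
  show "limitin X p x F"
    unfolding limitin_def
  proof (intro conjI xX allI impI)
    fix W assume W: "openin X W \<and> x \<in> W"
    have "\<forall>\<^sub>F t in F. p t \<in> W \<inter> U \<and> \<sigma> t \<in> fib E (p t) \<and> \<phi> (p t) (\<sigma> t) \<in> UNIV"
      using W oU U(2) by (intro ev) auto
    then show "\<forall>\<^sub>F t in F. p t \<in> W" by (rule eventually_mono) blast
  qed
qed

text \<open>Changes of trivialisation are norm-continuous in both directions, so one trivialisation
  around the limit decides convergence. It may lie outside the atlas, which allows the ones that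
  straighten a subbundle.\<close>

lemma section_tendsto_iff:
  assumes bb: "is_banach_bundle X E" and lt: "local_trivialisation X E U \<phi>" and x: "x \<in> U"
  shows "section_tendsto X E p \<sigma> x u F \<longleftrightarrow>
     u \<in> fib E x \<and> limitin X p x F \<and> (\<forall>\<^sub>F t in F. \<sigma> t \<in> fib E (p t))
     \<and> ((\<lambda>t. \<phi> (p t) (\<sigma> t)) \<longlongrightarrow> \<phi> x u) F"
    (is "?lhs \<longleftrightarrow> ?rhs")
proof
  note D = local_trivialisationD[OF lt]
  have xX: "x \<in> topspace X" using D(1) x openin_subset by blast
  { fix V \<psi> assume V: "(V, \<psi>) \<in> atlas E" "x \<in> V"
    have oUV: "openin X (U \<inter> V)" "x \<in> U \<inter> V"
      using D(1) V(2) x local_trivialisationD(1)[OF is_banach_bundleD(4)[OF bb V(1)]] by auto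
    note norm_continuous_in_tendsto[OF D(5)[OF V(1)] oUV] norm_continuous_in_tendsto[OF D(6)[OF V(1)] oUV]
  } note trans = this
  show ?rhs if ?lhs
  proof -
    obtain V \<psi> where V: "(V, \<psi>) \<in> atlas E" "x \<in> V" using is_banach_bundleD(5)[OF bb xX] by blast
    note L = section_tendsto_atlas[OF bb V that]
    show ?thesis using L trans(2)[OF V L(2,3,1,4)] by blast
  qed
  show ?lhs if rhs: ?rhs
    unfolding total_space_eq limitin_topology_generated_by
  proof (intro conjI ballI impI)
    show "(x, u) \<in> \<Union> (total_space_basis X E)"
      using topspace_total_space[OF bb] xX rhs
      unfolding total_space_eq topology_generated_by_topspace by blast
    fix G assume "G \<in> total_space_basis X E" and xG: "(x, u) \<in> G"
    then obtain V \<psi> W N where G: "G = {(x, u). x \<in> W \<and> u \<in> fib E x \<and> \<psi> x u \<in> N}"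
      and V: "(V, \<psi>) \<in> atlas E" "openin X W" "W \<subseteq> V" "open N"
      unfolding total_space_basis_def by blast
    have xV: "x \<in> V" "x \<in> W" "\<psi> x u \<in> N" using xG G V by auto
    have "((\<lambda>t. \<psi> (p t) (\<sigma> t)) \<longlongrightarrow> \<psi> x u) F"
      using trans(1)[OF V(1) xV(1)] rhs by blast
    then have "\<forall>\<^sub>F t in F. \<psi> (p t) (\<sigma> t) \<in> N" using V(4) xV(3) by (rule topological_tendstoD)
    moreover have "\<forall>\<^sub>F t in F. p t \<in> W" using rhs V(2) xV(2) by (auto simp: limitin_def)
    moreover have "\<forall>\<^sub>F t in F. \<sigma> t \<in> fib E (p t)" using rhs by blast
    ultimately show "\<forall>\<^sub>F t in F. (p t, \<sigma> t) \<in> G"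
      by eventually_elim (simp add: G)
  qed
qed

lemma section_tendstoE:
  assumes bb: "is_banach_bundle X E" and lim: "section_tendsto X E p \<sigma> x u F"
  obtains U \<phi> where "local_trivialisation X E U \<phi>" "x \<in> U" "x \<in> topspace X" "u \<in> fib E x"
    "limitin X p x F" "\<forall>\<^sub>F t in F. p t \<in> U" "\<forall>\<^sub>F t in F. \<sigma> t \<in> fib E (p t)"
    "((\<lambda>t. \<phi> (p t) (\<sigma> t)) \<longlongrightarrow> \<phi> x u) F"
proof -
  have "(x, u) \<in> topspace (total_space X E)" using lim by (simp add: limitin_def)
  then have xX: "x \<in> topspace X" using topspace_total_space[OF bb] by auto
  obtain U \<phi> where U: "(U, \<phi>) \<in> atlas E" "x \<in> U" using is_banach_bundleD(5)[OF bb xX] by blast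
  have lt: "local_trivialisation X E U \<phi>" using U(1) by (rule is_banach_bundleD(4)[OF bb])
  note L = section_tendsto_atlas[OF bb U lim]
  have "\<forall>\<^sub>F t in F. p t \<in> U"
    using L(2) local_trivialisationD(1)[OF lt] U(2) by (auto simp: limitin_def)
  with lt U(2) xX L show thesis by (intro that)
qed

lemma section_tendsto_add:
  assumes bb: "is_banach_bundle X E"
    and 1: "section_tendsto X E p \<sigma> x u F"
    and 2: "section_tendsto X E p \<tau> x v F"
  shows "section_tendsto X E p (\<lambda>t. \<sigma> t + \<tau> t) x (u + v) F"
proof -
  obtain U \<phi> where U: "local_trivialisation X E U \<phi>" "x \<in> U" "x \<in> topspace X" "u \<in> fib E x"
    "limitin X p x F" "\<forall>\<^sub>F t in F. p t \<in> U" "\<forall>\<^sub>F t in F. \<sigma> t \<in> fib E (p t)"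
    "((\<lambda>t. \<phi> (p t) (\<sigma> t)) \<longlongrightarrow> \<phi> x u) F"
    by (rule section_tendstoE[OF bb 1])
  note D = local_trivialisationD[OF U(1)]
  have v: "v \<in> fib E x" "\<forall>\<^sub>F t in F. \<tau> t \<in> fib E (p t)" "((\<lambda>t. \<phi> (p t) (\<tau> t)) \<longlongrightarrow> \<phi> x v) F"
    using 2 by (simp_all add: section_tendsto_iff[OF bb U(1,2)])
  have UX: "U \<subseteq> topspace X" using D(1) by (rule openin_subset)
  have ev: "\<forall>\<^sub>F t in F. \<phi> (p t) (\<sigma> t) + \<phi> (p t) (\<tau> t) = \<phi> (p t) (\<sigma> t + \<tau> t)"
    using U(6,7) v(2) by eventually_elim (simp add: D)
  have "((\<lambda>t. \<phi> (p t) (\<sigma> t) + \<phi> (p t) (\<tau> t)) \<longlongrightarrow> \<phi> x u + \<phi> x v) F"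
    by (intro tendsto_add U v)
  then have "((\<lambda>t. \<phi> (p t) (\<sigma> t + \<tau> t)) \<longlongrightarrow> \<phi> x (u + v)) F"
    using tendsto_cong[OF ev] D(2)[OF U(2,4) v(1)] by simp
  moreover have "\<forall>\<^sub>F t in F. \<sigma> t + \<tau> t \<in> fib E (p t)"
    using U(6,7) v(2) by eventually_elim (use UX fib_closed[OF bb] in blast)
  ultimately show ?thesis
    using U v fib_closed[OF bb U(3)] by (simp add: section_tendsto_iff[OF bb U(1,2)])
qed

lemma section_tendsto_scale:
  assumes bb: "is_banach_bundle X E"
    and 1: "section_tendsto X E p \<sigma> x u F"
    and a: "(a \<longlongrightarrow> b) F"
  shows "section_tendsto X E p (\<lambda>t. smult_fib E (a t) (\<sigma> t)) x (smult_fib E b u) F"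
proof -
  obtain U \<phi> where U: "local_trivialisation X E U \<phi>" "x \<in> U" "x \<in> topspace X" "u \<in> fib E x"
    "limitin X p x F" "\<forall>\<^sub>F t in F. p t \<in> U" "\<forall>\<^sub>F t in F. \<sigma> t \<in> fib E (p t)"
    "((\<lambda>t. \<phi> (p t) (\<sigma> t)) \<longlongrightarrow> \<phi> x u) F"
    by (rule section_tendstoE[OF bb 1])
  note D = local_trivialisationD[OF U(1)]
  have UX: "U \<subseteq> topspace X" using D(1) by (rule openin_subset)
  have ev: "\<forall>\<^sub>F t in F. smult_model E (a t) (\<phi> (p t) (\<sigma> t)) = \<phi> (p t) (smult_fib E (a t) (\<sigma> t))"
    using U(6,7) by eventually_elim (simp add: D)
  have "((\<lambda>t. smult_model E (a t) (\<phi> (p t) (\<sigma> t))) \<longlongrightarrow> smult_model E b (\<phi> x u)) F"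
    by (rule bounded_bilinear.tendsto[OF bounded_bilinear_K_banach_space[OF is_banach_bundleD(2)[OF bb]] a U(8)])
  then have "((\<lambda>t. \<phi> (p t) (smult_fib E (a t) (\<sigma> t))) \<longlongrightarrow> \<phi> x (smult_fib E b u)) F"
    using tendsto_cong[OF ev] D(3)[OF U(2,4)] by simp
  moreover have "\<forall>\<^sub>F t in F. smult_fib E (a t) (\<sigma> t) \<in> fib E (p t)"
    using U(6,7) by eventually_elim (use UX fib_closed[OF bb] in blast)
  ultimately show ?thesis
    using U fib_closed[OF bb U(3)] by (simp add: section_tendsto_iff[OF bb U(1,2)])
qed

lemma section_tendsto_norm_continuous:
  assumes E: "is_banach_bundle X E" and F: "is_banach_bundle X F"
    and lt: "local_trivialisation X E U \<phi>" "local_trivialisation X F V \<psi>"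
    and W: "openin X W" "x \<in> W" "W \<subseteq> U" "W \<subseteq> V"
    and nc: "norm_continuous_in X W (fib E) \<phi> \<psi> L"
    and fib: "\<And>y u. y \<in> W \<Longrightarrow> u \<in> fib E y \<Longrightarrow> L y u \<in> fib F y"
    and 1: "section_tendsto X E p \<sigma> x u \<F>"
  shows "section_tendsto X F p (\<lambda>t. L (p t) (\<sigma> t)) x (L x u) \<F>"
proof -
  have x: "x \<in> U" "x \<in> V" using W by auto
  have u: "u \<in> fib E x" "limitin X p x \<F>" "\<forall>\<^sub>F t in \<F>. \<sigma> t \<in> fib E (p t)"
    "((\<lambda>t. \<phi> (p t) (\<sigma> t)) \<longlongrightarrow> \<phi> x u) \<F>"
    using 1 by (simp_all add: section_tendsto_iff[OF E lt(1) x(1)])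
  have "\<forall>\<^sub>F t in \<F>. p t \<in> W" using u(2) W(1,2) by (auto simp: limitin_def)
  then have "\<forall>\<^sub>F t in \<F>. L (p t) (\<sigma> t) \<in> fib F (p t)"
    using u(3) by eventually_elim (rule fib)
  then show ?thesis
    using u fib[OF W(2) u(1)] norm_continuous_in_tendsto[OF nc W(1,2) u(2,3,1,4)]
    by (simp add: section_tendsto_iff[OF F lt(2) x(2)])
qed

lemma section_tendsto_morphism:
  assumes E: "is_banach_bundle X E" and F: "is_banach_bundle X F"
    and L: "bundle_morphism X E F L"
    and 1: "section_tendsto X E p \<sigma> x u \<F>"
  shows "section_tendsto X F p (\<lambda>t. L (p t) (\<sigma> t)) x (L x u) \<F>"
proof -
  have "(x, u) \<in> topspace (total_space X E)" using 1 by (simp add: limitin_def)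
  then have xX: "x \<in> topspace X" using topspace_total_space[OF E] by auto
  obtain U \<phi> where U: "(U, \<phi>) \<in> atlas E" "x \<in> U" using is_banach_bundleD(5)[OF E xX] by blast
  obtain V \<psi> where V: "(V, \<psi>) \<in> atlas F" "x \<in> V" using is_banach_bundleD(5)[OF F xX] by blast
  note lt = is_banach_bundleD(4)[OF E U(1)] is_banach_bundleD(4)[OF F V(1)]
  have o: "openin X (U \<inter> V)"
    by (intro openin_Int local_trivialisationD(1)[OF lt(1)] local_trivialisationD(1)[OF lt(2)])
  have nc: "norm_continuous_in X (U \<inter> V) (fib E) \<phi> \<psi> L"
    using L U(1) V(1) by (auto simp: bundle_morphism_def)
  show ?thesis
  proof (rule section_tendsto_norm_continuous[OF E F lt o _ _ _ nc _ 1])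
    show "L y u \<in> fib F y" if "y \<in> U \<inter> V" "u \<in> fib E y" for y u
      using L that openin_subset[OF o] by (auto simp: bundle_morphism_def linear_between_def)
  qed (use U V in auto)
qed

text \<open>A map between fibres is linear on the fibre \<open>A\<close> only and arbitrary
  elsewhere in the ambient space, so membership in \<open>A\<close> accompanies each step of the
  induction over the span.\<close>

lemma span_image_linear_between:
  assumes s: "vector_space s" and t: "vector_space t" and f: "linear_between s t A C f"
    and A: "module.subspace s A" and B: "B \<subseteq> A"
  shows "f ` module.span s B = module.span t (f ` B)"
proof -
  interpret s: vector_space s by (rule s)
  interpret t: vector_space t by (rule t)
  have add: "f (u + v) = f u + f v" if "u \<in> A" "v \<in> A" for u v
    using f that by (simp add: linear_between_def)
  have scale: "f (s a u) = t a (f u)" if "u \<in> A" for a u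
    using f that by (simp add: linear_between_def)
  have f0: "f 0 = 0" using add[of 0 0] s.subspace_0[OF A] by simp
  have span_A: "s.span B \<subseteq> A" using A B by (simp add: s.span_minimal)
  show ?thesis
  proof (rule antisym)
    show "f ` s.span B \<subseteq> t.span (f ` B)"
    proof (rule image_subsetI)
      fix u assume "u \<in> s.span B"
      then have "f u \<in> t.span (f ` B) \<and> u \<in> A"
      proof (induction rule: s.span_induct_alt)
        case base
        show ?case using s.subspace_0[OF A] by (simp add: f0 t.span_zero)
      next
        case (step c x y)
        have x: "x \<in> A" "s c x \<in> A" using step(1) B s.subspace_scale[OF A] by auto
        have y: "y \<in> A" using step(2) by blast
        have "f x \<in> t.span (f ` B)" using step(1) by (intro t.span_base) blast
        then have "t c (f x) + f y \<in> t.span (f ` B)" using step(2) by (intro t.span_add t.span_scale) auto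
        then show ?case
          using s.subspace_add[OF A x(2) y] by (simp add: add[OF x(2) y] scale[OF x(1)])
      qed
      then show "f u \<in> t.span (f ` B)" by blast
    qed
    have "t.subspace (f ` s.span B)"
    proof (rule t.subspaceI)
      show "0 \<in> f ` s.span B" using f0 s.span_zero by force
      show "u + v \<in> f ` s.span B" if uv: "u \<in> f ` s.span B" "v \<in> f ` s.span B" for u v
      proof -
        obtain u' v' where "u' \<in> s.span B" "v' \<in> s.span B" "u = f u'" "v = f v'" using uv by blast
        moreover have "u + v = f (u' + v')"
          using add[of u' v'] span_A calculation by (simp add: subsetD)
        ultimately show ?thesis by (intro image_eqI[of _ f "u' + v'"] s.span_add)
      qed
      show "t a u \<in> f ` s.span B" if u: "u \<in> f ` s.span B" for a u
      proof -
        obtain u' where "u' \<in> s.span B" "u = f u'" using u by blast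
        moreover have "t a u = f (s a u')"
          using scale[of u' a] span_A calculation by (simp add: subsetD)
        ultimately show ?thesis by (intro image_eqI[of _ f "s a u'"] s.span_scale)
      qed
    qed
    then show "t.span (f ` B) \<subseteq> f ` s.span B"
      by (intro t.span_minimal) (auto intro: s.span_base)
  qed
qed

lemma has_dim_span:
  assumes "vector_space s" "finite C"
  shows "\<exists>n. has_dim s (module.span s C) n"
proof -
  interpret vector_space s by fact
  obtain B where B: "B \<subseteq> C" "independent B" "C \<subseteq> span B"
    by (rule maximal_independent_subset)
  have "span B = span C"
    using span_mono[OF B(1)] span_minimal[OF B(3)] by auto
  moreover have "finite B" using B(1) assms(2) finite_subset by blast
  ultimately show ?thesis using B(2) unfolding has_dim_def by blast
qed

section \<open>Finite dimensional subbundles as vector bundles\<close>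

lemma finite_dim_subbundleD:
  assumes "finite_dim_subbundle X F V" "x \<in> topspace X"
  shows "V x \<subseteq> fib F x"
    "\<exists>U \<phi> M n. x \<in> U \<and> local_trivialisation X F U \<phi> \<and> has_dim (smult_model F) M n \<and> (\<forall>y\<in>U. \<phi> y ` V y = M)"
  using assms by (auto simp: finite_dim_subbundle_def)

lemma mem_subbundle_iff:
  assumes lt: "local_trivialisation X F U \<phi>" and y: "y \<in> U" "\<phi> y ` V y = M" "V y \<subseteq> fib F y"
    and f: "f \<in> fib F y"
  shows "f \<in> V y \<longleftrightarrow> \<phi> y f \<in> M"
proof -
  have "inj_on (\<phi> y) (fib F y)"
    using local_trivialisationD(4)[OF lt y(1)] by (simp add: bij_betw_def)
  then show ?thesis unfolding y(2)[symmetric] using inj_on_image_mem_iff y(3) f by metis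
qed

lemma topspace_subbundle_space:
  assumes "is_banach_bundle X F" "finite_dim_subbundle X F V"
  shows "topspace (subbundle_space X F V) = {(x, u). x \<in> topspace X \<and> u \<in> V x}"
  using finite_dim_subbundleD(1)[OF assms(2)]
  by (auto simp: subbundle_space_def topspace_total_space[OF assms(1)])

lemma limitin_subbundle_space_iff:
  assumes F: "is_banach_bundle X F" and V: "finite_dim_subbundle X F V"
    and lt: "local_trivialisation X F U \<phi>" and x: "x \<in> U"
  shows "limitin (subbundle_space X F V) (\<lambda>t. (p t, \<sigma> t)) (x, u) \<F> \<longleftrightarrow>
     u \<in> V x \<and> limitin X p x \<F> \<and> (\<forall>\<^sub>F t in \<F>. \<sigma> t \<in> V (p t))
     \<and> ((\<lambda>t. \<phi> (p t) (\<sigma> t)) \<longlongrightarrow> \<phi> x u) \<F>"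
proof -
  have xX: "x \<in> topspace X" using local_trivialisationD(1)[OF lt] x openin_subset by blast
  have ev: "\<forall>\<^sub>F t in \<F>. p t \<in> topspace X" if "limitin X p x \<F>"
    using that xX by (auto simp: limitin_def)
  have fib: "\<forall>\<^sub>F t in \<F>. \<sigma> t \<in> fib F (p t)"
    if "\<forall>\<^sub>F t in \<F>. p t \<in> topspace X" "\<forall>\<^sub>F t in \<F>. \<sigma> t \<in> V (p t)"
    using that by eventually_elim (use finite_dim_subbundleD(1)[OF V] in blast)
  have "limitin (subbundle_space X F V) (\<lambda>t. (p t, \<sigma> t)) (x, u) \<F> \<longleftrightarrow>
     u \<in> V x \<and> (\<forall>\<^sub>F t in \<F>. p t \<in> topspace X \<and> \<sigma> t \<in> V (p t)) \<and> u \<in> fib F x \<and> limitin X p x \<F>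
     \<and> (\<forall>\<^sub>F t in \<F>. \<sigma> t \<in> fib F (p t)) \<and> ((\<lambda>t. \<phi> (p t) (\<sigma> t)) \<longlongrightarrow> \<phi> x u) \<F>"
    using xX by (auto simp: subbundle_space_def limitin_subtopology section_tendsto_iff[OF F lt x])
  also have "\<dots> \<longleftrightarrow> u \<in> V x \<and> limitin X p x \<F> \<and> (\<forall>\<^sub>F t in \<F>. \<sigma> t \<in> V (p t))
     \<and> ((\<lambda>t. \<phi> (p t) (\<sigma> t)) \<longlongrightarrow> \<phi> x u) \<F>"
    using finite_dim_subbundleD(1)[OF V] xX ev fib
    by (auto simp: eventually_conj_iff)
  finally show ?thesis .
qed

text \<open>A straightening trivialisation makes the subbundle the constant space \<open>M\<close>,
  so a basis of \<open>M\<close> pulled back to the fibres is a frame. Its coordinate functions are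
  coordinates in \<open>M\<close>, and their boundedness gives continuity.\<close>

lemma is_vector_bundle_subbundle_space:
  fixes F :: "('k::real_or_complex, 'x, 'f::ab_group_add, 'n::banach) banach_bundle"
  assumes F: "is_banach_bundle X F" and V: "finite_dim_subbundle X F V"
  shows "is_vector_bundle (smult_fib F) X (subbundle_space X F V)"
proof (rule is_vector_bundleI)
  note FD = is_banach_bundleD[OF F]
  let ?s = "smult_fib F" and ?m = "smult_model F"
  interpret m: vector_space ?m using FD(2) by (simp add: K_banach_space_def)
  show "vector_space ?s" by (rule FD)
  show "topspace (subbundle_space X F V) \<subseteq> topspace X \<times> UNIV"
    by (auto simp: topspace_subbundle_space[OF F V])
  fix x assume xX: "x \<in> topspace X"
  obtain U \<phi> M n where U: "x \<in> U" and lt: "local_trivialisation X F U \<phi>"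
    and M: "has_dim ?m M n" "\<And>y. y \<in> U \<Longrightarrow> \<phi> y ` V y = M"
    using finite_dim_subbundleD(2)[OF V xX] by blast
  note D = local_trivialisationD[OF lt]
  have UX: "y \<in> topspace X" if "y \<in> U" for y using that D(1) openin_subset by blast
  obtain B where B: "finite B" "card B = n" "m.independent B" "m.span B = M"
    using M(1) by (auto simp: has_dim_def)
  obtain b where b: "bij_betw b {..<n} B"
    using ex_bij_betw_nat_finite[OF B(1)] B(2) by (auto simp: lessThan_atLeast0)
  have bB: "b i \<in> B" if "i < n" for i using b that by (auto simp: bij_betw_def)
  have bM: "b i \<in> M" if "i < n" for i using m.span_base[OF bB[OF that]] B(4) by simp
  have sumB: "(\<Sum>i<n. g (b i)) = (\<Sum>v\<in>B. g v)" for g :: "'n \<Rightarrow> 'n"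
    by (rule sum.reindex_bij_betw[OF b])
  have memV: "f \<in> V y \<longleftrightarrow> \<phi> y f \<in> M" if y: "y \<in> U" and f: "f \<in> fib F y" for y f
    by (fact mem_subbundle_iff[where V = V, OF lt y M(2)[OF y] finite_dim_subbundleD(1)[OF V UX[OF y]] f])
  define e where "e i y = inv_into (fib F y) (\<phi> y) (b i)" for i y
  have e: "e i y \<in> fib F y" "\<phi> y (e i y) = b i" if "y \<in> U" for i y
    using D(4)[OF that] unfolding e_def bij_betw_def
    by (auto simp: inv_into_into f_inv_into_f)
  have comb: "(\<Sum>i\<in>I. ?s (a i) (e i y)) \<in> fib F y \<and> \<phi> y (\<Sum>i\<in>I. ?s (a i) (e i y)) = (\<Sum>i\<in>I. ?m (a i) (b i))"
    if "finite I" "y \<in> U" for I y a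
    using that
  proof (induction I)
    case empty
    then show ?case using fib_closed[OF F UX] local_trivialisation_zero_diff[OF F lt] by simp
  next
    case (insert i I)
    then show ?case using e fib_closed[OF F UX] by (simp add: D)
  qed
  have combV: "(\<Sum>i<n. ?s (a i) (e i y)) \<in> V y" if "y \<in> U" for y a
  proof -
    have "(\<Sum>i<n. ?m (a i) (b i)) \<in> M"
      using bM unfolding B(4)[symmetric] by (intro m.span_sum m.span_scale) auto
    then show ?thesis using memV[OF that] comb[OF finite_lessThan that] by simp
  qed
  define c where "c i z = m.representation B (\<phi> (fst z) (snd z)) (b i)" for i and z :: "'x \<times> 'f"
  have rep_comb: "m.representation B (\<Sum>i<n. ?m (a i) (b i)) (b j) = a j" if "j < n" for a j
  proof -
    \<comment> \<open>Coefficients are moved from indices to basis vectors, where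
      \<open>representation\<close> lives.\<close>
    define a' where "a' v = a (inv_into {..<n} b v)" for v
    have a': "a' (b i) = a i" if "i < n" for i
      using b that by (simp add: a'_def bij_betw_inv_into_left)
    have "(\<Sum>i<n. ?m (a i) (b i)) = (\<Sum>i<n. ?m (a' (b i)) (b i))" by (simp add: a')
    also have "\<dots> = (\<Sum>v\<in>B. ?m (a' v) v)" by (rule sumB)
    finally have eq: "(\<Sum>i<n. ?m (a i) (b i)) = (\<Sum>v\<in>B. ?m (a' v) v)" .
    have "m.representation B (\<Sum>v\<in>B. ?m (a' v) v) = (\<lambda>v. if v \<in> B then a' v else 0)"
    proof (rule m.representation_eqI[OF B(3)])
      show "(\<Sum>v\<in>B. ?m (a' v) v) \<in> m.span B"
        by (intro m.span_sum m.span_scale m.span_base)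
      show "finite {v. (if v \<in> B then a' v else 0) \<noteq> 0}"
        by (rule finite_subset[OF _ B(1)]) auto
      show "(\<Sum>v | (if v \<in> B then a' v else 0) \<noteq> 0. ?m (if v \<in> B then a' v else 0) v) = (\<Sum>v\<in>B. ?m (a' v) v)"
        using B(1) by (intro sum.mono_neutral_cong_left) auto
    qed (auto split: if_splits)
    then show ?thesis unfolding eq using bB[OF that] a'[OF that] by simp
  qed
  have rep_sum: "(\<Sum>i<n. ?m (m.representation B w (b i)) (b i)) = w" if "w \<in> M" for w
    using sumB[of "\<lambda>v. ?m (m.representation B w v) v"] m.sum_representation_eq[OF B(3) _ B(1) order_refl, of w]
      that B(4) by simp
  let ?P = "product_topology (\<lambda>_. euclidean :: 'k topology) {..<n}"
  let ?S = "prod_topology (subtopology X U) ?P"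
  have "vb_frame ?s X (subbundle_space X F V) U n e c"
    unfolding vb_frame_def
  proof (intro conjI ballI allI impI)
    show "openin X U" by (rule D)
    fix y assume y: "y \<in> U"
    show "(y, \<Sum>i<n. ?s (a i) (e i y)) \<in> topspace (subbundle_space X F V)" for a
      using combV[OF y] UX[OF y] by (simp add: topspace_subbundle_space[OF F V])
    show "c j (y, \<Sum>i<n. ?s (a i) (e i y)) = a j" if "j < n" for a j
      using comb[OF finite_lessThan y, of a n] rep_comb[OF that, of a] by (simp add: c_def)
    show "(\<Sum>i<n. ?s (c i (y, u)) (e i y)) = u" if "(y, u) \<in> topspace (subbundle_space X F V)" for u
    proof -
      have u: "u \<in> V y" "u \<in> fib F y"
        using that finite_dim_subbundleD(1)[OF V] by (auto simp: topspace_subbundle_space[OF F V])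
      have "\<phi> y u \<in> M" using memV[OF y u(2)] u(1) by simp
      then have "\<phi> y (\<Sum>i<n. ?s (c i (y, u)) (e i y)) = \<phi> y u"
        using comb[OF finite_lessThan y, of "\<lambda>i. c i (y, u)" n] rep_sum by (simp add: c_def)
      then show ?thesis
        using D(4)[OF y] comb[OF finite_lessThan y] u(2) by (meson bij_betw_def inj_onD)
    qed
  next
    show "continuous_map ?S (subbundle_space X F V) (\<lambda>(y, a). (y, \<Sum>i<n. ?s (a i) (e i y)))"
      unfolding continuous_map_atin
    proof
      fix z assume z: "z \<in> topspace ?S"
      then have zU: "fst z \<in> U" by (simp add: mem_Times_iff)
      have 1: "limitin X fst (fst z) (atin ?S z)"
        using iffD1[OF continuous_map_atin continuous_map_into_fulltopology[OF continuous_map_fst]] z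
        by blast
      have a: "((\<lambda>t. snd t i) \<longlongrightarrow> snd z i) (atin ?S z)" if "i < n" for i
      proof -
        have "continuous_map ?S euclidean (\<lambda>t. snd t i)"
          using continuous_map_componentwise[of ?S "\<lambda>_. euclidean :: 'k topology" "{..<n}" snd]
            continuous_map_snd[of "subtopology X U" ?P] that by simp
        from bspec[OF iffD1[OF continuous_map_euclidean_atin this] z] show ?thesis .
      qed
      have lim: "((\<lambda>t. \<Sum>i<n. ?m (snd t i) (b i)) \<longlongrightarrow> (\<Sum>i<n. ?m (snd z i) (b i))) (atin ?S z)"
        by (intro tendsto_sum bounded_bilinear.tendsto[OF bounded_bilinear_K_banach_space[OF FD(2)]]
            tendsto_const a) simp
      have evS: "\<forall>\<^sub>F t in atin ?S z. fst t \<in> U"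
        using 1 D(1) zU by (auto simp: limitin_def)
      have "\<forall>\<^sub>F t in atin ?S z. (\<Sum>i<n. ?m (snd t i) (b i)) = \<phi> (fst t) (\<Sum>i<n. ?s (snd t i) (e i (fst t)))"
        using evS by (rule eventually_mono) (simp add: comb)
      from tendsto_cong[OF this] lim
      have "((\<lambda>t. \<phi> (fst t) (\<Sum>i<n. ?s (snd t i) (e i (fst t)))) \<longlongrightarrow>
          \<phi> (fst z) (\<Sum>i<n. ?s (snd z i) (e i (fst z)))) (atin ?S z)"
        using comb[OF finite_lessThan zU] by simp
      moreover have "\<forall>\<^sub>F t in atin ?S z. (\<Sum>i<n. ?s (snd t i) (e i (fst t))) \<in> V (fst t)"
        using evS by (rule eventually_mono) (rule combV)
      ultimately show "limitin (subbundle_space X F V) (\<lambda>(y, a). (y, \<Sum>i<n. ?s (a i) (e i y)))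
          ((\<lambda>(y, a). (y, \<Sum>i<n. ?s (a i) (e i y))) z) (atin ?S z)"
        unfolding case_prod_unfold
        using 1 combV[OF zU] by (simp add: limitin_subbundle_space_iff[OF F V lt zU])
    qed
  next
    let ?W = "subtopology (subbundle_space X F V) (U \<times> UNIV)"
    have lim: "z \<in> topspace ?W \<Longrightarrow> fst z \<in> U \<and> snd z \<in> V (fst z) \<and> limitin X fst (fst z) (atin ?W z)
        \<and> (\<forall>\<^sub>F t in atin ?W z. snd t \<in> V (fst t))
        \<and> ((\<lambda>t. \<phi> (fst t) (snd t)) \<longlongrightarrow> \<phi> (fst z) (snd z)) (atin ?W z)" for z
    proof -
      assume z: "z \<in> topspace ?W"
      then have zU: "fst z \<in> U" by auto
      have "limitin (subbundle_space X F V) (\<lambda>t. (fst t, snd t)) (fst z, snd z) (atin ?W z)"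
        using limitin_atin_id[OF z] by (simp add: limitin_subtopology)
      then show ?thesis using zU unfolding limitin_subbundle_space_iff[OF F V lt zU] by blast
    qed
    then show "continuous_map ?W X fst" by (simp add: continuous_map_atin)
    fix i assume i: "i < n"
    obtain C where C: "\<And>w. w \<in> M \<Longrightarrow> norm (m.representation B w (b i)) \<le> C * norm w"
      using bounded_coordinate[OF FD(2) B(1,3) bB[OF i]] B(4) by blast
    show "continuous_map ?W euclidean (c i)"
      unfolding continuous_map_euclidean_atin
    proof
      fix z assume z: "z \<in> topspace ?W"
      note L = lim[OF z]
      have zU: "fst z \<in> U" and zV: "snd z \<in> V (fst z)" using L by auto
      have zM: "\<phi> (fst z) (snd z) \<in> M" using M(2)[OF zU] zV by blast
      have "\<forall>\<^sub>F t in atin ?W z. fst t \<in> U" using L D(1) by (auto simp: limitin_def)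
      moreover have "\<forall>\<^sub>F t in atin ?W z. snd t \<in> V (fst t)" using L by blast
      ultimately have "\<forall>\<^sub>F t in atin ?W z. norm (c i t - c i z) \<le>
          C * norm (\<phi> (fst t) (snd t) - \<phi> (fst z) (snd z))"
      proof eventually_elim
        case (elim t)
        have tM: "\<phi> (fst t) (snd t) \<in> M" using M(2)[OF elim(1)] elim(2) by blast
        have "c i t - c i z = m.representation B (\<phi> (fst t) (snd t) - \<phi> (fst z) (snd z)) (b i)"
          using tM zM B(3,4) by (simp add: c_def m.representation_diff)
        moreover have "\<phi> (fst t) (snd t) - \<phi> (fst z) (snd z) \<in> M"
          using tM zM m.span_diff B(4) by blast
        ultimately show ?case using C by simp
      qed
      moreover have "((\<lambda>t. C * norm (\<phi> (fst t) (snd t) - \<phi> (fst z) (snd z))) \<longlongrightarrow> 0) (atin ?W z)"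
      proof -
        have "((\<lambda>t. \<phi> (fst t) (snd t) - \<phi> (fst z) (snd z)) \<longlongrightarrow> 0) (atin ?W z)"
          using L by (intro LIM_zero) blast
        then show ?thesis by (intro tendsto_mult_right_zero tendsto_norm_zero)
      qed
      ultimately have "((\<lambda>t. c i t - c i z) \<longlongrightarrow> 0) (atin ?W z)"
        by (rule Lim_null_comparison)
      then show "(c i \<longlongrightarrow> c i z) (atin ?W z)" by (rule LIM_zero_cancel)
    qed
  qed
  with U show "\<exists>U n e c. x \<in> U \<and> vb_frame ?s X (subbundle_space X F V) U n e c" by blast
qed

section \<open>Local splittings of Fredholm morphisms\<close>

text \<open>By definition a morphism is continuous in the trivialisations of the atlases. Composing
  with changes of trivialisation on both sides reaches any other pair, after shrinking to where
  atlas members are available too.\<close>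

lemma bundle_morphism_norm_continuous_at:
  assumes E: "is_banach_bundle X E" and F: "is_banach_bundle X F" and L: "bundle_morphism X E F L"
    and lt: "local_trivialisation X E U \<phi>" "local_trivialisation X F V \<psi>"
    and x: "x \<in> U" "x \<in> V"
  shows "\<exists>W. openin X W \<and> x \<in> W \<and> W \<subseteq> U \<and> W \<subseteq> V \<and> norm_continuous_in X W (fib E) \<phi> \<psi> L"
proof -
  note D = local_trivialisationD[OF lt(1)] and D' = local_trivialisationD[OF lt(2)]
  have xX: "x \<in> topspace X" using D(1) x openin_subset by blast
  obtain U1 \<alpha> where U1: "(U1, \<alpha>) \<in> atlas E" "x \<in> U1" using is_banach_bundleD(5)[OF E xX] by blast
  obtain V1 \<beta> where V1: "(V1, \<beta>) \<in> atlas F" "x \<in> V1" using is_banach_bundleD(5)[OF F xX] by blast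
  have o: "openin X U1" "openin X V1"
    using U1(1) V1(1) is_banach_bundleD(4)[OF E] is_banach_bundleD(4)[OF F] local_trivialisationD(1) by blast+
  have Lf: "L y u \<in> fib F y" if "y \<in> topspace X" "u \<in> fib E y" for y u
    using L that by (auto simp: bundle_morphism_def linear_between_def)
  have "norm_continuous_in X (U1 \<inter> V1) (fib E) \<alpha> \<beta> L"
    using L U1(1) V1(1) by (auto simp: bundle_morphism_def)
  from norm_continuous_in_compose[OF D(5)[OF U1(1)] this]
  have "norm_continuous_in X ((U \<inter> U1) \<inter> (U1 \<inter> V1)) (fib E) \<phi> \<beta> L" by simp
  from norm_continuous_in_compose[OF this D'(6)[OF V1(1)]]
  have "norm_continuous_in X (((U \<inter> U1) \<inter> (U1 \<inter> V1)) \<inter> (V \<inter> V1)) (fib E) \<phi> \<psi> L"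
    using Lf openin_subset[OF D(1)] by blast
  moreover have "openin X (((U \<inter> U1) \<inter> (U1 \<inter> V1)) \<inter> (V \<inter> V1))"
    using D(1) D'(1) o by (intro openin_Int)
  ultimately show ?thesis using x U1 V1 by (intro exI conjI) auto
qed

lemma continuous_map_blinfun_affine:
  assumes "continuous_map X euclidean T"
  shows "continuous_map X euclidean (\<lambda>x. (Q o\<^sub>L T x) + P)"
  using assms unfolding continuous_map_euclidean_atin
  by (auto intro!: tendsto_add tendsto_const bounded_bilinear.tendsto[OF bounded_bilinear_blinfun_compose])

text \<open>Compatibility with the atlas is demanded in both directions, so the twisting operators
  and their inverses both have to be norm-continuous.\<close>

lemma local_trivialisation_compose:
  assumes lt: "local_trivialisation X E U \<phi>"
    and A: "continuous_map (subtopology X U) euclidean A" and B: "continuous_map (subtopology X U) euclidean B"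
    and AB: "\<And>y. y \<in> U \<Longrightarrow> A y o\<^sub>L B y = id_blinfun" and BA: "\<And>y. y \<in> U \<Longrightarrow> B y o\<^sub>L A y = id_blinfun"
    and scale: "\<And>y a u. y \<in> U \<Longrightarrow> A y (smult_model E a u) = smult_model E a (A y u)"
  shows "local_trivialisation X E U (\<lambda>y u. blinfun_apply (A y) (\<phi> y u))"
proof -
  note D = local_trivialisationD[OF lt]
  have AB': "A y (B y w) = w" and BA': "B y (A y w) = w" if "y \<in> U" for y w
    using blinfun_compose_id_apply[OF AB[OF that]] blinfun_compose_id_apply[OF BA[OF that]] by auto
  have bij: "bij_betw (\<lambda>u. A y (\<phi> y u)) (fib E y) UNIV" if y: "y \<in> U" for y
  proof -
    have "bij_betw (blinfun_apply (A y)) UNIV UNIV"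
      by (rule bij_betw_byWitness[of _ "blinfun_apply (B y)"]) (auto simp: AB' BA' y)
    from bij_betw_trans[OF D(4)[OF y] this] show ?thesis by (simp add: o_def)
  qed
  have nc1: "norm_continuous_in X U (fib E) \<phi> (\<lambda>y u. A y (\<phi> y u)) (\<lambda>y u. u)"
    unfolding norm_continuous_in_def using A by blast
  have nc2: "norm_continuous_in X U (fib E) (\<lambda>y u. A y (\<phi> y u)) \<phi> (\<lambda>y u. u)"
    unfolding norm_continuous_in_def using B by (intro exI[of _ B]) (simp add: BA')
  have "norm_continuous_in X (U \<inter> V) (fib E) (\<lambda>y u. A y (\<phi> y u)) \<psi> (\<lambda>x u. u)
      \<and> norm_continuous_in X (U \<inter> V) (fib E) \<psi> (\<lambda>y u. A y (\<phi> y u)) (\<lambda>x u. u)"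
    if V: "(V, \<psi>) \<in> atlas E" for V \<psi>
  proof
    have "norm_continuous_in X (U \<inter> (U \<inter> V)) (fib E) (\<lambda>y u. A y (\<phi> y u)) \<psi> (\<lambda>x u. u)"
      by (rule norm_continuous_in_compose[OF nc2 D(5)[OF V]])
    then show "norm_continuous_in X (U \<inter> V) (fib E) (\<lambda>y u. A y (\<phi> y u)) \<psi> (\<lambda>x u. u)"
      by (rule norm_continuous_in_subset) simp
    have "norm_continuous_in X ((U \<inter> V) \<inter> U) (fib E) \<psi> (\<lambda>y u. A y (\<phi> y u)) (\<lambda>x u. u)"
      by (rule norm_continuous_in_compose[OF D(6)[OF V] nc1])
    then show "norm_continuous_in X (U \<inter> V) (fib E) \<psi> (\<lambda>y u. A y (\<phi> y u)) (\<lambda>x u. u)"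
      by (rule norm_continuous_in_subset) blast
  qed
  then show ?thesis
    using D(1-4) bij unfolding local_trivialisation_def linear_between_def
    by (auto simp: scale blinfun.add_right)
qed

text \<open>The trivialisation of \<open>F\<close> is taken to straighten \<open>V\<close>, so the
  model subspace \<open>M\<close>, and with it \<open>P\<close> and \<open>Q\<close>, stays fixed
  while \<open>T y\<close> varies. In the trivialisation of \<open>E\<close> twisted by
  \<open>A y\<close>, which is \<open>Q\<close> after \<open>T y\<close> plus \<open>P\<close>, the
  splitting is the constant operator \<open>Q\<close>, so its norm continuity is immediate.\<close>

lemma ex_local_splitting:
  fixes E :: "('k::real_or_complex, 'x, 'e::ab_group_add, 'm::banach) banach_bundle"
    and F :: "('k, 'x, 'f::ab_group_add, 'n::banach) banach_bundle"
  assumes E: "is_banach_bundle X E" and F: "is_banach_bundle X F" and L: "bundle_morphism X E F L"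
    and ker: "has_dim (smult_fib E) {u \<in> fib E x0. L x0 u = 0} k"
    and V: "finite_dim_subbundle X F V" and trans: "transversal_to_image X E F L V"
    and x0: "x0 \<in> topspace X"
  shows "\<exists>W \<phi> \<psi> N n S. x0 \<in> W \<and> local_trivialisation X E W \<phi> \<and> local_trivialisation X F W \<psi>
    \<and> has_dim (smult_model E) N n \<and> (\<forall>y\<in>W. \<phi> y ` preimage_subbundle E L V y = N)
    \<and> norm_continuous_in X W (fib F) \<psi> \<phi> S
    \<and> (\<forall>y\<in>W. linear_between (smult_fib F) (smult_fib E) (fib F y) (fib E y) (S y)
        \<and> (\<forall>f\<in>fib F y. L y (S y f) - f \<in> V y))"
proof -
  note ED = is_banach_bundleD[OF E] and FD = is_banach_bundleD[OF F]
  let ?sm = "smult_model E" and ?sn = "smult_model F"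
  interpret sE: vector_space "smult_fib E" by (rule ED)
  interpret m: vector_space ?sm using ED(2) by (simp add: K_banach_space_def)
  interpret n: vector_space ?sn using FD(2) by (simp add: K_banach_space_def)
  have Lf: "L y u \<in> fib F y" "L y (smult_fib E a u) = smult_fib F a (L y u)"
    if "y \<in> topspace X" "u \<in> fib E y" for y u a
    using L that by (auto simp: bundle_morphism_def linear_between_def)
  obtain U1 \<phi> where U1': "(U1, \<phi>) \<in> atlas E" "x0 \<in> U1" using ED(5)[OF x0] by blast
  note U1 = U1'(2) ED(4)[OF U1'(1)]
  obtain U2 \<psi> M q where U2: "x0 \<in> U2" "local_trivialisation X F U2 \<psi>"
    and M: "has_dim ?sn M q" "\<forall>y\<in>U2. \<psi> y ` V y = M"
    using finite_dim_subbundleD(2)[OF V x0] by (elim exE conjE)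
  obtain O1 where O1: "openin X O1" "x0 \<in> O1" "O1 \<subseteq> U1" "O1 \<subseteq> U2"
    and nc: "norm_continuous_in X O1 (fib E) \<phi> \<psi> L"
    using bundle_morphism_norm_continuous_at[OF E F L U1(2) U2(2) U1(1) U2(1)] by blast
  note D1 = local_trivialisationD[OF local_trivialisation_subset[OF U1(2) O1(1,3)]]
  note D2 = local_trivialisationD[OF local_trivialisation_subset[OF U2(2) O1(1,4)]]
  have OX: "y \<in> topspace X" if "y \<in> O1" for y using that O1(1) openin_subset by blast
  obtain T where T: "continuous_map (subtopology X O1) euclidean T"
    "\<And>y u. y \<in> O1 \<Longrightarrow> u \<in> fib E y \<Longrightarrow> \<psi> y (L y u) = blinfun_apply (T y) (\<phi> y u)"
    using nc unfolding norm_continuous_in_def by blast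
  have surj: "\<exists>u\<in>fib E y. \<phi> y u = w" if "y \<in> O1" for y w
    using D1(4)[OF that] by (metis UNIV_I bij_betw_def imageE)
  have surj2: "\<exists>f\<in>fib F y. \<psi> y f = w" if "y \<in> O1" for y w
    using D2(4)[OF that] by (metis UNIV_I bij_betw_def imageE)
  have Ts: "T y (?sm a w) = ?sn a (T y w)" if y: "y \<in> O1" for y a w
  proof -
    obtain u where u: "u \<in> fib E y" "\<phi> y u = w" using surj[OF y] by blast
    have "T y (?sm a w) = T y (\<phi> y (smult_fib E a u))" by (simp add: D1(3)[OF y u(1)] u(2))
    also have "\<dots> = \<psi> y (L y (smult_fib E a u))"
      using T(2)[OF y fib_closed(4)[OF E OX[OF y] u(1)]] by simp
    also have "\<dots> = ?sn a (\<psi> y (L y u))"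
      using Lf[OF OX[OF y] u(1)] by (simp add: D2(3)[OF y])
    finally show ?thesis using T(2)[OF y u(1)] u(2) by simp
  qed
  have memV: "f \<in> V y \<longleftrightarrow> \<psi> y f \<in> M" if y: "y \<in> O1" and f: "f \<in> fib F y" for y f
  proof -
    have y2: "y \<in> U2" using y O1(4) by blast
    show ?thesis
      using mem_subbundle_iff[where V = V, OF U2(2) y2 bspec[OF M(2) y2] finite_dim_subbundleD(1)[OF V OX[OF y]] f] .
  qed
  obtain B where B: "finite B" "M = n.span B"
    using M(1) by (auto simp: has_dim_def)
  note zd2 = local_trivialisation_zero_diff[OF F U2(2)]
  obtain K where K: "finite K" "sE.span K = {u \<in> fib E x0. L x0 u = 0}"
    using ker by (auto simp: has_dim_def)
  have psi0: "\<psi> y f = 0 \<longleftrightarrow> f = 0" if y: "y \<in> O1" and f: "f \<in> fib F y" for y f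
  proof -
    have "\<psi> y 0 = 0" using zd2(1) y O1(4) by blast
    then show ?thesis
      using D2(4)[OF y] fib_closed(1)[OF F OX[OF y]] f by (metis bij_betw_def inj_onD)
  qed
  \<comment> \<open>Finite dimensionality of the kernel is given in the fibre; the trivialisation
    moves it to the model operator \<open>T x0\<close>.\<close>
  have kerT: "{w. T x0 w = 0} = m.span (\<phi> x0 ` K)"
  proof -
    have "linear_between (smult_fib E) ?sm (fib E x0) UNIV (\<phi> x0)"
      using D1(2,3)[OF O1(2)] by (simp add: linear_between_def)
    moreover have "K \<subseteq> fib E x0" using sE.span_superset[of K] K(2) by blast
    ultimately have "m.span (\<phi> x0 ` K) = \<phi> x0 ` {u \<in> fib E x0. L x0 u = 0}"
      unfolding K(2)[symmetric]
      using span_image_linear_between[OF ED(1) m.vector_space_axioms _ ED(3)[OF x0]] by metis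
    also have "\<dots> = {w. T x0 w = 0}"
    proof (intro antisym subsetI)
      fix w assume "w \<in> \<phi> x0 ` {u \<in> fib E x0. L x0 u = 0}"
      then obtain u where "u \<in> fib E x0" "L x0 u = 0" "w = \<phi> x0 u" by blast
      then show "w \<in> {w. T x0 w = 0}"
        using T(2)[OF O1(2), of u] psi0[OF O1(2) fib_closed(1)[OF F x0]] by simp
    next
      fix w assume w: "w \<in> {w. T x0 w = 0}"
      obtain u where u: "u \<in> fib E x0" "\<phi> x0 u = w" using surj[OF O1(2)] by blast
      then have "\<psi> x0 (L x0 u) = 0" using w T(2)[OF O1(2) u(1)] by simp
      then have "L x0 u = 0" using psi0[OF O1(2) Lf(1)[OF x0 u(1)]] by blast
      then show "w \<in> \<phi> x0 ` {u \<in> fib E x0. L x0 u = 0}" using u by blast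
    qed
    finally show ?thesis by simp
  qed
  have "Vector_Spaces.linear ?sm ?sn (T x0)"
    by (intro Vector_Spaces.linear.intro module_hom.intro module_hom_axioms.intro m.module_axioms
        n.module_axioms m.vector_space_axioms n.vector_space_axioms)
      (simp_all add: blinfun.add_right Ts[OF O1(2)])
  from finite_span_preimage[OF this _ kerT B(1)]
  obtain C where C: "finite C" "m.span C = {u. T x0 u \<in> M}"
    using K(1) B(2) by blast
  have trans0: "\<exists>u. T x0 u - w \<in> M" for w
  proof -
    obtain f where f: "f \<in> fib F x0" "\<psi> x0 f = w" using surj2[OF O1(2)] by blast
    obtain u v where u: "u \<in> fib E x0" and v: "v \<in> V x0" and fuv: "f = L x0 u + v"
      using trans f(1) x0 unfolding transversal_to_image_def by blast
    have vF: "v \<in> fib F x0" using v finite_dim_subbundleD(1)[OF V x0] by blast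
    have "w = T x0 (\<phi> x0 u) + \<psi> x0 v"
      using f(2) fuv D2(2)[OF O1(2) Lf(1)[OF x0 u] vF] T(2)[OF O1(2) u] by simp
    then have "T x0 (\<phi> x0 u) - w = - \<psi> x0 v" by simp
    moreover have "\<psi> x0 v \<in> M" using memV[OF O1(2) vF] v by blast
    ultimately have "T x0 (\<phi> x0 u) - w \<in> M" using n.span_neg B(2) by simp
    then show ?thesis by blast
  qed
  obtain P :: "'m \<Rightarrow>\<^sub>L 'm" and Q :: "'n \<Rightarrow>\<^sub>L 'm" where
    P: "\<And>u. T x0 (P u) \<in> M" "\<And>u. T x0 u \<in> M \<Longrightarrow> P u = u" "\<And>a u. P (?sm a u) = ?sm a (P u)"
    and Q: "\<And>a f. Q (?sn a f) = ?sm a (Q f)" "\<And>f. P (Q f) = 0" "\<And>f. Q f = 0 \<longleftrightarrow> f \<in> M"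
      "\<And>u. Q (T x0 u) = u - P u"
    using ex_right_inverse_modulo[OF ED(2) FD(2) Ts[OF O1(2)] B C(1) C(2)[symmetric] trans0] by blast
  define A where "A y = (Q o\<^sub>L T y) + P" for y
  have A: "A y w = Q (T y w) + P w" for y w by (simp add: A_def blinfun.add_left)
  have cA: "continuous_map (subtopology X O1) euclidean A"
    unfolding A_def[abs_def] by (rule continuous_map_blinfun_affine[OF T(1)])
  have A0: "A x0 = id_blinfun" by (rule blinfun_eqI) (simp add: A Q)
  \<comment> \<open>Within distance \<open>1/2\<close> of the identity, the contraction argument
    inverts \<open>A y\<close> with inverse of norm at most \<open>2\<close>.\<close>
  define W where "W = {y \<in> O1. A y \<in> ball id_blinfun (1/2)}"
  have "openin (subtopology X O1) {y \<in> topspace (subtopology X O1). A y \<in> ball id_blinfun (1/2)}"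
    by (rule openin_continuous_map_preimage[OF cA]) simp
  moreover have "{y \<in> topspace (subtopology X O1). A y \<in> ball id_blinfun (1/2)} = W"
    using OX by (auto simp: W_def)
  ultimately have "openin (subtopology X O1) W" by simp
  then have oW: "openin X W" using openin_open_subtopology[OF O1(1)] by simp
  have xW: "x0 \<in> W" using O1(2) A0 by (simp add: W_def)
  have WO: "W \<subseteq> O1" by (auto simp: W_def)
  have "\<exists>B. A y o\<^sub>L B = id_blinfun \<and> B o\<^sub>L A y = id_blinfun \<and> norm B \<le> 2" if "y \<in> W" for y
    using that by (intro blinfun_inverse_near_identity) (simp add: W_def dist_norm norm_minus_commute)
  then obtain I where I: "\<And>y. y \<in> W \<Longrightarrow> A y o\<^sub>L I y = id_blinfun"
    "\<And>y. y \<in> W \<Longrightarrow> I y o\<^sub>L A y = id_blinfun" "\<And>y. y \<in> W \<Longrightarrow> norm (I y) \<le> 2"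
    by metis
  have cA': "continuous_map (subtopology X W) euclidean A"
    by (rule continuous_map_from_subtopology_mono[OF cA WO])
  have cI: "continuous_map (subtopology X W) euclidean I"
    by (rule continuous_map_blinfun_inverse[OF cA', where c = 2]) (simp_all add: I)
  have WU: "W \<subseteq> U1" "W \<subseteq> U2" using WO O1 by auto
  have lt1: "local_trivialisation X E W \<phi>" by (rule local_trivialisation_subset[OF U1(2) oW WU(1)])
  have lt2: "local_trivialisation X F W \<psi>" by (rule local_trivialisation_subset[OF U2(2) oW WU(2)])
  have lt: "local_trivialisation X E W (\<lambda>y u. A y (\<phi> y u))"
  proof (rule local_trivialisation_compose[OF lt1 cA' cI I(1,2)])
    show "A y (?sm a u) = ?sm a (A y u)" if "y \<in> W" for y a u
      using that WO by (simp add: A P Q Ts subsetD m.scale_right_distrib)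
  qed
  note LD = local_trivialisationD[OF lt]
  \<comment> \<open>The preimage of \<open>M\<close> at the centre \<open>x0\<close>, onto which the
    twisted trivialisation carries the preimages over all of \<open>W\<close>.\<close>
  define N where "N = {w. T x0 w \<in> M}"
  obtain d where d: "has_dim ?sm N d"
    using has_dim_span[OF m.vector_space_axioms C(1)] C(2) by (auto simp: N_def)
  have straight: "A y (\<phi> y u) \<in> N \<longleftrightarrow> u \<in> preimage_subbundle E L V y"
    if y: "y \<in> W" and u: "u \<in> fib E y" for y u
  proof -
    have yO: "y \<in> O1" using y WO by blast
    have "A y (\<phi> y u) \<in> N \<longleftrightarrow> T y (\<phi> y u) \<in> M"
      unfolding N_def mem_Collect_eq A
      by (rule straighten_preimage(1)[OF P(1,2) Q(2,3) I(1)[OF y, unfolded A_def]])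
    also have "\<dots> \<longleftrightarrow> L y u \<in> V y"
      using memV[OF yO Lf(1)[OF OX[OF yO] u]] T(2)[OF yO u] by simp
    finally show ?thesis using u by (simp add: preimage_subbundle_def)
  qed
  have pre: "(\<lambda>u. A y (\<phi> y u)) ` preimage_subbundle E L V y = N" if y: "y \<in> W" for y
  proof (intro antisym subsetI)
    fix w assume "w \<in> (\<lambda>u. A y (\<phi> y u)) ` preimage_subbundle E L V y"
    then show "w \<in> N" using straight[OF y] by (auto simp: preimage_subbundle_def)
  next
    fix w assume w: "w \<in> N"
    have "w \<in> (\<lambda>u. A y (\<phi> y u)) ` fib E y" using LD(4)[OF y] by (simp add: bij_betw_def)
    then obtain u where "u \<in> fib E y" "A y (\<phi> y u) = w" by blast
    then show "w \<in> (\<lambda>u. A y (\<phi> y u)) ` preimage_subbundle E L V y"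
      using straight[OF y] w by blast
  qed
  \<comment> \<open>Read in the untwisted trivialisation \<open>\<phi>\<close>, this is the inverse
    of \<open>A y\<close> applied to \<open>Q (\<psi> y f)\<close>.\<close>
  define S where "S y f = inv_into (fib E y) (\<lambda>u. A y (\<phi> y u)) (Q (\<psi> y f))" for y f
  have S: "S y f \<in> fib E y" "A y (\<phi> y (S y f)) = Q (\<psi> y f)" if y: "y \<in> W" for y f
  proof -
    have "Q (\<psi> y f) \<in> (\<lambda>u. A y (\<phi> y u)) ` fib E y"
      using LD(4)[OF y] by (simp add: bij_betw_def)
    from inv_into_into[OF this] f_inv_into_f[OF this]
    show "S y f \<in> fib E y" "A y (\<phi> y (S y f)) = Q (\<psi> y f)" by (simp_all add: S_def)
  qed
  have inj: "u = v" if "y \<in> W" "u \<in> fib E y" "v \<in> fib E y" "A y (\<phi> y u) = A y (\<phi> y v)" for y u v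
    using LD(4)[OF that(1)] that(2-4) by (auto simp: bij_betw_def dest: inj_onD)
  have ncS: "norm_continuous_in X W (fib F) \<psi> (\<lambda>y u. A y (\<phi> y u)) S"
    unfolding norm_continuous_in_def by (intro exI[of _ "\<lambda>_. Q"]) (simp add: S)
  have WX: "y \<in> topspace X" if "y \<in> W" for y using that WO OX by blast
  note L2 = local_trivialisationD[OF lt2]
  have linS: "linear_between (smult_fib F) (smult_fib E) (fib F y) (fib E y) (S y)" if y: "y \<in> W" for y
    unfolding linear_between_def
  proof (intro conjI ballI allI)
    note cl = fib_closed[OF E WX[OF y]]
    fix f assume f: "f \<in> fib F y"
    show "S y f \<in> fib E y" by (rule S[OF y])
    show "S y (f + g) = S y f + S y g" if g: "g \<in> fib F y" for g
    proof (rule inj[OF y])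
      show "A y (\<phi> y (S y (f + g))) = A y (\<phi> y (S y f + S y g))"
        by (simp add: S[OF y] LD(2)[OF y] L2(2)[OF y f g] blinfun.add_right)
    qed (auto intro: cl S y)
    show "S y (smult_fib F a f) = smult_fib E a (S y f)" for a
    proof (rule inj[OF y])
      show "A y (\<phi> y (S y (smult_fib F a f))) = A y (\<phi> y (smult_fib E a (S y f)))"
        by (simp add: S[OF y] LD(3)[OF y] L2(3)[OF y f] Q)
    qed (auto intro: cl S y)
  qed
  have LS: "L y (S y f) - f \<in> V y" if y: "y \<in> W" and f: "f \<in> fib F y" for y f
  proof -
    have yO: "y \<in> O1" using y WO by blast
    have LSf: "L y (S y f) \<in> fib F y" by (rule Lf(1)[OF WX[OF y] S(1)[OF y]])
    have "\<phi> y (S y f) = I y (Q (\<psi> y f))"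
      using blinfun_compose_id_apply[OF I(2)[OF y], of "\<phi> y (S y f)"] S(2)[OF y] by simp
    then have "\<psi> y (L y (S y f)) = T y (I y (Q (\<psi> y f)))"
      using T(2)[OF yO S(1)[OF y]] by simp
    then have "\<psi> y (L y (S y f) - f) = T y (I y (Q (\<psi> y f))) - \<psi> y f"
      using local_trivialisation_zero_diff(2)[OF F lt2 y LSf f] by simp
    also have "\<dots> \<in> M"
      by (rule straighten_preimage(2)[OF P(1,2) Q(2,3) I(1)[OF y, unfolded A_def]])
    finally show ?thesis
      using memV[OF yO] fib_closed(3)[OF F WX[OF y] LSf f] by blast
  qed
  show ?thesis
    using xW lt lt2 d pre ncS linS LS
    by (intro exI[of _ W] exI[of _ "\<lambda>y u. A y (\<phi> y u)"] exI[of _ \<psi>] exI[of _ N] exI[of _ d] exI[of _ S]) blast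
qed

lemma finite_dim_subbundle_preimage:
  assumes E: "is_banach_bundle X E" and F: "is_banach_bundle X F"
    and L: "fredholm_morphism X E F L"
    and V: "finite_dim_subbundle X F V" and trans: "transversal_to_image X E F L V"
  shows "finite_dim_subbundle X E (preimage_subbundle E L V)"
  unfolding finite_dim_subbundle_def
proof (intro conjI ballI)
  fix x assume x: "x \<in> topspace X"
  show "preimage_subbundle E L V x \<subseteq> fib E x" by (auto simp: preimage_subbundle_def)
  obtain k where "has_dim (smult_fib E) {u \<in> fib E x. L x u = 0} k" "bundle_morphism X E F L"
    using L x unfolding fredholm_morphism_def fredholm_morphism_of_index_def fredholm_of_index_def by blast
  from ex_local_splitting[OF E F this(2,1) V trans x]
  show "\<exists>U \<phi> M n. x \<in> U \<and> local_trivialisation X E U \<phi> \<and> has_dim (smult_model E) M n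
      \<and> (\<forall>y\<in>U. \<phi> y ` preimage_subbundle E L V y = M)"
    by blast
qed

section \<open>Global right inverses and the exchange isomorphism\<close>

lemma subbundle_fibre_subspace:
  assumes F: "is_banach_bundle X F" and V: "finite_dim_subbundle X F V" and x: "x \<in> topspace X"
  shows "module.subspace (smult_fib F) (V x)"
proof -
  interpret s: vector_space "smult_fib F" by (rule is_banach_bundleD[OF F])
  interpret m: vector_space "smult_model F"
    using is_banach_bundleD(2)[OF F] by (simp add: K_banach_space_def)
  obtain U \<phi> M n where U: "x \<in> U" and lt: "local_trivialisation X F U \<phi>"
    and dim: "has_dim (smult_model F) M n" and M: "\<forall>y\<in>U. \<phi> y ` V y = M"
    using finite_dim_subbundleD(2)[OF V x] by (elim exE conjE)
  have Msub: "m.subspace M" using dim by (auto simp: has_dim_def)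
  note VF = finite_dim_subbundleD(1)[OF V x]
  note iff = mem_subbundle_iff[where V = V, OF lt U bspec[OF M U] VF]
  note D = local_trivialisationD[OF lt]
  note cl = fib_closed[OF F x]
  show ?thesis
  proof (rule s.subspaceI)
    show "0 \<in> V x"
      using iff[OF cl(1)] local_trivialisation_zero_diff(1)[OF F lt U] m.subspace_0[OF Msub] by simp
  next
    fix f g assume fg: "f \<in> V x" "g \<in> V x"
    then have "f \<in> fib F x" "g \<in> fib F x" using VF by auto
    then show "f + g \<in> V x"
      using iff[OF cl(2)] D(2)[OF U] iff fg m.subspace_add[OF Msub] by simp
  next
    fix a f assume f: "f \<in> V x"
    then have "f \<in> fib F x" using VF by auto
    then show "smult_fib F a f \<in> V x"
      using iff[OF cl(4)] D(3)[OF U] iff f m.subspace_scale[OF Msub] by simp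
  qed
qed

lemma section_tendsto_zero:
  assumes bb: "is_banach_bundle X E" and p: "limitin X p x F"
  shows "section_tendsto X E p (\<lambda>t. 0) x 0 F"
proof -
  have x: "x \<in> topspace X" using p by (simp add: limitin_def)
  obtain U \<phi> where U: "(U, \<phi>) \<in> atlas E" "x \<in> U" using is_banach_bundleD(5)[OF bb x] by blast
  have lt: "local_trivialisation X E U \<phi>" using U(1) by (rule is_banach_bundleD(4)[OF bb])
  note D = local_trivialisationD[OF lt]
  have "\<forall>\<^sub>F t in F. p t \<in> U" using p D(1) U(2) by (auto simp: limitin_def)
  then have ev: "\<forall>\<^sub>F t in F. 0 = \<phi> (p t) 0"
    by (rule eventually_mono) (simp add: local_trivialisation_zero_diff(1)[OF bb lt])
  have "\<forall>\<^sub>F t in F. p t \<in> topspace X" using p x by (auto simp: limitin_def)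
  then have "\<forall>\<^sub>F t in F. 0 \<in> fib E (p t)"
    by (rule eventually_mono) (rule fib_closed(1)[OF bb])
  moreover have "((\<lambda>t. \<phi> (p t) 0) \<longlongrightarrow> \<phi> x 0) F"
    using iffD1[OF tendsto_cong[OF ev] tendsto_const] local_trivialisation_zero_diff(1)[OF bb lt U(2)]
    by simp
  ultimately show ?thesis
    using p fib_closed(1)[OF bb x] by (simp add: section_tendsto_iff[OF bb lt U(2)])
qed

lemma section_tendsto_diff:
  assumes bb: "is_banach_bundle X E"
    and 1: "section_tendsto X E p \<sigma> x u F"
    and 2: "section_tendsto X E p \<tau> x v F"
  shows "section_tendsto X E p (\<lambda>t. \<sigma> t - \<tau> t) x (u - v) F"
proof -
  interpret vector_space "smult_fib E" by (rule is_banach_bundleD[OF bb])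
  show ?thesis
    using section_tendsto_add[OF bb 1 section_tendsto_scale[OF bb 2 tendsto_const[of "- 1"]]]
    by simp
qed

lemma continuous_map_total_spaceD:
  assumes "continuous_map (total_space X F) (total_space X E) (\<lambda>(x, f). (x, g x f))"
    and "section_tendsto X F p \<sigma> x f \<F>"
  shows "section_tendsto X E p (\<lambda>t. g (p t) (\<sigma> t)) x (g x f) \<F>"
  using continuous_map_limit[OF assms] by (simp add: o_def)

lemma continuous_map_total_spaceI:
  assumes "\<And>z. z \<in> topspace T \<Longrightarrow> section_tendsto X E fst (\<lambda>t. g (fst t) (snd t))
      (fst z) (g (fst z) (snd z)) (atin T z)"
  shows "continuous_map T (total_space X E) (\<lambda>(x, f). (x, g x f))"
  using assms by (simp add: continuous_map_atin case_prod_unfold)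

lemma section_tendsto_id:
  assumes bb: "is_banach_bundle X E" and z: "z \<in> topspace (total_space X E)"
  shows "section_tendsto X E fst snd (fst z) (snd z) (atin (total_space X E) z)"
    and "limitin X fst (fst z) (atin (total_space X E) z)"
    and "fst z \<in> topspace X" "snd z \<in> fib E (fst z)"
proof -
  show 1: "section_tendsto X E fst snd (fst z) (snd z) (atin (total_space X E) z)"
    using limitin_atin_id[OF z] by simp
  show "limitin X fst (fst z) (atin (total_space X E) z)"
    by (rule section_tendstoE[OF bb 1])
  show "fst z \<in> topspace X" "snd z \<in> fib E (fst z)"
    using z by (auto simp: topspace_total_space[OF bb])
qed

text \<open>Adding such maps adds their weights, so local ones multiplied by bump functions can be summed first
  and normalised afterwards, without a partition of unity.\<close>

definition weighted_right_inverse ::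
  "'x topology \<Rightarrow> ('k::real_or_complex, 'x, 'e::ab_group_add, 'm::banach) banach_bundle \<Rightarrow>
   ('k, 'x, 'f::ab_group_add, 'n::banach) banach_bundle \<Rightarrow> ('x \<Rightarrow> 'e \<Rightarrow> 'f) \<Rightarrow> ('x \<Rightarrow> 'f set) \<Rightarrow>
   ('x \<Rightarrow> real) \<Rightarrow> ('x \<Rightarrow> 'f \<Rightarrow> 'e) \<Rightarrow> bool" where
  "weighted_right_inverse X E F L V \<rho> g \<longleftrightarrow>
     continuous_map (total_space X F) (total_space X E) (\<lambda>(x, f). (x, g x f))
     \<and> continuous_map X euclideanreal \<rho> \<and> (\<forall>x\<in>topspace X. \<rho> x \<ge> 0)
     \<and> (\<forall>x\<in>topspace X. linear_between (smult_fib F) (smult_fib E) (fib F x) (fib E x) (g x)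
          \<and> (\<forall>f\<in>fib F x. L x (g x f) - smult_fib F (of_real (\<rho> x)) f \<in> V x))"

section \<open>Summing and normalising local right inverses\<close>

lemma bundle_morphism_linear:
  assumes "bundle_morphism X E F L" "x \<in> topspace X" "u \<in> fib E x" "v \<in> fib E x"
  shows "L x u \<in> fib F x" "L x (u + v) = L x u + L x v" "L x (smult_fib E a u) = smult_fib F a (L x u)"
  using assms by (auto simp: bundle_morphism_def linear_between_def)

lemma tendsto_of_real_base:
  fixes \<rho> :: "'x \<Rightarrow> real"
  assumes \<rho>: "continuous_map X euclideanreal \<rho>" and p: "limitin X p x F"
  shows "((\<lambda>t. of_real (\<rho> (p t)) :: 'k::real_normed_field) \<longlongrightarrow> of_real (\<rho> x)) F"
  using tendsto_continuous_map_limitin[of X "topspace X" \<rho>] assms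
  by (intro tendsto_of_real) (auto simp: limitin_def)

lemma weighted_right_inverse_add:
  assumes E: "is_banach_bundle X E" and F: "is_banach_bundle X F" and L: "bundle_morphism X E F L"
    and V: "finite_dim_subbundle X F V"
    and 1: "weighted_right_inverse X E F L V \<rho> g" and 2: "weighted_right_inverse X E F L V \<rho>' g'"
  shows "weighted_right_inverse X E F L V (\<lambda>x. \<rho> x + \<rho>' x) (\<lambda>x f. g x f + g' x f)"
proof -
  interpret sE: vector_space "smult_fib E" by (rule is_banach_bundleD[OF E])
  interpret sF: vector_space "smult_fib F" by (rule is_banach_bundleD[OF F])
  have c: "continuous_map (total_space X F) (total_space X E) (\<lambda>(x, f). (x, g x f + g' x f))"
  proof (rule continuous_map_total_spaceI)
    fix z assume z: "z \<in> topspace (total_space X F)"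
    note id = section_tendsto_id(1)[OF F z]
    show "section_tendsto X E fst (\<lambda>t. g (fst t) (snd t) + g' (fst t) (snd t))
      (fst z) (g (fst z) (snd z) + g' (fst z) (snd z)) (atin (total_space X F) z)"
      using 1 2 unfolding weighted_right_inverse_def
      by (intro section_tendsto_add[OF E] continuous_map_total_spaceD[OF _ id]) auto
  qed
  have "linear_between (smult_fib F) (smult_fib E) (fib F x) (fib E x) (\<lambda>f. g x f + g' x f)"
    if x: "x \<in> topspace X" for x
    using 1 2 x fib_closed[OF E x] unfolding weighted_right_inverse_def linear_between_def
    by (simp add: sE.scale_right_distrib add_ac)
  moreover have "L x (g x f + g' x f) - smult_fib F (of_real (\<rho> x + \<rho>' x)) f \<in> V x"
    if x: "x \<in> topspace X" and f: "f \<in> fib F x" for x f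
  proof -
    have g: "g x f \<in> fib E x" "g' x f \<in> fib E x"
      using 1 2 x f unfolding weighted_right_inverse_def linear_between_def by blast+
    have "(L x (g x f) - smult_fib F (of_real (\<rho> x)) f) + (L x (g' x f) - smult_fib F (of_real (\<rho>' x)) f) \<in> V x"
      using 1 2 x f unfolding weighted_right_inverse_def
      by (intro sF.subspace_add[OF subbundle_fibre_subspace[OF F V x]]) blast+
    then show ?thesis
      by (simp add: bundle_morphism_linear(2)[OF L x g] sF.scale_left_distrib algebra_simps)
  qed
  moreover have "continuous_map X euclideanreal (\<lambda>x. \<rho> x + \<rho>' x)"
    using 1 2 unfolding weighted_right_inverse_def by (intro continuous_map_add) blast+
  ultimately show ?thesis
    using 1 2 c unfolding weighted_right_inverse_def by simp
qed

lemma weighted_right_inverse_zero: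
  assumes E: "is_banach_bundle X E" and F: "is_banach_bundle X F" and L: "bundle_morphism X E F L"
    and V: "finite_dim_subbundle X F V"
  shows "weighted_right_inverse X E F L V (\<lambda>x. 0) (\<lambda>x f. 0)"
proof -
  interpret sE: vector_space "smult_fib E" by (rule is_banach_bundleD[OF E])
  interpret sF: vector_space "smult_fib F" by (rule is_banach_bundleD[OF F])
  have "continuous_map (total_space X F) (total_space X E) (\<lambda>(x, f). (x, 0))"
    by (rule continuous_map_total_spaceI[where g = "\<lambda>_ _. 0"])
      (rule section_tendsto_zero[OF E section_tendsto_id(2)[OF F]])
  moreover have "L x 0 = 0" if x: "x \<in> topspace X" for x
    using bundle_morphism_linear(2)[OF L x fib_closed(1,1)[OF E x]] by simp
  ultimately show ?thesis
    unfolding weighted_right_inverse_def linear_between_def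
    by (simp add: fib_closed[OF E] sF.subspace_0[OF subbundle_fibre_subspace[OF F V]])
qed

text \<open>A local splitting times a bump function extends by zero to all of \<open>X\<close>. By
  linearity of \<open>L x\<close> the bump function comes out as the weight.\<close>

lemma ex_weighted_right_inverse:
  assumes X: "completely_regular_space X"
    and E: "is_banach_bundle X E" and F: "is_banach_bundle X F" and L: "fredholm_morphism X E F L"
    and V: "finite_dim_subbundle X F V" and trans: "transversal_to_image X E F L V"
    and x0: "x0 \<in> topspace X"
  shows "\<exists>\<rho> g. weighted_right_inverse X E F L V \<rho> g \<and> \<rho> x0 > 0"
proof -
  interpret sE: vector_space "smult_fib E" by (rule is_banach_bundleD[OF E])
  interpret sF: vector_space "smult_fib F" by (rule is_banach_bundleD[OF F])
  obtain k where k: "has_dim (smult_fib E) {u \<in> fib E x0. L x0 u = 0} k" and L': "bundle_morphism X E F L"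
    using L x0 unfolding fredholm_morphism_def fredholm_morphism_of_index_def fredholm_of_index_def by blast
  obtain W \<phi> \<psi> S where W: "x0 \<in> W" and lt: "local_trivialisation X E W \<phi>" "local_trivialisation X F W \<psi>"
    and nc: "norm_continuous_in X W (fib F) \<psi> \<phi> S"
    and S: "\<forall>y\<in>W. linear_between (smult_fib F) (smult_fib E) (fib F y) (fib E y) (S y)
        \<and> (\<forall>f\<in>fib F y. L y (S y f) - f \<in> V y)"
    using ex_local_splitting[OF E F L' k V trans x0] by (elim exE conjE)
  note oW = local_trivialisationD(1)[OF lt(1)]
  obtain r where r: "continuous_map X euclideanreal r" "r x0 = 0" "r ` (topspace X - W) \<subseteq> {1}"
    using X oW W unfolding completely_regular_space_alt' by blast
  \<comment> \<open>Cutting at \<open>1/2\<close> instead of using \<open>1 - r\<close> makes the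
    weight vanish on a neighbourhood of every point outside \<open>W\<close>. Continuity of the
    extension by zero depends on it, because nothing bounds \<open>S\<close> near the boundary of
    \<open>W\<close>.\<close>
  define \<rho> where "\<rho> y = max 0 (1/2 - r y)" for y
  have \<rho>: "continuous_map X euclideanreal \<rho>"
    unfolding \<rho>_def by (intro continuous_map_real_max continuous_map_diff r) auto
  define g where "g y f = (if y \<in> W then smult_fib E (of_real (\<rho> y)) (S y f) else 0)" for y f
  have \<rho>0: "\<rho> y = 0" if "y \<in> topspace X" "y \<notin> W" for y
    using r(3) that by (force simp: \<rho>_def)
  have "continuous_map (total_space X F) (total_space X E) (\<lambda>(x, f). (x, g x f))"
  proof (rule continuous_map_total_spaceI)
    fix z assume z: "z \<in> topspace (total_space X F)"
    note id = section_tendsto_id[OF F z]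
    let ?\<F> = "atin (total_space X F) z"
    show "section_tendsto X E fst (\<lambda>t. g (fst t) (snd t)) (fst z) (g (fst z) (snd z)) ?\<F>"
    proof (cases "fst z \<in> W")
      case True
      have "section_tendsto X E fst (\<lambda>t. S (fst t) (snd t)) (fst z) (S (fst z) (snd z)) ?\<F>"
        by (rule section_tendsto_norm_continuous[OF F E lt(2,1) oW True order_refl order_refl nc _ id(1)])
          (use S in \<open>auto simp: linear_between_def\<close>)
      from section_tendsto_scale[OF E this tendsto_of_real_base[OF \<rho> id(2)]]
      have lim: "section_tendsto X E fst (\<lambda>t. smult_fib E (of_real (\<rho> (fst t))) (S (fst t) (snd t)))
          (fst z) (smult_fib E (of_real (\<rho> (fst z))) (S (fst z) (snd z))) ?\<F>" .
      have "\<forall>\<^sub>F t in ?\<F>. fst t \<in> W" using id(2) oW True by (auto simp: limitin_def)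
      then have "\<forall>\<^sub>F t in ?\<F>. (fst t, smult_fib E (of_real (\<rho> (fst t))) (S (fst t) (snd t)))
          = (fst t, g (fst t) (snd t))"
        by (rule eventually_mono) (simp add: g_def)
      from limitin_transform_eventually[OF this lim] show ?thesis
        using True by (simp add: g_def)
    next
      case False
      then have "r (fst z) = 1" using r(3) id(3) by blast
      moreover have "((\<lambda>t. r (fst t)) \<longlongrightarrow> r (fst z)) ?\<F>"
        using tendsto_continuous_map_limitin[of X "topspace X" r, OF _ _ id(3,2)] r(1) by simp
      ultimately have "\<forall>\<^sub>F t in ?\<F>. r (fst t) > 1/2"
        by (intro order_tendstoD(1)) auto
      then have "\<forall>\<^sub>F t in ?\<F>. (fst t, 0) = (fst t, g (fst t) (snd t))"
        by (rule eventually_mono) (simp add: g_def \<rho>_def)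
      from limitin_transform_eventually[OF this section_tendsto_zero[OF E id(2)]]
      show ?thesis using False by (simp add: g_def)
    qed
  qed
  moreover have "linear_between (smult_fib F) (smult_fib E) (fib F x) (fib E x) (g x)"
    if x: "x \<in> topspace X" for x
    using S fib_closed[OF E x] unfolding linear_between_def g_def
    by (auto simp: sE.scale_right_distrib mult.commute)
  moreover have "L x (g x f) - smult_fib F (of_real (\<rho> x)) f \<in> V x"
    if x: "x \<in> topspace X" and f: "f \<in> fib F x" for x f
  proof (cases "x \<in> W")
    case True
    have Sf: "S x f \<in> fib E x" and LS: "L x (S x f) - f \<in> V x"
      using S True f by (auto simp: linear_between_def)
    have "L x (g x f) - smult_fib F (of_real (\<rho> x)) f = smult_fib F (of_real (\<rho> x)) (L x (S x f) - f)"
      using True by (simp add: g_def bundle_morphism_linear(3)[OF L' x Sf Sf] sF.scale_right_diff_distrib)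
    then show ?thesis
      using sF.subspace_scale[OF subbundle_fibre_subspace[OF F V x] LS] by simp
  next
    case False
    have "L x 0 = 0"
      using bundle_morphism_linear(2)[OF L' x fib_closed(1,1)[OF E x]] by simp
    then show ?thesis
      using False \<rho>0[OF x] sF.subspace_0[OF subbundle_fibre_subspace[OF F V x]] by (simp add: g_def)
  qed
  ultimately have "weighted_right_inverse X E F L V \<rho> g"
    using \<rho> unfolding weighted_right_inverse_def by (simp add: \<rho>_def)
  moreover have "\<rho> x0 > 0" using r(2) by (simp add: \<rho>_def)
  ultimately show ?thesis by blast
qed

lemma ex_right_inverse_morphism:
  fixes E :: "('k::real_or_complex, 'x, 'e::ab_group_add, 'm::banach) banach_bundle"
    and F :: "('k, 'x, 'f::ab_group_add, 'n::banach) banach_bundle"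
  assumes X: "compact_space X" "Hausdorff_space X"
    and E: "is_banach_bundle X E" and F: "is_banach_bundle X F" and L: "fredholm_morphism X E F L"
    and V: "finite_dim_subbundle X F V" and trans: "transversal_to_image X E F L V"
  shows "\<exists>s. weighted_right_inverse X E F L V (\<lambda>x. 1) s"
proof -
  interpret sE: vector_space "smult_fib E" by (rule is_banach_bundleD[OF E])
  interpret sF: vector_space "smult_fib F" by (rule is_banach_bundleD[OF F])
  note L' = fredholm_morphism_imp_bundle_morphism[OF L]
  have "completely_regular_space X"
    using X by (simp add: compact_Hausdorff_or_regular_imp_normal_space normal_imp_completely_regular_space)
  then have "\<exists>q. weighted_right_inverse X E F L V (fst q) (snd q) \<and> fst q x > 0" if "x \<in> topspace X" for x
    using ex_weighted_right_inverse[OF _ E F L V trans that] by force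
  then obtain q where q: "\<And>x. x \<in> topspace X \<Longrightarrow> weighted_right_inverse X E F L V (fst (q x)) (snd (q x))"
    "\<And>x. x \<in> topspace X \<Longrightarrow> fst (q x) x > 0"
    by metis
  \<comment> \<open>The positivity sets of the weights form the cover, so a finite subcover makes
    the total weight positive everywhere.\<close>
  define O' where "O' x = {y \<in> topspace X. fst (q x) y > 0}" for x
  have "openin X (O' x)" if "x \<in> topspace X" for x
  proof -
    have "continuous_map X euclideanreal (fst (q x))"
      using q(1)[OF that] by (simp add: weighted_right_inverse_def)
    from openin_continuous_map_preimage[OF this, of "{0<..}"] show ?thesis by (simp add: O'_def)
  qed
  moreover have "topspace X \<subseteq> \<Union> (O' ` topspace X)" using q(2) by (auto simp: O'_def)
  ultimately obtain \<U> where \<U>: "finite \<U>" "\<U> \<subseteq> O' ` topspace X" "topspace X \<subseteq> \<Union> \<U>"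
    using X(1) unfolding compact_space_alt by (metis (no_types, lifting) imageE)
  obtain J where J: "finite J" "J \<subseteq> topspace X" "\<U> = O' ` J"
    using finite_subset_image[OF \<U>(1,2)] by blast
  define R where "R x = (\<Sum>i\<in>J. fst (q i) x)" for x
  have "weighted_right_inverse X E F L V (\<lambda>x. \<Sum>i\<in>J. fst (q i) x) (\<lambda>x f. \<Sum>i\<in>J. snd (q i) x f)"
    using J(1,2)
  proof (induction J)
    case empty
    then show ?case using weighted_right_inverse_zero[OF E F L' V] by simp
  next
    case (insert i J)
    then show ?case
      using weighted_right_inverse_add[OF E F L' V q(1)[of i], of "\<lambda>x. \<Sum>i\<in>J. fst (q i) x"] by simp
  qed
  then obtain G where G: "weighted_right_inverse X E F L V R G" unfolding R_def by blast
  have Rpos: "R x > 0" if x: "x \<in> topspace X" for x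
  proof -
    obtain i where i: "i \<in> J" "fst (q i) x > 0" using \<U>(3) x unfolding J(3) O'_def by blast
    have "fst (q j) x \<ge> 0" if "j \<in> J" for j
      using q(1)[of j] J(2) that x by (auto simp: weighted_right_inverse_def)
    then show ?thesis unfolding R_def using J(1) i by (intro sum_pos2)
  qed
  \<comment> \<open>\<open>L\<close> after \<open>G\<close> is multiplication by \<open>R\<close>
    modulo \<open>V\<close>, so dividing by \<open>R\<close> normalises the weight to
    \<open>1\<close>.\<close>
  define s where "s x f = smult_fib E (of_real (1 / R x)) (G x f)" for x f
  have cR: "continuous_map X euclideanreal (\<lambda>x. 1 / R x)"
    using G Rpos unfolding weighted_right_inverse_def
    by (intro continuous_map_real_divide) force+
  have "continuous_map (total_space X F) (total_space X E) (\<lambda>(x, f). (x, s x f))"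
  proof (rule continuous_map_total_spaceI)
    fix z assume z: "z \<in> topspace (total_space X F)"
    note id = section_tendsto_id[OF F z]
    have "continuous_map (total_space X F) (total_space X E) (\<lambda>(x, f). (x, G x f))"
      using G by (simp add: weighted_right_inverse_def)
    from section_tendsto_scale[OF E continuous_map_total_spaceD[OF this id(1)]
        tendsto_of_real_base[OF cR id(2)]]
    show "section_tendsto X E fst (\<lambda>t. s (fst t) (snd t)) (fst z) (s (fst z) (snd z))
        (atin (total_space X F) z)"
      by (simp only: s_def)
  qed
  moreover have "linear_between (smult_fib F) (smult_fib E) (fib F x) (fib E x) (s x)"
    if x: "x \<in> topspace X" for x
    using G x fib_closed[OF E x] unfolding weighted_right_inverse_def linear_between_def s_def
    by (simp add: sE.scale_right_distrib mult.commute)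
  moreover have "L x (s x f) - smult_fib F (of_real 1) f \<in> V x"
    if x: "x \<in> topspace X" and f: "f \<in> fib F x" for x f
  proof -
    have Gf: "G x f \<in> fib E x" and LG: "L x (G x f) - smult_fib F (of_real (R x)) f \<in> V x"
      using G x f by (auto simp: weighted_right_inverse_def linear_between_def)
    have "(of_real (1 / R x) :: 'k) * of_real (R x) = 1"
      using Rpos[OF x] by (simp flip: of_real_mult)
    then have "smult_fib F (of_real (1 / R x)) (L x (G x f) - smult_fib F (of_real (R x)) f)
        = L x (s x f) - f"
      by (simp add: s_def bundle_morphism_linear(3)[OF L' x Gf Gf] sF.scale_right_diff_distrib
          del: of_real_divide of_real_1)
    then show ?thesis
      using sF.subspace_scale[OF subbundle_fibre_subspace[OF F V x] LG, of "of_real (1 / R x)"] by simp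
  qed
  ultimately have "weighted_right_inverse X E F L V (\<lambda>x. 1) s"
    unfolding weighted_right_inverse_def by simp
  then show ?thesis by blast
qed

text \<open>The common bundle behind the isomorphism consists of the triples \<open>(a, v, w)\<close> with
  \<open>L a = v + w\<close>: a right inverse modulo \<open>V\<close> identifies it with \<open>E(L, V) \<oplus> W\<close> through
  \<open>a = u + s w\<close>, and one modulo \<open>W\<close> with \<open>E(L, W) \<oplus> V\<close>.\<close>

definition exchange_map ::
  "('x \<Rightarrow> 'e::ab_group_add \<Rightarrow> 'f::ab_group_add) \<Rightarrow> ('x \<Rightarrow> 'f \<Rightarrow> 'e) \<Rightarrow> ('x \<Rightarrow> 'f \<Rightarrow> 'e) \<Rightarrow> 'x \<Rightarrow> 'e \<times> 'f \<Rightarrow> 'e \<times> 'f"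
  where
  "exchange_map L s s' x p = (let a = fst p + s x (snd p); v = L x a - snd p in (a - s' x v, v))"

text \<open>On input \<open>(a - s' v, v)\<close>, adding \<open>s' v\<close> restores
  \<open>a\<close>, and \<open>L a - v\<close> is the old \<open>w\<close>. Both directions pass
  through the same triple, and everything cancels.\<close>

lemma exchange_map_inverse: "exchange_map L s' s x (exchange_map L s s' x p) = p"
  by (simp add: exchange_map_def Let_def)

text \<open>Exchanging the pair \<open>V\<close>, \<open>s\<close> with the pair \<open>W\<close>,
  \<open>s'\<close> yields the continuity of the inverse, so one direction is enough.\<close>

lemma continuous_map_exchange_map:
  fixes E :: "('k::real_or_complex, 'x, 'e::ab_group_add, 'm::banach) banach_bundle"
    and F :: "('k, 'x, 'f::ab_group_add, 'n::banach) banach_bundle"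
  assumes E: "is_banach_bundle X E" and F: "is_banach_bundle X F" and L: "fredholm_morphism X E F L"
    and V: "finite_dim_subbundle X F V" "transversal_to_image X E F L V"
    and W: "finite_dim_subbundle X F W" "transversal_to_image X E F L W"
    and s: "weighted_right_inverse X E F L V (\<lambda>x. 1) s"
    and s': "weighted_right_inverse X E F L W (\<lambda>x. 1) s'"
  shows "continuous_map
     (whitney_sum (subbundle_space X E (preimage_subbundle E L V)) (subbundle_space X F W))
     (whitney_sum (subbundle_space X E (preimage_subbundle E L W)) (subbundle_space X F V))
     (\<lambda>(x, p). (x, exchange_map L s s' x p))"
proof -
  note L' = fredholm_morphism_imp_bundle_morphism[OF L]
  interpret sF: vector_space "smult_fib F" by (rule is_banach_bundleD[OF F])
  let ?A = "subbundle_space X E (preimage_subbundle E L V)" and ?B = "subbundle_space X F W"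
  note EV = finite_dim_subbundle_preimage[OF E F L V]
  define a where "a z = fst (snd z) + s (fst z) (snd (snd z))" for z :: "'x \<times> 'e \<times> 'f"
  define v where "v z = L (fst z) (a z) - snd (snd z)" for z :: "'x \<times> 'e \<times> 'f"
  have ex: "exchange_map L s s' (fst z) (snd z) = (a z - s' (fst z) (v z), v z)" for z
    by (simp add: exchange_map_def a_def v_def Let_def)
  have mem: "a z - s' (fst z) (v z) \<in> preimage_subbundle E L W (fst z) \<and> v z \<in> V (fst z) \<and> fst z \<in> topspace X"
    if z: "z \<in> topspace (whitney_sum ?A ?B)" for z
  proof -
    obtain x u w where zx: "z = (x, (u, w))" by (metis prod.collapse)
    have x: "x \<in> topspace X" and u: "u \<in> fib E x" "L x u \<in> V x" and w: "w \<in> W x"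
      using z by (auto simp: zx topspace_whitney_sum topspace_subbundle_space[OF E EV]
          topspace_subbundle_space[OF F W(1)] preimage_subbundle_def)
    have wF: "w \<in> fib F x" using w finite_dim_subbundleD(1)[OF W(1) x] by blast
    note subV = subbundle_fibre_subspace[OF F V(1) x] and subW = subbundle_fibre_subspace[OF F W(1) x]
    have sw: "s x w \<in> fib E x" "L x (s x w) - w \<in> V x"
      using s x wF by (auto simp: weighted_right_inverse_def linear_between_def)
    have aE: "a z \<in> fib E x" using fib_closed(2)[OF E x u(1) sw(1)] by (simp add: a_def zx)
    \<comment> \<open>The first summand lies in \<open>V\<close> because \<open>u\<close> belongs to
      \<open>E(L, V)\<close>, the second because \<open>s\<close> inverts \<open>L\<close> modulo
      \<open>V\<close>.\<close>
    have "v z = L x u + (L x (s x w) - w)"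
      by (simp add: v_def a_def zx bundle_morphism_linear(2)[OF L' x u(1) sw(1)])
    then have vV: "v z \<in> V x" using sF.subspace_add[OF subV u(2) sw(2)] by simp
    then have vF: "v z \<in> fib F x" using finite_dim_subbundleD(1)[OF V(1) x] by blast
    have sv: "s' x (v z) \<in> fib E x" "L x (s' x (v z)) - v z \<in> W x"
      using s' x vF by (auto simp: weighted_right_inverse_def linear_between_def)
    have dE: "a z - s' x (v z) \<in> fib E x" by (rule fib_closed(3)[OF E x aE sv(1)])
    \<comment> \<open>\<open>L a = v + w\<close> by the choice of \<open>v\<close>; removing
      \<open>L (s' v)\<close>, which is \<open>v\<close> modulo \<open>W\<close>, leaves an element
      of \<open>W\<close>.\<close>
    have "L x (a z) = L x (a z - s' x (v z)) + L x (s' x (v z))"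
      using bundle_morphism_linear(2)[OF L' x dE sv(1)] by simp
    then have "L x (a z - s' x (v z)) = w - (L x (s' x (v z)) - v z)"
      by (simp add: v_def zx algebra_simps)
    then have "L x (a z - s' x (v z)) \<in> W x" using sF.subspace_diff[OF subW w sv(2)] by simp
    then show ?thesis using vV dE x by (simp add: preimage_subbundle_def zx)
  qed
  have lim: "section_tendsto X E fst (\<lambda>t. a t - s' (fst t) (v t)) (fst z) (a z - s' (fst z) (v z)) \<F>
      \<and> section_tendsto X F fst v (fst z) (v z) \<F>"
    if z: "z \<in> topspace (whitney_sum ?A ?B)" and \<F>: "\<F> = atin (whitney_sum ?A ?B) z" for z \<F>
  proof -
    have "limitin ?A (\<lambda>t. (fst t, fst (snd t))) (fst z, fst (snd z)) \<F>"
      "limitin ?B (\<lambda>t. (fst t, snd (snd t))) (fst z, snd (snd z)) \<F>"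
      using continuous_map_whitney_sum_proj[of ?A ?B] z
      unfolding continuous_map_atin case_prod_unfold \<F> by blast+
    then have u: "section_tendsto X E fst (\<lambda>t. fst (snd t)) (fst z) (fst (snd z)) \<F>"
      and w: "section_tendsto X F fst (\<lambda>t. snd (snd t)) (fst z) (snd (snd z)) \<F>"
      by (simp_all add: subbundle_space_def limitin_subtopology)
    have cs: "continuous_map (total_space X F) (total_space X E) (\<lambda>(x, f). (x, s x f))"
      "continuous_map (total_space X F) (total_space X E) (\<lambda>(x, f). (x, s' x f))"
      using s s' by (simp_all add: weighted_right_inverse_def)
    have a: "section_tendsto X E fst a (fst z) (a z) \<F>"
      unfolding a_def by (rule section_tendsto_add[OF E u continuous_map_total_spaceD[OF cs(1) w]])
    have v: "section_tendsto X F fst v (fst z) (v z) \<F>"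
      unfolding v_def
      by (rule section_tendsto_diff[OF F section_tendsto_morphism[OF E F L' a] w])
    with section_tendsto_diff[OF E a continuous_map_total_spaceD[OF cs(2) v]]
    show ?thesis by blast
  qed
  show ?thesis
    unfolding continuous_map_whitney_sum subbundle_space_def[of X E "preimage_subbundle E L W"]
      subbundle_space_def[of X F V] continuous_map_in_subtopology
    unfolding case_prod_unfold fst_conv snd_conv ex continuous_map_atin
    using lim mem by auto
qed

lemma bundle_isomorphic_exchange:
  assumes X: "compact_space X" "Hausdorff_space X"
    and E: "is_banach_bundle X E" and F: "is_banach_bundle X F" and L: "fredholm_morphism X E F L"
    and V: "finite_dim_subbundle X F V" "transversal_to_image X E F L V"
    and W: "finite_dim_subbundle X F W" "transversal_to_image X E F L W"
  shows "bundle_isomorphic (smult_pair (smult_fib E) (smult_fib F)) (smult_pair (smult_fib E) (smult_fib F))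
     (whitney_sum (subbundle_space X E (preimage_subbundle E L V)) (subbundle_space X F W))
     (whitney_sum (subbundle_space X E (preimage_subbundle E L W)) (subbundle_space X F V))"
proof -
  let ?Z = "whitney_sum (subbundle_space X E (preimage_subbundle E L V)) (subbundle_space X F W)"
  note L' = fredholm_morphism_imp_bundle_morphism[OF L]
  interpret sF: vector_space "smult_fib F" by (rule is_banach_bundleD[OF F])
  interpret sE: vector_space "smult_fib E" by (rule is_banach_bundleD[OF E])
  note EV = finite_dim_subbundle_preimage[OF E F L V]
  obtain s where s: "weighted_right_inverse X E F L V (\<lambda>x. 1) s"
    using ex_right_inverse_morphism[OF X E F L V] by blast
  obtain s' where s': "weighted_right_inverse X E F L W (\<lambda>x. 1) s'"
    using ex_right_inverse_morphism[OF X E F L W] by blast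
  have slin: "t x f \<in> fib E x" "t x (f + g) = t x f + t x g" "t x (smult_fib F c f) = smult_fib E c (t x f)"
    if "x \<in> topspace X" "f \<in> fib F x" "g \<in> fib F x" "t = s \<or> t = s'" for x f g c t
    using s s' that by (auto simp: weighted_right_inverse_def linear_between_def)
  have memD: "x \<in> topspace X \<and> fst p \<in> fib E x \<and> snd p \<in> fib F x"
    if "(x, p) \<in> topspace ?Z"
    for x p
    using that finite_dim_subbundleD(1)[OF W(1)]
    by (cases p) (auto simp: topspace_whitney_sum topspace_subbundle_space[OF E EV]
          topspace_subbundle_space[OF F W(1)] preimage_subbundle_def)
  show ?thesis
  proof (rule bundle_isomorphicI[OF continuous_map_exchange_map[OF E F L V W s s']
        continuous_map_exchange_map[OF E F L W V s' s] exchange_map_inverse exchange_map_inverse])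
    fix x p q
    assume p: "(x, p) \<in> topspace ?Z"
    have x: "x \<in> topspace X" and p': "fst p \<in> fib E x" "snd p \<in> fib F x" using memD[OF p] by auto
    note cE = fib_closed[OF E x] and cF = fib_closed[OF F x]
    have a: "fst p + s x (snd p) \<in> fib E x" using cE(2)[OF p'(1) slin(1)[OF x p'(2) p'(2)]] by blast
    then have v: "L x (fst p + s x (snd p)) - snd p \<in> fib F x"
      using p' bundle_morphism_linear(1)[OF L' x a a] by (intro cF(3))
    show "exchange_map L s s' x (smult_pair (smult_fib E) (smult_fib F) c p)
        = smult_pair (smult_fib E) (smult_fib F) c (exchange_map L s s' x p)" for c
    proof -
      have 1: "smult_fib E c (fst p) + s x (smult_fib F c (snd p)) = smult_fib E c (fst p + s x (snd p))"
        by (simp add: slin(3)[OF x p'(2) p'(2)] sE.scale_right_distrib)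
      have 2: "L x (smult_fib E c (fst p + s x (snd p))) - smult_fib F c (snd p)
          = smult_fib F c (L x (fst p + s x (snd p)) - snd p)"
        by (simp only: bundle_morphism_linear(3)[OF L' x a a] sF.scale_right_diff_distrib)
      show ?thesis
        unfolding exchange_map_def Let_def smult_pair_apply fst_conv snd_conv 1 2
        by (simp add: slin(3)[OF x v v] sE.scale_right_diff_distrib)
    qed
    assume q: "(x, q) \<in> topspace ?Z"
    have q': "fst q \<in> fib E x" "snd q \<in> fib F x" using memD[OF q] by auto
    have b: "fst q + s x (snd q) \<in> fib E x" using cE(2)[OF q'(1) slin(1)[OF x q'(2) q'(2)]] by blast
    then have w: "L x (fst q + s x (snd q)) - snd q \<in> fib F x"
      using q' bundle_morphism_linear(1)[OF L' x b b] by (intro cF(3))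
    have 1: "fst (p + q) + s x (snd (p + q)) = (fst p + s x (snd p)) + (fst q + s x (snd q))"
      by (simp add: slin(2)[OF x p'(2) q'(2)])
    have 2: "L x ((fst p + s x (snd p)) + (fst q + s x (snd q))) - snd (p + q)
        = (L x (fst p + s x (snd p)) - snd p) + (L x (fst q + s x (snd q)) - snd q)"
      by (simp add: bundle_morphism_linear(2)[OF L' x a b])
    show "exchange_map L s s' x (p + q) = exchange_map L s s' x p + exchange_map L s s' x q"
      unfolding exchange_map_def Let_def 1 2
      by (simp add: slin(2)[OF x v w])
  qed
qed

theorem theorem3p2:
  fixes X :: "'x topology"
    and E :: "('k::real_or_complex, 'x, 'e::ab_group_add, 'm::banach) banach_bundle"
    and F :: "('k, 'x, 'f::ab_group_add, 'n::banach) banach_bundle"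
    and L :: "'x \<Rightarrow> 'e \<Rightarrow> 'f"
    and V W :: "'x \<Rightarrow> 'f set"
  assumes "compact_space X" and "Hausdorff_space X"
    and "is_banach_bundle X E" and "is_banach_bundle X F"
    and "fredholm_morphism X E F L"
    and "finite_dim_subbundle X F V" and "finite_dim_subbundle X F W"
    and "transversal_to_image X E F L V" and "transversal_to_image X E F L W"
  shows "K_diff X (K_class X E (preimage_subbundle E L V)) (K_class X F V)
           = K_diff X (K_class X E (preimage_subbundle E L W)) (K_class X F W)
         \<and> K_diff X (K_class X E (preimage_subbundle E L V)) (K_class X F V)
             \<in> carrier (K_group X)"
proof -
  note EV = finite_dim_subbundle_preimage[OF assms(3,4,5,6,8)]
    and EW = finite_dim_subbundle_preimage[OF assms(3,4,5,7,9)]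
  note iso = bundle_isomorphic_exchange[OF assms(1-5) assms(6,8,7,9)]
  note vb = is_vector_bundle_subbundle_space[OF assms(3) EV] is_vector_bundle_subbundle_space[OF assms(4,6)]
    is_vector_bundle_subbundle_space[OF assms(3) EW] is_vector_bundle_subbundle_space[OF assms(4,7)]
  show ?thesis
    unfolding K_class_def using K_diff_eqI[OF vb iso] by blast
qed

end
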